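(* Let $k\in\mathbb N$ and $s=\lceil k/12\rceil$. Every $\mathcal K_{2,s}$-free digraph $D$ with $n$ vertices and more than $(k-1)n$ arcs contains every antidirected tree with $k$ arcs (as a subdigraph).
   Context: A digraph is finite, without loops or parallel arcs, but may contain both arcs $xy$ and $yx$. An antidirected tree is an orientation of a tree containing no directed path of length two. A digraph $D$ is $\mathcal K_{2,s}$-free if it does not contain as a subdigraph any of the three orientations of the complete bipartite graph $K_{2,s}$ in which each of the two vertices of the class of size two has either out-degree $0$ or in-degree $0$ (i.e. both vertices have all arcs pointing out, both have all arcs pointing in, or one has all arcs out and the other all arcs in). "Contains $T$" means there is an injective map $f:V(T)\to V(D)$ such that $f(x)f(y)$ is an arc of $D$ for every arc $xy$ of $T$. *)

theory Defs
  imports Complex_Main "Graph_Theory.Graph_Theory"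
begin

definition oriented_graph :: "('a,'b) pre_digraph \<Rightarrow> bool" where
  "oriented_graph G \<longleftrightarrow> digraph G \<and> asym (arcs_ends G)"

text \<open>
  An undirected graph is a symmetric digraph here, so an undirected cycle is a cycle of length
  at least 3: every edge gives rise to a closed walk of length 2. The library predicate
  \<open>tree\<close> forbids directed cycles of every length, so it fails for every symmetric digraph with an
  edge, and for an oriented graph it does not exclude cycles of the underlying graph.
\<close>
definition undirected_tree :: "('a,'b) pre_digraph \<Rightarrow> bool" where
  "undirected_tree G \<longleftrightarrow>
     graph G \<and> Digraph_Component.connected G \<and>
     \<not> (\<exists>p. pre_digraph.cycle G p \<and> 3 \<le> length p)"

definition antidirected_tree :: "('a,'b) pre_digraph \<Rightarrow> bool" where
  "antidirected_tree T \<longleftrightarrow>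
     oriented_graph T \<and> undirected_tree (with_proj (mk_symmetric T)) \<and>
     \<not> (\<exists>u p v. pre_digraph.apath T u p v \<and> length p = 2)"

text \<open>
  Up to isomorphism there are three such orientations: all arcs leave the class \<open>U\<close> of size two,
  all arcs enter it, or one vertex of \<open>U\<close> has only outgoing and the other only incoming arcs.
\<close>
definition K2s_orientation :: "nat \<Rightarrow> ('a,'b) pre_digraph \<Rightarrow> bool" where
  "K2s_orientation s H \<longleftrightarrow>
     oriented_graph H \<and>
     (\<exists>U W. verts H = U \<union> W \<and> U \<inter> W = {} \<and> card U = 2 \<and> card W = s \<and>
        arcs_ends (with_proj (mk_symmetric H)) = U \<times> W \<union> W \<times> U \<and>
        (\<forall>u \<in> U. out_degree H u = 0 \<or> in_degree H u = 0))"

definition K2s_free :: "nat \<Rightarrow> ('a,'b) pre_digraph \<Rightarrow> bool" where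
  "K2s_free s D \<longleftrightarrow> \<not> (\<exists>H. subgraph H D \<and> K2s_orientation s H)"

definition contains_digraph :: "('a,'b) pre_digraph \<Rightarrow> ('c,'d) pre_digraph \<Rightarrow> bool" where
  "contains_digraph D T \<longleftrightarrow>
     (\<exists>f. f ` verts T \<subseteq> verts D \<and> inj_on f (verts T) \<and>
        (\<forall>x y. x \<rightarrow>\<^bsub>T\<^esub> y \<longrightarrow> f x \<rightarrow>\<^bsub>D\<^esub> f y))"

end

theory Submission
  imports Defs
begin

text \<open>With \<open>c = s - 1\<close>, being \<open>K\<^bsub>2,s\<^esub>\<close>-free means that the in- or out-neighbourhoods of two distinct vertices
  share at most \<open>c < k / 12\<close> vertices. Root the tree at a vertex of maximum degree; reversing all arcs if
  necessary, the root is a source. Vertices of the tree alternate between sources and sinks, so only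
  out-degrees of images of sources and in-degrees of images of sinks matter, and deleting vertices of small
  degree yields a host in which these degrees are at least \<open>x\<close> and \<open>y\<close>, for any prescribed \<open>x + y = k + 1\<close>.

  If the root, or the root together with one sink, has almost all vertices as neighbours, the host is
  chosen such that the root can be mapped to a vertex of large out-degree. Its out-neighbourhood is reserved
  for the children of the root, and it meets every other neighbourhood in at most \<open>c\<close> vertices, so that the
  remaining vertices can be embedded greedily. Otherwise \<open>x\<close> and \<open>y\<close> are balanced, the inner vertices are
  embedded one at a time while Hall's condition for the leaves is maintained for small sets of vertices,
  and the leaves are embedded at the end by Hall's theorem.\<close>

section \<open>Counting and systems of distinct representatives\<close>

text \<open>Since \<open>x + y = k + 1\<close>, one of the two kinds of degree is at most about k/2,
  and a greedy embedding of k + 1 vertices may find a neighbourhood completely used up. What helps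
  is that few neighbourhoods are large together: four of size k/2 with pairwise intersections of at
  most c < k/12 cover more than k vertices, so Hall's condition for the leaves is in doubt only for
  at most three tree vertices. Images are vertices of D and not copies of them, so sources and sinks
  compete for room; forbidding all three orientations bounds mixed intersections, of an out- with an
  in-neighbourhood, by c as well. Let D be the number of children of the root and b the largest
  number of children of a sink. The balanced method runs when at least 3c + 1 vertices lie outside
  the root and both families of children and D is not far above k/2. The factor 12 is consumed at
  the border of this case: b \<le> 2c and at most 3c remaining vertices force D \<ge> k - 5c, and
  \<open>2 * D \<ge> k + 2 * c + 1\<close> follows from k > 12c; a dominating pair with 3c remaining
  vertices consumes it too.\<close>

lemma card_Un2_ge:
  assumes "finite A" "finite B" "card (A \<inter> B) \<le> c"
  shows "card A + card B \<le> card (A \<union> B) + c"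
  using card_Un_Int[OF assms(1,2)] assms(3) by linarith

lemma card_Un3_ge:
  assumes fin: "finite A" "finite B" "finite C"
    and "card (A \<inter> B) \<le> c" "card (A \<inter> C) \<le> c" "card (B \<inter> C) \<le> c"
  shows "card A + card B + card C \<le> card (A \<union> B \<union> C) + 3 * c"
proof -
  have "card ((A \<union> B) \<inter> C) \<le> card (A \<inter> C) + card (B \<inter> C)"
    by (simp add: Int_Un_distrib2 card_Un_le)
  moreover have "card (A \<union> B) + card C \<le> card (A \<union> B \<union> C) + card ((A \<union> B) \<inter> C)"
    using fin by (intro card_Un2_ge) auto
  ultimately show ?thesis
    using card_Un2_ge[OF fin(1,2) assms(4)] assms(5,6) by linarith
qed

text \<open>As \<open>p\<close> lies in both \<open>A \<inter> C\<close> and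
  \<open>B \<inter> C\<close>, adding \<open>C\<close> loses at most \<open>2 * c - 1\<close>.
  Candidates for the next image all have the image of the parent as a neighbour, and this gain of
  one enters the estimate for three bad candidates.\<close>

lemma card_Un3_common_ge:
  assumes fin: "finite A" "finite B" "finite C"
    and "card (A \<inter> B) \<le> c" "card (A \<inter> C) \<le> c" "card (B \<inter> C) \<le> c"
    and p: "p \<in> A" "p \<in> B" "p \<in> C"
  shows "card A + card B + card C + 1 \<le> card (A \<union> B \<union> C) + 3 * c"
proof -
  have "card (A \<inter> C) + card (B \<inter> C) = card (A \<inter> C \<union> B \<inter> C) + card (A \<inter> C \<inter> (B \<inter> C))"
    using fin by (intro card_Un_Int) auto
  moreover have "card (A \<inter> C \<inter> (B \<inter> C)) > 0"
    using fin p by (auto simp: card_gt_0_iff)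
  moreover have "card (A \<union> B) + card C = card (A \<union> B \<union> C) + card (A \<inter> C \<union> B \<inter> C)"
    using card_Un_Int[of "A \<union> B" C] fin by (simp add: Int_Un_distrib2)
  ultimately show ?thesis
    using card_Un2_ge[OF fin(1,2) assms(4)] assms(5,6) by linarith
qed

lemma card_Un4_ge:
  assumes fin: "finite A" "finite B" "finite C" "finite D"
    and "card (A \<inter> B) \<le> c" "card (A \<inter> C) \<le> c" "card (B \<inter> C) \<le> c"
    and "card (A \<inter> D) \<le> c" "card (B \<inter> D) \<le> c" "card (C \<inter> D) \<le> c"
  shows "card A + card B + card C + card D \<le> card (A \<union> B \<union> C \<union> D) + 6 * c"
proof -
  have "card ((A \<union> B \<union> C) \<inter> D) \<le> card (A \<inter> D) + card (B \<inter> D) + card (C \<inter> D)"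
    using card_Un_le[of "(A \<union> B) \<inter> D" "C \<inter> D"] card_Un_le[of "A \<inter> D" "B \<inter> D"]
    by (simp add: Int_Un_distrib2)
  hence "card (A \<union> B \<union> C) + card D \<le> card (A \<union> B \<union> C \<union> D) + 3 * c"
    using fin assms(8-10) by (intro card_Un2_ge) auto
  thus ?thesis using card_Un3_ge[OF fin(1-3) assms(5-7)] by linarith
qed

lemma card_Un4_common_ge:
  assumes fin: "finite A" "finite B" "finite C" "finite D"
    and "card (A \<inter> B) \<le> c" "card (A \<inter> C) \<le> c" "card (B \<inter> C) \<le> c"
    and "card (A \<inter> D) \<le> c" "card (B \<inter> D) \<le> c" "card (C \<inter> D) \<le> c"
    and p: "p \<in> A" "p \<in> B" "p \<in> C"
  shows "card A + card B + card C + card D + 1 \<le> card (A \<union> B \<union> C \<union> D) + 6 * c"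
proof -
  have "card ((A \<union> B \<union> C) \<inter> D) \<le> card (A \<inter> D) + card (B \<inter> D) + card (C \<inter> D)"
    using card_Un_le[of "(A \<union> B) \<inter> D" "C \<inter> D"] card_Un_le[of "A \<inter> D" "B \<inter> D"]
    by (simp add: Int_Un_distrib2)
  hence "card (A \<union> B \<union> C) + card D \<le> card (A \<union> B \<union> C \<union> D) + 3 * c"
    using fin assms(8-10) by (intro card_Un2_ge) auto
  thus ?thesis using card_Un3_common_ge[OF fin(1-3) assms(5-7) p] by linarith
qed

text \<open>Bonferroni's inequality, cut off after the pairs.\<close>

lemma card_UN_ge:
  assumes "finite X" "\<And>i. i \<in> X \<Longrightarrow> finite (S i)"
    and "\<And>i j. i \<in> X \<Longrightarrow> j \<in> X \<Longrightarrow> i \<noteq> j \<Longrightarrow> card (S i \<inter> S j) \<le> c"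
  shows "(\<Sum>i\<in>X. card (S i)) \<le> card (\<Union>i\<in>X. S i) + c * (card X choose 2)"
  using assms
proof (induction X rule: finite_induct)
  case (insert a X)
  let ?U = "\<Union>i\<in>X. S i"
  have "card (S a \<inter> ?U) \<le> (\<Sum>i\<in>X. card (S a \<inter> S i))"
    using card_UN_le[OF insert.hyps(1), of "\<lambda>i. S a \<inter> S i"] unfolding Int_UN_distrib .
  also have "\<dots> \<le> (\<Sum>i\<in>X. c)"
    by (intro sum_mono insert.prems(2)) (use insert.hyps in auto)
  finally have "card (S a \<inter> ?U) \<le> c * card X" by (simp add: mult.commute)
  moreover have "card (S a) + card ?U = card (S a \<union> ?U) + card (S a \<inter> ?U)"
    using insert.prems(1) insert.hyps(1) by (intro card_Un_Int) auto
  moreover have "(\<Sum>i\<in>X. card (S i)) \<le> card ?U + c * (card X choose 2)"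
    by (rule insert.IH) (use insert.prems in auto)
  moreover have "c * (Suc (card X) choose 2) = c * card X + c * (card X choose 2)"
    by (simp add: numeral_2_eq_2 algebra_simps)
  ultimately show ?case using insert.hyps by (simp add: UN_insert)
qed simp

text \<open>Double counting of the pairs \<open>(z, w)\<close> with \<open>w \<in> S z\<close>: each
  counted \<open>z\<close> contributes at least \<open>b\<close>, each \<open>w\<close> at most
  \<open>c\<close>.\<close>

lemma card_many_hits_le:
  assumes Z: "finite Z" and W: "finite W"
    and hit: "\<And>w. w \<in> W \<Longrightarrow> card {z \<in> Z. w \<in> S z} \<le> c"
  shows "b * card {z \<in> Z. b \<le> card (S z \<inter> W)} \<le> c * card W"
proof -
  let ?B = "{z \<in> Z. b \<le> card (S z \<inter> W)}"
  have "b * card ?B = (\<Sum>z\<in>?B. b)" by simp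
  also have "\<dots> \<le> (\<Sum>z\<in>?B. card (S z \<inter> W))" by (intro sum_mono) auto
  also have "\<dots> \<le> (\<Sum>z\<in>Z. card (S z \<inter> W))" using Z by (intro sum_mono2) auto
  also have "\<dots> = (\<Sum>z\<in>Z. \<Sum>w\<in>W. if w \<in> S z then 1 else 0)"
    using W by (intro sum.cong) (auto simp: sum.If_cases Int_commute Int_def)
  also have "\<dots> = (\<Sum>w\<in>W. \<Sum>z\<in>Z. if w \<in> S z then 1 else 0)" by (rule sum.swap)
  also have "\<dots> = (\<Sum>w\<in>W. card {z \<in> Z. w \<in> S z})"
    using Z by (intro sum.cong) (auto simp: sum.If_cases Int_def)
  also have "\<dots> \<le> (\<Sum>w\<in>W. c)" using hit by (intro sum_mono) auto
  finally show ?thesis by (simp add: mult.commute)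
qed

lemma few_many_hits:
  assumes "finite Z" "finite W" "\<And>w. w \<in> W \<Longrightarrow> card {z \<in> Z. w \<in> S z} \<le> c"
    and "card W < 2 * b" "0 < c"
  shows "card {z \<in> Z. b \<le> card (S z \<inter> W)} < 2 * c"
proof -
  have "b * card {z \<in> Z. b \<le> card (S z \<inter> W)} \<le> c * card W"
    using assms(1-3) by (rule card_many_hits_le)
  also have "\<dots> < c * (2 * b)" using assms(4,5) by (simp only: nat_mult_less_cancel_disj)
  finally have "b * card {z \<in> Z. b \<le> card (S z \<inter> W)} < b * (2 * c)" by (simp add: ac_simps)
  thus ?thesis by (simp only: nat_mult_less_cancel_disj)
qed

section \<open>Hall's theorem with demands\<close>

lemma inj_into_large:
  assumes "finite A" "finite B" "card A \<le> card B"
  obtains g where "inj_on g A" "g ` A \<subseteq> B"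
  using card_le_inj[OF assms] by blast

text \<open>The tight sets of size at most \<open>m\<close> are closed under union, so a single tight set \<open>T\<close> contains
  all of them; removing from \<open>F x\<close> what \<open>T\<close> can reach keeps Hall's condition for every set avoiding \<open>x\<close>.\<close>

lemma hall_extension:
  fixes F :: "'i \<Rightarrow> 'v set" and dem :: "'i \<Rightarrow> nat"
  assumes S: "finite S" "x \<in> S" "1 \<le> m" and fin: "\<And>i. i \<in> S \<Longrightarrow> finite (F i)"
    and le: "\<And>X. X \<subseteq> S \<Longrightarrow> card X \<le> m \<Longrightarrow> sum dem X \<le> card (\<Union>(F ` X))"
    and less: "\<And>X. X \<subseteq> S \<Longrightarrow> m < card X \<Longrightarrow> card X \<le> 2 * m \<Longrightarrow> sum dem X < card (\<Union>(F ` X))"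
  obtains P where "P \<subseteq> F x" "dem x \<le> card P"
    "\<And>X z. X \<subseteq> S - {x} \<Longrightarrow> card X \<le> m \<Longrightarrow> z \<in> P \<Longrightarrow> sum dem X \<le> card (\<Union>(F ` X) - {z})"
proof -
  define TT where "TT = {X. X \<subseteq> S - {x} \<and> card X \<le> m \<and> card (\<Union>(F ` X)) = sum dem X}"
  have finX: "finite X" if "X \<subseteq> S" for X using that S(1) finite_subset by blast
  have finU: "finite (\<Union>(F ` X))" if "X \<subseteq> S" for X using that finX[OF that] fin by blast
  have union: "X \<union> Y \<in> TT" if X: "X \<in> TT" and Y: "Y \<in> TT" for X Y
  proof -
    have sub: "X \<subseteq> S" "Y \<subseteq> S" "X \<inter> Y \<subseteq> S" "X \<union> Y \<subseteq> S" and sub': "X \<union> Y \<subseteq> S - {x}"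
      using X Y unfolding TT_def by auto
    have cX: "card X \<le> m" "card Y \<le> m" "card (X \<inter> Y) \<le> m"
      using X Y card_mono[OF finX[OF sub(1)], of "X \<inter> Y"] unfolding TT_def by auto
    have "card (\<Union>(F ` (X \<union> Y))) + card (\<Union>(F ` X) \<inter> \<Union>(F ` Y)) = sum dem X + sum dem Y"
      using card_Un_Int[OF finU[OF sub(1)] finU[OF sub(2)]] X Y unfolding TT_def by (simp add: image_Un)
    moreover have "card (\<Union>(F ` (X \<inter> Y))) \<le> card (\<Union>(F ` X) \<inter> \<Union>(F ` Y))"
      using finU[OF sub(1)] by (intro card_mono) auto
    moreover have "sum dem (X \<inter> Y) \<le> card (\<Union>(F ` (X \<inter> Y)))" using le[OF sub(3) cX(3)] .
    moreover have "sum dem X + sum dem Y = sum dem (X \<union> Y) + sum dem (X \<inter> Y)"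
      using finX sub by (metis sum.union_inter)
    ultimately have upper: "card (\<Union>(F ` (X \<union> Y))) \<le> sum dem (X \<union> Y)" by linarith
    \<comment> \<open>The union of two admissible sets may have up to \<open>2 * m\<close> elements.
      Strictness between \<open>m\<close> and \<open>2 * m\<close> rules out tight sets there, so
      the union is again of admissible size.\<close>
    have "card (X \<union> Y) \<le> 2 * m" using card_Un_le[of X Y] cX by linarith
    hence "card (X \<union> Y) \<le> m" using less[OF sub(4)] upper by linarith
    thus ?thesis using le[OF sub(4)] upper sub' unfolding TT_def by auto
  qed
  have "finite TT" using S(1) unfolding TT_def by simp
  moreover have "{} \<in> TT" unfolding TT_def by simp
  ultimately have "Max (card ` TT) \<in> card ` TT" by (intro Max_in) auto
  then obtain T where T: "T \<in> TT" "card T = Max (card ` TT)" by auto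
  have max: "card X \<le> card T" if "X \<in> TT" for X
    using Max_ge[of "card ` TT" "card X"] \<open>finite TT\<close> that T(2) by auto
  note T = T(1)
  have Tsub: "T \<subseteq> S - {x}" "card T \<le> m" "card (\<Union>(F ` T)) = sum dem T" using T unfolding TT_def by auto
  have sub: "X \<subseteq> T" if "X \<in> TT" for X
  proof -
    have "finite (X \<union> T)" using that Tsub(1) finX[of "X \<union> T"] unfolding TT_def by auto
    moreover have "card (X \<union> T) \<le> card T" using max[OF union[OF that T]] .
    ultimately have "T = X \<union> T" by (intro card_seteq) auto
    thus ?thesis by blast
  qed
  define P where "P = F x - \<Union>(F ` T)"
  show ?thesis
  proof (rule that)
    show "P \<subseteq> F x" unfolding P_def by blast
    have xT: "x \<notin> T" "insert x T \<subseteq> S" "finite T" using Tsub S finX[of T] by auto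
    \<comment> \<open>\<open>T\<close> may already have \<open>m\<close> elements, in which case
      \<open>insert x T\<close> falls into the range of \<open>less\<close>. The neighbours of
      \<open>T\<close> are used up exactly by its demand, so the demand of \<open>x\<close> is left
      for \<open>P\<close>.\<close>
    have "sum dem (insert x T) \<le> card (\<Union>(F ` insert x T))"
    proof (cases "card (insert x T) \<le> m")
      case False
      have "card (insert x T) \<le> 2 * m" using Tsub(2) S(3) xT by simp
      thus ?thesis using less[OF xT(2)] False by simp
    qed (use le xT in blast)
    also have "\<dots> = card (P \<union> \<Union>(F ` T))" unfolding P_def by (intro arg_cong[where f = card]) auto
    also have "\<dots> \<le> card P + card (\<Union>(F ` T))" by (rule card_Un_le)
    finally show "dem x \<le> card P" using Tsub(3) xT by simp
    fix X z assume X: "X \<subseteq> S - {x}" "card X \<le> m" and z: "z \<in> P"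
    have XS: "X \<subseteq> S" using X by blast
    show "sum dem X \<le> card (\<Union>(F ` X) - {z})"
    proof (cases "z \<in> \<Union>(F ` X)")
      case True
      hence "\<not> X \<subseteq> T" using z unfolding P_def by auto
      hence "X \<notin> TT" using sub by blast
      hence "sum dem X < card (\<Union>(F ` X))" using le[OF XS X(2)] X unfolding TT_def by auto
      thus ?thesis using True finU[OF XS] by (simp add: card_Diff_singleton)
    qed (use le[OF XS X(2)] in simp)
  qed
qed

text \<open>Induction on the total demand, giving one vertex \<open>z\<close> to some
  \<open>x\<close> at a time. Sets containing \<open>x\<close> lose at most one vertex and exactly
  one unit of demand; the others are protected by the choice of \<open>z\<close> in
  \<open>hall_extension\<close>, applied with \<open>m = card S\<close>, where the strict range is
  empty.\<close>

lemma hall_demands: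
  fixes F :: "'i \<Rightarrow> 'v set" and dem :: "'i \<Rightarrow> nat"
  assumes "finite S" "\<And>i. i \<in> S \<Longrightarrow> finite (F i)"
    and "\<And>X. X \<subseteq> S \<Longrightarrow> sum dem X \<le> card (\<Union>(F ` X))"
  shows "\<exists>B. (\<forall>i\<in>S. B i \<subseteq> F i \<and> card (B i) = dem i) \<and> (\<forall>i\<in>S. \<forall>j\<in>S. i \<noteq> j \<longrightarrow> B i \<inter> B j = {})"
  using assms
proof (induction "sum dem S" arbitrary: F dem)
  case 0
  hence "\<forall>i\<in>S. dem i = 0" by simp
  thus ?case by (intro exI[of _ "\<lambda>_. {}"]) simp
next
  case (Suc n)
  have "\<exists>x\<in>S. dem x > 0"
  proof (rule ccontr)
    assume "\<not> ?thesis"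
    hence "sum dem S = 0" by simp
    thus False using Suc.hyps(2) by simp
  qed
  then obtain x where x: "x \<in> S" "dem x > 0" by blast
  have S: "1 \<le> card S" using x Suc.prems(1) by (auto simp: Suc_le_eq card_gt_0_iff)
  obtain P where P: "P \<subseteq> F x" "dem x \<le> card P"
    "\<And>X z. X \<subseteq> S - {x} \<Longrightarrow> card X \<le> card S \<Longrightarrow> z \<in> P \<Longrightarrow> sum dem X \<le> card (\<Union>(F ` X) - {z})"
  proof (rule hall_extension[of S x "card S" F dem])
    show "sum dem X < card (\<Union>(F ` X))" if "X \<subseteq> S" "card S < card X" for X
      using card_mono[OF Suc.prems(1) that(1)] that(2) by simp
    show "sum dem X \<le> card (\<Union>(F ` X))" if "X \<subseteq> S" for X
      using Suc.prems(3) that .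
  qed (use Suc.prems(1,2) x S in auto)
  then obtain z where z: "z \<in> P" using x by fastforce
  define dem' where "dem' = dem(x := dem x - 1)"
  define F' where "F' = (\<lambda>i. F i - {z})"
  have sum': "sum dem' X = (if x \<in> X then sum dem X - 1 else sum dem X)" if "X \<subseteq> S" for X
  proof -
    have "finite X" using that Suc.prems(1) finite_subset by blast
    thus ?thesis using x unfolding dem'_def by (auto simp: sum.remove[of X x] intro!: sum.cong)
  qed
  have U': "\<Union>(F' ` X) = \<Union>(F ` X) - {z}" for X unfolding F'_def by auto
  have "\<exists>B. (\<forall>i\<in>S. B i \<subseteq> F' i \<and> card (B i) = dem' i) \<and> (\<forall>i\<in>S. \<forall>j\<in>S. i \<noteq> j \<longrightarrow> B i \<inter> B j = {})"
  proof (rule Suc.hyps(1))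
    show "n = sum dem' S" using sum'[of S] x Suc.hyps(2) by simp
    show "sum dem' X \<le> card (\<Union>(F' ` X))" if X: "X \<subseteq> S" for X
    proof (cases "x \<in> X")
      case True
      have "card (\<Union>(F ` X)) - 1 \<le> card (\<Union>(F ` X) - {z})" by (simp add: card_Diff_singleton_if)
      thus ?thesis using sum'[OF X] True Suc.prems(3)[OF X] unfolding U' by simp
    next
      case False
      thus ?thesis using P(3)[of X z] z X sum'[OF X] card_mono[OF Suc.prems(1) X] unfolding U' by auto
    qed
  qed (use Suc.prems(1,2) in \<open>auto simp: F'_def\<close>)
  then obtain B where B0: "\<forall>i\<in>S. B i \<subseteq> F' i \<and> card (B i) = dem' i"
    "\<forall>i\<in>S. \<forall>j\<in>S. i \<noteq> j \<longrightarrow> B i \<inter> B j = {}" by (elim exE conjE)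
  have B: "B i \<subseteq> F' i" "card (B i) = dem' i" if "i \<in> S" for i using B0(1) that by auto
  have zB: "z \<notin> B i" if "i \<in> S" for i using B(1)[OF that] unfolding F'_def by blast
  have "finite (B x)" using B(1)[OF x(1)] Suc.prems(2)[OF x(1)] finite_subset unfolding F'_def by blast
  hence "card (insert z (B x)) = dem x" using zB[OF x(1)] B(2)[OF x(1)] x(2) unfolding dem'_def by simp
  moreover have "insert z (B x) \<subseteq> F x" using B(1)[OF x(1)] z P(1) unfolding F'_def by blast
  ultimately have new: "insert z (B x) \<subseteq> F x" "card (insert z (B x)) = dem x" by simp_all
  define B' where "B' = B(x := insert z (B x))"
  have "B' i \<subseteq> F i \<and> card (B' i) = dem i" if "i \<in> S" for i
    using new B[OF that] unfolding B'_def dem'_def F'_def by (cases "i = x") auto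
  moreover have "B' i \<inter> B' j = {}" if "i \<in> S" "j \<in> S" "i \<noteq> j" for i j
    using B0(2) zB that x(1) unfolding B'_def by (cases "i = x"; cases "j = x") simp_all
  ultimately show ?case by blast
qed

section \<open>Sub-bigraphs of large minimum degree\<close>

text \<open>A digraph is treated as the bipartite graph between an out-copy (sign \<open>True\<close>) and an in-copy
  (sign \<open>False\<close>) of its vertex set.\<close>

definition nb :: "('a \<times> 'a) set \<Rightarrow> bool \<Rightarrow> 'a \<Rightarrow> 'a set" where
  "nb R \<sigma> u = (if \<sigma> then {w. (u, w) \<in> R} else {w. (w, u) \<in> R})"

text \<open>\<open>A \<sigma>\<close> collects the host vertices that may carry tree vertices of
  sign \<open>\<sigma>\<close>. The sets \<open>A True\<close> and \<open>A False\<close> may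
  overlap, so the two sides are not independent of each other.\<close>

definition core :: "('a \<times> 'a) set \<Rightarrow> (bool \<Rightarrow> nat) \<Rightarrow> (bool \<Rightarrow> 'a set) \<Rightarrow> bool" where
  "core R m A \<longleftrightarrow> (\<forall>\<sigma>. \<forall>u\<in>A \<sigma>. m \<sigma> \<le> card (nb R \<sigma> u \<inter> A (\<not> \<sigma>)))"

lemma nb_sym: "w \<in> nb R \<sigma> u \<longleftrightarrow> u \<in> nb R (\<not> \<sigma>) w"
  unfolding nb_def by auto

lemma finite_nb: "finite R \<Longrightarrow> finite (nb R \<sigma> u)"
proof -
  assume fin: "finite R"
  have "nb R \<sigma> u \<subseteq> fst ` R \<union> snd ` R" unfolding nb_def by (auto split: if_splits intro: rev_image_eqI)
  thus ?thesis using fin finite_subset by blast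
qed

text \<open>Deleting an out-vertex with at most \<open>\<alpha>\<close> neighbours removes at most
  \<open>\<alpha>\<close> arcs and lowers the weighted count by exactly \<open>\<alpha>\<close>,
  likewise for in-vertices and \<open>\<beta>\<close>. The strict surplus of arcs survives every
  deletion and prevents the process from ending with nothing.\<close>

lemma weighted_core:
  fixes \<alpha> \<beta> :: nat
  assumes "finite R" "finite P" "finite Q" "\<alpha> * card P + \<beta> * card Q < card (R \<inter> P \<times> Q)"
  shows "\<exists>P' Q'. P' \<subseteq> P \<and> Q' \<subseteq> Q \<and> \<alpha> * card P' + \<beta> * card Q' < card (R \<inter> P' \<times> Q')
    \<and> (\<forall>u\<in>P'. \<alpha> < card (nb R True u \<inter> Q')) \<and> (\<forall>w\<in>Q'. \<beta> < card (nb R False w \<inter> P'))"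
  using assms
proof (induction "card P + card Q" arbitrary: P Q rule: less_induct)
  case less
  show ?case
  proof (cases "(\<forall>u\<in>P. \<alpha> < card (nb R True u \<inter> Q)) \<and> (\<forall>w\<in>Q. \<beta> < card (nb R False w \<inter> P))")
    case True
    thus ?thesis using less.prems(4) by blast
  next
    case False
    then consider u where "u \<in> P" "card (nb R True u \<inter> Q) \<le> \<alpha>"
      | w where "w \<in> Q" "card (nb R False w \<inter> P) \<le> \<beta>" by (auto simp: not_less)
    thus ?thesis
    proof cases
      case (1 u)
      have c: "card P = Suc (card (P - {u}))" using card.remove[OF less.prems(2) 1(1)] by simp
      have "R \<inter> P \<times> Q = R \<inter> (P - {u}) \<times> Q \<union> Pair u ` (nb R True u \<inter> Q)"
        using 1 by (auto simp: nb_def)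
      hence "card (R \<inter> P \<times> Q) \<le> card (R \<inter> (P - {u}) \<times> Q) + card (Pair u ` (nb R True u \<inter> Q))"
        by (metis card_Un_le)
      also have "card (Pair u ` (nb R True u \<inter> Q)) \<le> \<alpha>"
        using 1 card_image_le[of "nb R True u \<inter> Q" "Pair u"] less.prems(3) by simp
      finally have "\<alpha> * card (P - {u}) + \<beta> * card Q < card (R \<inter> (P - {u}) \<times> Q)"
        using less.prems(4) c by simp
      then obtain P' Q' where "P' \<subseteq> P - {u}" "Q' \<subseteq> Q" "\<alpha> * card P' + \<beta> * card Q' < card (R \<inter> P' \<times> Q')"
        "\<forall>u\<in>P'. \<alpha> < card (nb R True u \<inter> Q')" "\<forall>w\<in>Q'. \<beta> < card (nb R False w \<inter> P')"
        using less.hyps[of "P - {u}" Q] less.prems c by auto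
      thus ?thesis by blast
    next
      case (2 w)
      have c: "card Q = Suc (card (Q - {w}))" using card.remove[OF less.prems(3) 2(1)] by simp
      have "R \<inter> P \<times> Q = R \<inter> P \<times> (Q - {w}) \<union> (\<lambda>u. (u, w)) ` (nb R False w \<inter> P)"
        using 2 by (auto simp: nb_def)
      hence "card (R \<inter> P \<times> Q) \<le> card (R \<inter> P \<times> (Q - {w})) + card ((\<lambda>u. (u, w)) ` (nb R False w \<inter> P))"
        by (metis card_Un_le)
      also have "card ((\<lambda>u. (u, w)) ` (nb R False w \<inter> P)) \<le> \<beta>"
        using 2 card_image_le[of "nb R False w \<inter> P" "\<lambda>u. (u, w)"] less.prems(2) by simp
      finally have "\<alpha> * card P + \<beta> * card (Q - {w}) < card (R \<inter> P \<times> (Q - {w}))"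
        using less.prems(4) c by simp
      then obtain P' Q' where "P' \<subseteq> P" "Q' \<subseteq> Q - {w}" "\<alpha> * card P' + \<beta> * card Q' < card (R \<inter> P' \<times> Q')"
        "\<forall>u\<in>P'. \<alpha> < card (nb R True u \<inter> Q')" "\<forall>w\<in>Q'. \<beta> < card (nb R False w \<inter> P')"
        using less.hyps[of P "Q - {w}"] less.prems c by auto
      thus ?thesis by blast
    qed
  qed
qed

lemma weighted_core':
  assumes "finite R" "finite P" "finite Q" "(x - 1) * card P + (y - 1) * card Q < card (R \<inter> P \<times> Q)"
  obtains A where "A True \<subseteq> P" "A False \<subseteq> Q" "A True \<noteq> {}" "core R (\<lambda>\<sigma>. if \<sigma> then x else y) A"
    "(x - 1) * card (A True) + (y - 1) * card (A False) < card (R \<inter> A True \<times> A False)"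
proof -
  obtain P' Q' where PQ: "P' \<subseteq> P" "Q' \<subseteq> Q" "(x - 1) * card P' + (y - 1) * card Q' < card (R \<inter> P' \<times> Q')"
    "\<forall>u\<in>P'. x - 1 < card (nb R True u \<inter> Q')" "\<forall>w\<in>Q'. y - 1 < card (nb R False w \<inter> P')"
    using weighted_core[OF assms] by blast
  have "P' \<noteq> {}" using PQ(3) by auto
  moreover have "core R (\<lambda>\<sigma>. if \<sigma> then x else y) (\<lambda>\<sigma>. if \<sigma> then P' else Q')"
    using PQ(4,5) unfolding core_def by auto
  ultimately show ?thesis using PQ(1-3) that[of "\<lambda>\<sigma>. if \<sigma> then P' else Q'"] by simp
qed

text \<open>If no out-vertex of a core has out-degree \<open>\<theta>\<close> in the whole digraph, delete all out-vertices
  of cores. What remains is still dense with respect to the weights \<open>\<theta> - 1\<close> and \<open>k - \<theta>\<close>, and as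
  it contains no core it has at least as many in-vertices as out-vertices.\<close>

lemma core_dichotomy:
  fixes m :: "bool \<Rightarrow> nat"
  assumes fin: "finite V" and R: "R \<subseteq> V \<times> V" and dense: "(k - 1) * card V < card R"
    and m: "m True + m False \<le> k + 1" "1 \<le> m True" "1 \<le> m False" "m True \<le> \<theta>" "\<theta> \<le> k"
  shows "(\<exists>A z. core R m A \<and> z \<in> A True \<and> \<theta> \<le> card (nb R True z)) \<or>
    (\<exists>A v. core R (\<lambda>\<sigma>. if \<sigma> then \<theta> else k + 1 - \<theta>) A \<and> v \<in> A True \<and> k \<le> card (nb R True v \<inter> A False))"
  (is "?i \<or> ?ii")
proof (cases ?i)
  case none: False
  have finR: "finite R" using R fin finite_subset by blast
  define S where "S = {z \<in> V. \<exists>A. core R m A \<and> z \<in> A True}"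
  have S: "S \<subseteq> V" "finite S" unfolding S_def using fin by auto
  have "card (R \<inter> S \<times> V) \<le> (\<theta> - 1) * card S"
  proof -
    have "R \<inter> S \<times> V = (SIGMA z:S. nb R True z)" using R by (auto simp: nb_def)
    hence "card (R \<inter> S \<times> V) = (\<Sum>z\<in>S. card (nb R True z))"
      using S(2) finite_nb[OF finR] by (simp add: card_SigmaI)
    also have "\<dots> \<le> (\<Sum>z\<in>S. \<theta> - 1)"
    proof (rule sum_mono)
      fix z assume "z \<in> S"
      hence "card (nb R True z) < \<theta>" using none unfolding S_def by (auto simp: not_le)
      thus "card (nb R True z) \<le> \<theta> - 1" by simp
    qed
    finally show ?thesis by (simp add: mult.commute)
  qed
  moreover have "card R \<le> card (R \<inter> S \<times> V) + card (R \<inter> (V - S) \<times> V)"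
  proof -
    have "R = R \<inter> S \<times> V \<union> R \<inter> (V - S) \<times> V" using R S by auto
    thus ?thesis by (metis card_Un_le)
  qed
  moreover have "card V = card S + card (V - S)"
    using S fin by (metis card_Diff_subset card_mono le_add_diff_inverse)
  moreover have "(k - 1) * card V = (\<theta> - 1) * card V + (k - \<theta>) * card V"
    using m by (simp add: add_mult_distrib[symmetric])
  ultimately have "(\<theta> - 1) * card (V - S) + (k - \<theta>) * card V < card (R \<inter> (V - S) \<times> V)"
    using dense by (simp add: add_mult_distrib2)
  hence "(\<theta> - 1) * card (V - S) + (k + 1 - \<theta> - 1) * card V < card (R \<inter> (V - S) \<times> V)"
    using m by (simp add: diff_diff_add)
  then obtain A where A: "A True \<subseteq> V - S" "A False \<subseteq> V" "A True \<noteq> {}"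
    "core R (\<lambda>\<sigma>. if \<sigma> then \<theta> else k + 1 - \<theta>) A"
    "(\<theta> - 1) * card (A True) + (k + 1 - \<theta> - 1) * card (A False) < card (R \<inter> A True \<times> A False)"
    using weighted_core'[of R "V - S" V \<theta> "k + 1 - \<theta>"] finR fin by (metis finite_Diff)
  have finA: "finite (A True)" "finite (A False)" using finite_subset[OF A(1)] finite_subset[OF A(2)] fin by auto
  \<comment> \<open>With more out- than in-vertices, moving the weight
    \<open>\<theta> - m True\<close> from the out-side to the in-side only lowers the weighted
    count, so a core for \<open>m\<close> would exist inside \<open>V - S\<close>, against the
    definition of \<open>S\<close>.\<close>
  have le: "card (A True) \<le> card (A False)"
  proof (rule ccontr)
    assume "\<not> ?thesis"
    hence lt: "card (A False) \<le> card (A True)" by simp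
    have eq: "(\<theta> - 1) = (m True - 1) + (\<theta> - m True)" "(k + 1 - \<theta> - 1) + (\<theta> - m True) \<ge> m False - 1"
      using m by auto
    have "(m True - 1) * card (A True) + (m False - 1) * card (A False)
        \<le> (m True - 1) * card (A True) + ((k + 1 - \<theta> - 1) + (\<theta> - m True)) * card (A False)"
      using eq(2) by (intro add_left_mono mult_right_mono) auto
    also have "\<dots> \<le> (m True - 1) * card (A True) + ((k + 1 - \<theta> - 1) * card (A False) + (\<theta> - m True) * card (A True))"
      using lt by (simp add: add_mult_distrib)
    also have "\<dots> = (\<theta> - 1) * card (A True) + (k + 1 - \<theta> - 1) * card (A False)"
      unfolding eq(1) add_mult_distrib by simp
    finally have "(m True - 1) * card (A True) + (m False - 1) * card (A False) < card (R \<inter> A True \<times> A False)"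
      using A(5) by linarith
    then obtain A' where A': "A' True \<subseteq> A True" "A' True \<noteq> {}" "core R (\<lambda>\<sigma>. if \<sigma> then m True else m False) A'"
      using weighted_core'[of R "A True" "A False" "m True" "m False"] finR finA by metis
    moreover have "(\<lambda>\<sigma>. if \<sigma> then m True else m False) = m" by (auto simp: fun_eq_iff)
    ultimately obtain z where "z \<in> A' True" "core R m A'" "z \<in> V - S" using A(1) by (metis all_not_in_conv subset_iff)
    thus False unfolding S_def by auto
  qed
  \<comment> \<open>Otherwise there are at most (k - 1) |A True| arcs. Splitting k - 1 into \<theta>
    - 1 and k - \<theta> and using \<open>le\<close> on the second share contradicts the density of
    \<open>A\<close>.\<close>
  have "\<exists>v\<in>A True. k \<le> card (nb R True v \<inter> A False)"
  proof (rule ccontr)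
    assume "\<not> ?thesis"
    hence lt: "\<And>v. v \<in> A True \<Longrightarrow> card (nb R True v \<inter> A False) \<le> k - 1" by force
    have "R \<inter> A True \<times> A False = (SIGMA z:A True. nb R True z \<inter> A False)" by (auto simp: nb_def)
    hence "card (R \<inter> A True \<times> A False) = (\<Sum>z\<in>A True. card (nb R True z \<inter> A False))"
      using finA by (simp add: card_SigmaI)
    also have "\<dots> \<le> (\<Sum>z\<in>A True. k - 1)" using lt by (rule sum_mono)
    also have "\<dots> = ((\<theta> - 1) + (k - \<theta>)) * card (A True)" using m by simp
    also have "\<dots> = (\<theta> - 1) * card (A True) + (k - \<theta>) * card (A True)" by (rule add_mult_distrib)
    also have "\<dots> \<le> (\<theta> - 1) * card (A True) + (k + 1 - \<theta> - 1) * card (A False)"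
      using le m by (intro add_left_mono mult_mono) auto
    finally show False using A(5) by simp
  qed
  hence ?ii using A(4) by blast
  thus ?thesis ..
qed simp

section \<open>Rooted trees and partial embeddings\<close>

text \<open>\<open>dep\<close> is a rank that drops towards the root and serves as the measure for
  all inductions along the tree. The value \<open>par rt\<close> carries no meaning, which is why
  \<open>ch\<close> excludes the root.\<close>

locale rooted_tree =
  fixes V :: "'c set" and rt :: 'c and par :: "'c \<Rightarrow> 'c" and dep :: "'c \<Rightarrow> nat"
  assumes finV: "finite V" and rtV: "rt \<in> V"
    and parV: "\<And>x. x \<in> V \<Longrightarrow> x \<noteq> rt \<Longrightarrow> par x \<in> V"
    and dep_par: "\<And>x. x \<in> V \<Longrightarrow> x \<noteq> rt \<Longrightarrow> dep (par x) < dep x"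
begin

definition ch :: "'c \<Rightarrow> 'c set" where "ch x = {y \<in> V - {rt}. par y = x}"
definition inner :: "'c set" where "inner = {x \<in> V. ch x \<noteq> {}}"
definition leaves :: "'c set" where "leaves = {x \<in> V. ch x = {}}"
text \<open>The vertex sets of the subtrees through the root, which are the domains of partial
  embeddings.\<close>

definition closed :: "'c set \<Rightarrow> bool" where
  "closed E \<longleftrightarrow> rt \<in> E \<and> E \<subseteq> V \<and> (\<forall>x\<in>E - {rt}. par x \<in> E)"

lemma ch_sub: "ch x \<subseteq> V" "rt \<notin> ch x" unfolding ch_def by auto
lemma fin_ch [simp]: "finite (ch x)" using finV finite_subset ch_sub by blast
lemma chD: "y \<in> ch x \<Longrightarrow> y \<in> V \<and> y \<noteq> rt \<and> par y = x" unfolding ch_def by auto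
lemma chI: "y \<in> V \<Longrightarrow> y \<noteq> rt \<Longrightarrow> y \<in> ch (par y)" unfolding ch_def by auto
lemma ch_disjoint: "x \<noteq> y \<Longrightarrow> ch x \<inter> ch y = {}" unfolding ch_def by auto
lemma ch_irrefl: "x \<notin> ch x" using chD dep_par by fastforce
lemma ch_inner: "y \<in> ch x \<Longrightarrow> x \<in> inner" using chD parV unfolding inner_def by blast
lemma inner_sub: "inner \<subseteq> V" and leaves_sub: "leaves \<subseteq> V" unfolding inner_def leaves_def by auto
lemma fin_inner [simp]: "finite inner" and fin_leaves [simp]: "finite leaves"
  using finV finite_subset inner_sub leaves_sub by auto
lemma V_split: "V = inner \<union> leaves" "inner \<inter> leaves = {}" unfolding inner_def leaves_def by auto
lemma not_leafD: "x \<in> V \<Longrightarrow> x \<notin> leaves \<Longrightarrow> x \<in> inner" using V_split by blast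
lemma d_pos: "x \<in> inner \<Longrightarrow> 1 \<le> card (ch x)" unfolding inner_def by (simp add: Suc_le_eq card_gt_0_iff)
lemma ch_dep: "y \<in> ch x \<Longrightarrow> dep x < dep y" using chD dep_par by blast
lemma ch_not_par: "y \<in> ch x \<Longrightarrow> x \<notin> ch y" using ch_dep[of y x] ch_dep[of x y] by auto

lemma V_eq: "V - {rt} = (\<Union>x\<in>V. ch x)" using parV unfolding ch_def by auto

lemma sum_ch: "X \<subseteq> V \<Longrightarrow> card (\<Union>x\<in>X. ch x) = (\<Sum>x\<in>X. card (ch x))"
  using finV finite_subset ch_disjoint by (intro card_UN_disjoint) auto

lemma sum_d: "(\<Sum>x\<in>inner. card (ch x)) + 1 = card V"
proof -
  have "V - {rt} = (\<Union>x\<in>inner. ch x)" using V_eq ch_inner inner_sub by blast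
  hence "card (V - {rt}) = (\<Sum>x\<in>inner. card (ch x))" using sum_ch[OF inner_sub] by simp
  moreover have "card V > 0" using finV rtV by (auto simp: card_gt_0_iff)
  ultimately show ?thesis using rtV by (simp add: card_Diff_singleton)
qed

lemma card_V: "card V = card inner + card leaves"
  using V_split by (metis card_Un_disjoint fin_inner fin_leaves)

text \<open>All vertices but the root are children, so an inner vertex with d children accounts for
  d - 1 extra leaves. Thus large degrees force many leaves and leave few inner vertices; this is how
  degrees are paid for in the numerical conditions.\<close>

lemma card_leaves: "card leaves = 1 + (\<Sum>x\<in>inner. card (ch x) - 1)"
proof -
  have "(\<Sum>x\<in>inner. card (ch x)) = (\<Sum>x\<in>inner. card (ch x) - 1) + (\<Sum>x\<in>inner. 1)"
    unfolding sum.distrib[symmetric] by (intro sum.cong refl) (use d_pos in fastforce)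
  thus ?thesis using sum_d card_V by simp
qed

lemma leaves_ge: "X \<subseteq> inner \<Longrightarrow> 1 + (\<Sum>x\<in>X. card (ch x) - 1) \<le> card leaves"
  unfolding card_leaves by (intro add_left_mono sum_mono2) auto

lemma sum_d_le: "X \<subseteq> V \<Longrightarrow> (\<Sum>x\<in>X. card (ch x)) + 1 \<le> card V"
proof -
  assume X: "X \<subseteq> V"
  have "(\<Sum>x\<in>X. card (ch x)) = card (\<Union>x\<in>X. ch x)" using sum_ch[OF X] by simp
  also have "\<dots> \<le> card (V - {rt})" using finV ch_sub by (intro card_mono) auto
  moreover have "card V > 0" using finV rtV by (auto simp: card_gt_0_iff)
  ultimately show ?thesis using rtV finV by (simp add: card_Diff_singleton)
qed

lemma closed_step:
  assumes "closed E" "closed F" "\<not> F \<subseteq> E"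
  obtains y where "y \<in> F" "y \<notin> E" "y \<in> V" "y \<noteq> rt" "par y \<in> E"
proof -
  have "\<exists>y. y \<in> F - E \<and> (\<forall>z. z \<in> F - E \<longrightarrow> dep y \<le> dep z)"
    using assms(3) ex_has_least_nat[of "\<lambda>y. y \<in> F - E" _ dep] by blast
  then obtain y where y: "y \<in> F - E" and min: "\<And>z. z \<in> F - E \<Longrightarrow> dep y \<le> dep z" by blast
  have yV: "y \<in> V" "y \<noteq> rt" using y assms unfolding closed_def by auto
  have "par y \<in> F" using y assms(2) yV unfolding closed_def by auto
  moreover have "par y \<notin> F - E" using min dep_par[OF yV] by (metis leD)
  ultimately show ?thesis using that y yV by blast
qed

lemma closed_V: "closed V" and closed_rt: "closed {rt}"
  unfolding closed_def using rtV parV by auto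

lemma closed_insert: "closed E \<Longrightarrow> y \<in> V \<Longrightarrow> par y \<in> E \<Longrightarrow> closed (insert y E)"
  unfolding closed_def by auto

lemma closed_Un_ch: "closed E \<Longrightarrow> x \<in> E \<Longrightarrow> K \<subseteq> ch x \<Longrightarrow> closed (E \<union> K)"
proof -
  assume a: "closed E" "x \<in> E" "K \<subseteq> ch x"
  have "y \<in> V" "par y = x" if "y \<in> K" for y using that a(3) chD by auto
  thus ?thesis using a(1,2) unfolding closed_def by auto
qed

lemma closed_ch: "closed E \<Longrightarrow> y \<notin> E \<Longrightarrow> ch y \<inter> E = {}"
  unfolding closed_def using chD by blast

lemma closed_Diff_leaves: "L \<subseteq> leaves - {rt} \<Longrightarrow> closed (V - L)"
  unfolding closed_def leaves_def using rtV parV chI by blast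

lemma closed_inner: "inner \<noteq> {} \<Longrightarrow> closed inner"
proof -
  assume ne: "inner \<noteq> {}"
  have par: "par x \<in> inner" if "x \<in> V" "x \<noteq> rt" for x using chI[OF that] ch_inner by blast
  moreover have "rt \<in> inner"
  proof -
    obtain x where "x \<in> inner" using ne by blast
    then obtain y where "y \<in> ch x" unfolding inner_def by blast
    hence "y \<in> V" "y \<notin> {rt}" using chD by auto
    then obtain y where "y \<in> V" "par y \<in> {rt}" "y \<noteq> rt" using closed_step[OF closed_rt closed_V] by blast
    thus ?thesis using chI ch_inner by auto
  qed
  ultimately show ?thesis using inner_sub unfolding closed_def by auto
qed

end

section \<open>Partial embeddings of a tree with alternating signs\<close>

locale tree_host = rooted_tree V rt par dep
  for V :: "'c set" and rt par dep +
  fixes sg :: "'c \<Rightarrow> bool" and R :: "('a \<times> 'a) set" and c :: nat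
  assumes sg_rt: "sg rt" and sg_par: "\<And>x. x \<in> V \<Longrightarrow> x \<noteq> rt \<Longrightarrow> sg x \<longleftrightarrow> \<not> sg (par x)"
    and finR: "finite R" and irrR: "\<And>u. (u, u) \<notin> R"
    and common: "\<And>u w \<sigma> \<tau>. u \<noteq> w \<Longrightarrow> card (nb R \<sigma> u \<inter> nb R \<tau> w) \<le> c"
begin

text \<open>Every tree edge joins a vertex to its parent, whose sign gives the direction of the arc.
  Membership in a core is not part of the definition, because the leaves embedded last are taken
  from full neighbourhoods.\<close>

definition emb :: "'c set \<Rightarrow> ('c \<Rightarrow> 'a) \<Rightarrow> bool" where
  "emb E f \<longleftrightarrow> inj_on f E \<and> (\<forall>y\<in>E - {rt}. f y \<in> nb R (sg (par y)) (f (par y)))"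

lemma fin_nb [simp]: "finite (nb R \<sigma> u)" using finite_nb[OF finR] .
lemma nb_irrefl: "u \<notin> nb R \<sigma> u" using irrR unfolding nb_def by auto

lemma sg_ch: "y \<in> ch x \<Longrightarrow> sg y \<longleftrightarrow> \<not> sg x" using chD sg_par by auto

lemma common_sub: "u \<noteq> w \<Longrightarrow> X \<subseteq> nb R \<sigma> u \<Longrightarrow> Y \<subseteq> nb R \<tau> w \<Longrightarrow> card (X \<inter> Y) \<le> c"
  by (rule order_trans[OF card_mono common[of u w \<sigma> \<tau>]]) auto

lemma emb_rt: "emb {rt} f" unfolding emb_def by simp

lemma emb_ch:
  assumes "emb E f" "closed E" "K \<subseteq> ch x" "K \<subseteq> E"
  shows "f ` K \<subseteq> nb R (sg x) (f x)"
  using assms chD unfolding emb_def by fastforce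

lemma emb_extend_set:
  assumes E: "closed E" "emb E f" and x: "x \<in> E" and K: "K \<subseteq> ch x" "K \<inter> E = {}"
    and B: "finite B" "B \<subseteq> nb R (sg x) (f x)" "B \<inter> f ` E = {}" "card K \<le> card B"
  obtains f' where "emb (E \<union> K) f'" "\<And>y. y \<in> E \<Longrightarrow> f' y = f y" "f' ` K \<subseteq> B"
proof -
  have finK: "finite K" using finite_subset[OF K(1)] by simp
  obtain g where g: "inj_on g K" "g ` K \<subseteq> B" using inj_into_large[OF finK B(1,4)] .
  define f' where "f' = (\<lambda>y. if y \<in> K then g y else f y)"
  have eq: "f' y = f y" if "y \<in> E" for y using that K(2) unfolding f'_def by auto
  have img: "f' ` K = g ` K" unfolding f'_def by simp
  have "inj_on f' (E \<union> K)"
  proof (rule inj_onI)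
    fix a b assume "a \<in> E \<union> K" "b \<in> E \<union> K" "f' a = f' b"
    moreover have "g y \<notin> f ` E" if "y \<in> K" for y using that g B(3) by blast
    ultimately show "a = b" using E(2) g(1) unfolding f'_def emb_def
      by (auto split: if_splits dest: inj_onD) (metis image_eqI)+
  qed
  moreover have "f' y \<in> nb R (sg (par y)) (f' (par y))" if y: "y \<in> E \<union> K - {rt}" for y
  proof (cases "y \<in> K")
    case True
    hence p: "par y = x" using K chD by blast
    have "f' y \<in> B" using True g(2) img by blast
    thus ?thesis using B(2) eq[OF x] p by auto
  next
    case False
    hence "y \<in> E" "par y \<in> E" using y E(1) unfolding closed_def by auto
    thus ?thesis using False y E(2) eq unfolding emb_def by auto
  qed
  ultimately have "emb (E \<union> K) f'" unfolding emb_def by blast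
  thus ?thesis using that[of f'] eq img g(2) by auto
qed

lemma emb_extend:
  assumes "closed E" "emb E f" "y \<in> V" "y \<noteq> rt" "y \<notin> E" "par y \<in> E"
    and "z \<in> nb R (sg (par y)) (f (par y))" "z \<notin> f ` E"
  shows "emb (insert y E) (f(y := z))"
proof -
  have yE: "f(y := z) ` E = f ` E" and eq: "\<And>x. x \<in> E \<Longrightarrow> (f(y := z)) x = f x" using assms(5) by auto
  have "inj_on (f(y := z)) (insert y E)"
    using assms(2,5,8) yE unfolding emb_def by (auto simp: inj_on_def)
  moreover have "(f(y := z)) w \<in> nb R (sg (par w)) ((f(y := z)) (par w))" if w: "w \<in> insert y E - {rt}" for w
  proof (cases "w = y")
    case True
    thus ?thesis using assms(6,7) eq by simp
  next
    case False
    hence "w \<in> E" "par w \<in> E" using w assms(1) unfolding closed_def by auto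
    thus ?thesis using False w assms(2) eq unfolding emb_def by simp
  qed
  ultimately show ?thesis unfolding emb_def by blast
qed

text \<open>The leaf children of the root can always wait until the end: nothing but the free part
  of the neighbourhood of the root's image matters for them.\<close>

lemma emb_rt_leaves:
  assumes f: "emb (V - (ch rt \<inter> leaves)) f"
    and free: "card (ch rt \<inter> leaves) \<le> card (nb R (sg rt) (f rt) - f ` (V - (ch rt \<inter> leaves)))"
  shows "\<exists>f. emb V f"
proof -
  let ?K = "ch rt \<inter> leaves"
  have cl: "closed (V - ?K)" using ch_sub(2) by (intro closed_Diff_leaves) auto
  obtain f' where "emb (V - ?K \<union> ?K) f'"
  proof (rule emb_extend_set[OF cl f, of rt ?K "nb R (sg rt) (f rt) - f ` (V - ?K)"])
    show "rt \<in> V - ?K" using rtV ch_sub(2) by auto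
    show "(nb R (sg rt) (f rt) - f ` (V - ?K)) \<inter> f ` (V - ?K) = {}" by blast
  qed (use free in auto)
  moreover have "V - ?K \<union> ?K = V" using leaves_sub by auto
  ultimately show ?thesis by auto
qed

text \<open>A leaf has to be adjacent to the image of its parent only, so disjoint sets of the right
  sizes, one for each inner vertex, suffice. They come from Hall's theorem with the number of leaf
  children as demand.\<close>

lemma emb_leaves:
  assumes ne: "inner \<noteq> {}" and f: "emb inner f"
    and hall: "\<And>X. X \<subseteq> inner \<Longrightarrow>
      (\<Sum>x\<in>X. card (ch x \<inter> leaves)) \<le> card (\<Union>x\<in>X. nb R (sg x) (f x) - f ` inner)"
  shows "\<exists>f. emb V f"
proof -
  define F where "F = (\<lambda>x. nb R (sg x) (f x) - f ` inner)"
  obtain B where B: "\<forall>i\<in>inner. B i \<subseteq> F i \<and> card (B i) = card (ch i \<inter> leaves)"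
    "\<forall>i\<in>inner. \<forall>j\<in>inner. i \<noteq> j \<longrightarrow> B i \<inter> B j = {}"
    using hall_demands[of inner F "\<lambda>x. card (ch x \<inter> leaves)"] hall unfolding F_def by auto
  have finB: "finite (B i)" if "i \<in> inner" for i
    using B(1) that finite_subset[of "B i" "F i"] unfolding F_def by auto
  have cl: "closed inner" using closed_inner[OF ne] .
  have "\<exists>g. inj_on g (ch i \<inter> leaves) \<and> g ` (ch i \<inter> leaves) \<subseteq> B i" if "i \<in> inner" for i
    using inj_into_large[of "ch i \<inter> leaves" "B i"] finB[OF that] B(1) that by (metis fin_ch finite_Int order_refl)
  then obtain g where g: "\<And>i. i \<in> inner \<Longrightarrow> inj_on (g i) (ch i \<inter> leaves)"
    "\<And>i. i \<in> inner \<Longrightarrow> g i ` (ch i \<inter> leaves) \<subseteq> B i" by metis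
  define f' where "f' = (\<lambda>y. if y \<in> inner then f y else g (par y) y)"
  have leaf: "par y \<in> inner" "y \<in> ch (par y) \<inter> leaves" "f' y \<in> B (par y)" "f' y \<notin> f ` inner"
    if "y \<in> V" "y \<notin> inner" for y
  proof -
    have "y \<noteq> rt" using cl that unfolding closed_def by auto
    thus p: "par y \<in> inner" "y \<in> ch (par y) \<inter> leaves"
      using that chI ch_inner V_split by blast+
    show b: "f' y \<in> B (par y)" using g(2)[OF p(1)] p(2) that unfolding f'_def by auto
    thus "f' y \<notin> f ` inner" using B(1) p(1) unfolding F_def by blast
  qed
  have "inj_on f' V"
  proof (rule inj_onI)
    fix a b assume ab: "a \<in> V" "b \<in> V" "f' a = f' b"
    consider "a \<in> inner" "b \<in> inner" | "a \<in> inner" "b \<notin> inner" | "a \<notin> inner" "b \<in> inner" | "a \<notin> inner" "b \<notin> inner"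
      by blast
    thus "a = b"
    proof cases
      case 1
      thus ?thesis using ab f unfolding f'_def emb_def by (auto dest: inj_onD)
    next
      case 2
      hence "f' a \<in> f ` inner" unfolding f'_def by simp
      thus ?thesis using leaf(4)[OF ab(2) 2(2)] ab(3) by simp
    next
      case 3
      hence "f' b \<in> f ` inner" unfolding f'_def by simp
      thus ?thesis using leaf(4)[OF ab(1) 3(1)] ab(3) by simp
    next
      case 4
      have "par a = par b"
        using leaf(1,3)[OF ab(1) 4(1)] leaf(1,3)[OF ab(2) 4(2)] ab(3) B(2) by (metis disjoint_iff)
      thus ?thesis using g(1)[OF leaf(1)[OF ab(1) 4(1)]] leaf(2)[OF ab(1) 4(1)] leaf(2)[OF ab(2) 4(2)] ab(3) 4
        unfolding f'_def by (auto dest: inj_onD)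
    qed
  qed
  moreover have "f' y \<in> nb R (sg (par y)) (f' (par y))" if y: "y \<in> V" "y \<noteq> rt" for y
  proof (cases "y \<in> inner")
    case True
    hence "par y \<in> inner" using cl y unfolding closed_def by auto
    thus ?thesis using True f y unfolding f'_def emb_def by auto
  next
    case False
    thus ?thesis using leaf[OF y(1) False] B(1) unfolding F_def f'_def by auto
  qed
  ultimately show ?thesis unfolding emb_def by blast
qed

end

section \<open>Embedding inner vertices one at a time\<close>

text \<open>The inner vertices of the tree are embedded first. An embedded vertex \<open>x\<close> with \<open>q > 0\<close> pending
  inner children demands \<open>q + max \<lambda> 2\<close> free neighbours, \<open>\<lambda>\<close> being its number of leaf children, and
  \<open>\<lambda>\<close> once \<open>q = 0\<close>. Hall's condition for these demands is maintained for single vertices and pairs; for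
  larger sets it is automatic as neighbourhoods overlap little. The demand leaves at least three candidates
  for the next inner vertex, and at most two of them can destroy Hall's condition.\<close>

locale engine = tree_host V rt par dep sg R c
  for V :: "'c set" and rt par dep sg and R :: "('a \<times> 'a) set" and c +
  fixes A :: "bool \<Rightarrow> 'a set" and sz :: "bool \<Rightarrow> nat" and k :: nat
  assumes coreA: "core R sz A" and card_Vk: "card V = k + 1"
begin

definition M :: "bool \<Rightarrow> 'a \<Rightarrow> 'a set" where "M \<sigma> u = nb R \<sigma> u \<inter> A (\<not> \<sigma>)"
definition lam :: "'c \<Rightarrow> nat" where "lam x = card (ch x \<inter> leaves)"
definition pend :: "'c set \<Rightarrow> 'c \<Rightarrow> 'c set" where "pend E x = ch x \<inter> inner - E"
definition dem :: "'c set \<Rightarrow> 'c \<Rightarrow> nat" where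
  "dem E x = (if pend E x = {} then lam x else card (pend E x) + max (lam x) 2)"
definition free :: "'c set \<Rightarrow> ('c \<Rightarrow> 'a) \<Rightarrow> 'c \<Rightarrow> 'a set" where "free E f x = M (sg x) (f x) - f ` E"
text \<open>The inner children of the root are embedded at once with it. Hence the root never has a
  pending child, its demand contains no slack, and the step bounds concern only vertices other than
  the root.\<close>

definition stage :: "'c set \<Rightarrow> bool" where
  "stage E \<longleftrightarrow> closed E \<and> E \<subseteq> inner \<and> ch rt \<inter> inner \<subseteq> E"
definition good :: "'c set \<Rightarrow> ('c \<Rightarrow> 'a) \<Rightarrow> bool" where
  "good E f \<longleftrightarrow> emb E f \<and> (\<forall>x\<in>E. f x \<in> A (sg x)) \<and>
    (\<forall>x\<in>E. dem E x \<le> card (free E f x)) \<and>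
    (\<forall>x\<in>E. \<forall>y\<in>E. x \<noteq> y \<longrightarrow> dem E x + dem E y \<le> card (free E f x \<union> free E f y))"

lemma fin_M [simp]: "finite (M \<sigma> u)" unfolding M_def by simp
lemma fin_free [simp]: "finite (free E f x)" unfolding free_def by simp
lemma fin_pend [simp]: "finite (pend E x)" unfolding pend_def by simp
lemma M_sub: "M \<sigma> u \<subseteq> nb R \<sigma> u" unfolding M_def by simp
lemma card_M: "u \<in> A \<sigma> \<Longrightarrow> sz \<sigma> \<le> card (M \<sigma> u)" using coreA unfolding core_def M_def by blast
lemma M_common: "u \<noteq> w \<Longrightarrow> card (M \<sigma> u \<inter> M \<tau> w) \<le> c" using common_sub M_sub by metis
lemma lam_le: "lam x \<le> card (ch x)" unfolding lam_def by (intro card_mono) auto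

lemma lam_pend:
  assumes "ch x \<inter> E = {}" "x \<in> V"
  shows "lam x + card (pend E x) = card (ch x)"
proof -
  have "ch x = (ch x \<inter> leaves) \<union> pend E x" using assms V_split ch_sub unfolding pend_def by blast
  moreover have "(ch x \<inter> leaves) \<inter> pend E x = {}" using V_split unfolding pend_def by blast
  ultimately show ?thesis unfolding lam_def by (metis card_Un_disjoint fin_ch finite_Int fin_pend)
qed

lemma dem_le: "dem E x \<le> card (pend E x) + max (card (ch x)) 2"
  using lam_le[of x] unfolding dem_def by auto

lemma card_stage_pend:
  assumes "E \<subseteq> inner" "finite X"
  shows "card E + (\<Sum>x\<in>X. card (pend E x)) \<le> card inner"
proof -
  have "(\<Sum>x\<in>X. card (pend E x)) = card (\<Union>x\<in>X. pend E x)"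
    using assms(2) ch_disjoint by (subst card_UN_disjoint) (auto simp: pend_def)
  moreover have "E \<inter> (\<Union>x\<in>X. pend E x) = {}" "E \<union> (\<Union>x\<in>X. pend E x) \<subseteq> inner"
    using assms(1) unfolding pend_def by auto
  ultimately show ?thesis
    using assms card_mono[of inner "E \<union> (\<Union>x\<in>X. pend E x)"] finite_subset[OF assms(1)]
    by (metis (no_types, lifting) card_Un_disjoint fin_inner finite_UN_I fin_pend)
qed

lemma card_inner: "card inner + card leaves = k + 1" using card_V card_Vk by simp

text \<open>One copy of \<open>card (pend E y)\<close> is split off on purpose: pending vertices are
  inner vertices outside \<open>E\<close>, so \<open>card_stage_pend\<close> absorbs this copy
  together with \<open>card E\<close>. The maximum reflects whether the slack 2 exceeds the number
  of leaf children.\<close>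

lemma new_dem3:
  assumes "ch y \<inter> E = {}" "y \<in> V"
  shows "3 * dem E y \<le> card (pend E y) + max (3 * card (ch y)) (2 * card (ch y) + 6)"
    and "2 * dem E y \<le> card (pend E y) + max (2 * card (ch y)) (card (ch y) + 4)"
  using lam_pend[OF assms] unfolding dem_def by (auto simp: max_def)

text \<open>Each pair of neighbourhoods costs \<open>c\<close> and the embedded vertices cost
  \<open>card E\<close>. For three or more vertices this estimate alone yields Hall's condition,
  without any bookkeeping.\<close>

lemma card_free_Un_ge:
  assumes E: "emb E f" "\<forall>x\<in>E. f x \<in> A (sg x)" "finite E" and X: "X \<subseteq> E"
  shows "(\<Sum>x\<in>X. sz (sg x)) \<le> card (\<Union>(free E f ` X)) + c * (card X choose 2) + card E"
proof -
  have finX: "finite X" using X E(3) finite_subset by blast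
  have "(\<Sum>x\<in>X. sz (sg x)) \<le> (\<Sum>x\<in>X. card (M (sg x) (f x)))"
    using E(2) X by (intro sum_mono card_M) auto
  also have "\<dots> \<le> card (\<Union>x\<in>X. M (sg x) (f x)) + c * (card X choose 2)"
  proof (rule card_UN_ge[OF finX])
    fix i j assume "i \<in> X" "j \<in> X" "i \<noteq> j"
    hence "f i \<noteq> f j" using E(1) X unfolding emb_def by (meson inj_onD subsetD)
    thus "card (M (sg i) (f i) \<inter> M (sg j) (f j)) \<le> c" by (rule M_common)
  qed simp
  also have "card (\<Union>x\<in>X. M (sg x) (f x)) \<le> card (\<Union>(free E f ` X) \<union> f ` E)"
    using finX E(3) unfolding free_def by (intro card_mono) auto
  also have "\<dots> \<le> card (\<Union>(free E f ` X)) + card E"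
    using card_Un_le[of "\<Union>(free E f ` X)" "f ` E"] card_image_le[OF E(3), of f] by linarith
  finally show ?thesis by linarith
qed

end

text \<open>\<open>bound1\<close> excludes three candidates that fail for the new vertex alone,
  \<open>bound2\<close> three candidates of which one fails together with an old vertex
  \<open>a\<close>, and \<open>bound3\<close> two candidates that fail with different old vertices.
  \<open>emb_le\<close> and \<open>emb_less\<close> are the inputs of \<open>hall_extension\<close>
  for at least three vertices; \<open>init1\<close> and \<open>init2\<close> start the process at
  the root, and \<open>four\<close> settles the leaves of four or more vertices.\<close>

locale engine_bounds = engine V rt par dep sg R c A sz k
  for V :: "'c set" and rt par dep sg and R :: "('a \<times> 'a) set" and c A sz k +
  fixes mm :: nat
  assumes mm: "mm = 2 \<or> mm = 3"
    and bound1: "\<And>y. y \<in> inner - {rt} \<Longrightarrow>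
      3 * c + k + max (3 * card (ch y)) (2 * card (ch y) + 6) < 3 * sz (sg y) + card leaves + 4"
    and bound2: "\<And>y a. y \<in> inner - {rt} \<Longrightarrow> a \<in> inner \<Longrightarrow> a \<noteq> y \<Longrightarrow>
      6 * c + k + max (3 * card (ch y)) (2 * card (ch y) + 6) + max (card (ch a)) 2
        < 3 * sz (sg y) + sz (sg a) + card leaves + 3"
    and bound3: "\<And>y a b. y \<in> inner - {rt} \<Longrightarrow> a \<in> inner \<Longrightarrow> b \<in> inner \<Longrightarrow> a \<noteq> y \<Longrightarrow> b \<noteq> y \<Longrightarrow> a \<noteq> b \<Longrightarrow>
      6 * c + k + max (2 * card (ch y)) (card (ch y) + 4) + max (card (ch a)) 2 + max (card (ch b)) 2
        < 2 * sz (sg y) + sz (sg a) + sz (sg b) + card leaves"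
    and emb_le: "\<And>E X. stage E \<Longrightarrow> X \<subseteq> E \<Longrightarrow> 3 \<le> card X \<Longrightarrow> card X \<le> mm \<Longrightarrow>
      sum (dem E) X + c * (card X choose 2) + card E \<le> (\<Sum>x\<in>X. sz (sg x))"
    and emb_less: "\<And>E X. stage E \<Longrightarrow> X \<subseteq> E \<Longrightarrow> mm < card X \<Longrightarrow> card X \<le> 2 * mm \<Longrightarrow>
      sum (dem E) X + c * (card X choose 2) + card E < (\<Sum>x\<in>X. sz (sg x))"
    and root_size: "card (ch rt) \<le> sz True"
    and init1: "\<And>y. y \<in> ch rt \<inter> inner \<Longrightarrow> 
      dem (insert rt (ch rt \<inter> inner)) y + min (c + 1) (card (ch rt \<inter> inner)) \<le> sz False \<and>
      card (ch rt) + dem (insert rt (ch rt \<inter> inner)) y + c + 1 \<le> sz True + sz False"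
    and init2: "\<And>y y'. y \<in> ch rt \<inter> inner \<Longrightarrow> y' \<in> ch rt \<inter> inner \<Longrightarrow> y \<noteq> y' \<Longrightarrow>
      dem (insert rt (ch rt \<inter> inner)) y + dem (insert rt (ch rt \<inter> inner)) y' + 3 * c + 1 \<le> 2 * sz False \<or>
      dem (insert rt (ch rt \<inter> inner)) y + dem (insert rt (ch rt \<inter> inner)) y' + c + card (ch rt \<inter> inner) + 1 \<le> 2 * sz False"
    and four: "\<And>X. X \<subseteq> inner \<Longrightarrow> card X = 4 \<Longrightarrow> 6 * c + k + 1 \<le> (\<Sum>x\<in>X. sz (sg x))"
    and rt_inner: "rt \<in> inner" and rt_A: "A True \<noteq> {}"
begin

text \<open>Every candidate in \<open>P\<close> is harmless for the old vertices: pairs without the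
  parent \<open>x\<close> are protected by \<open>hall_extension\<close>, and for pairs with
  \<open>x\<close> the lost vertex is compensated by the smaller demand of \<open>x\<close>. Only
  conditions involving the new vertex \<open>y\<close> can fail, alone (\<open>V1\<close>) or
  together with one old vertex (\<open>V2\<close>).\<close>

lemma inner_step:
  assumes st: "stage E" and g: "good E f" and y: "y \<in> inner" "y \<notin> E" and x: "par y \<in> E"
  shows "\<exists>z. good (insert y E) (f(y := z))"
proof -
  define x where "x = par y"
  let ?E = "insert y E"
  have cl: "closed E" and Ein: "E \<subseteq> inner" and finE: "finite E" and rtE: "rt \<in> E"
    using st finite_subset[of E inner] unfolding stage_def closed_def by auto
  have yV: "y \<in> V" "y \<noteq> rt" "y \<in> inner - {rt}" using y inner_sub rtE by auto
  have xE: "x \<in> E" and ych: "y \<in> ch x" and xy: "x \<noteq> y"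
    using x chI[OF yV(1,2)] y unfolding x_def by auto
  have sgy: "sg y \<longleftrightarrow> \<not> sg x" using sg_ch[OF ych] .
  have emb: "emb E f" and fA: "\<forall>v\<in>E. f v \<in> A (sg v)" using g unfolding good_def by auto
  have finj: "f a \<noteq> f b" if "a \<in> E" "b \<in> E" "a \<noteq> b" for a b
    using emb that unfolding emb_def by (meson inj_onD)
  have chyE: "ch y \<inter> E = {}" "ch y \<inter> ?E = {}" using closed_ch[OF cl y(2)] ch_irrefl by auto
  have pend_same: "pend ?E a = pend E a" if "a \<noteq> x" for a
    using ych ch_disjoint[OF that] unfolding pend_def by auto
  have dem_same: "dem ?E a = dem E a" if "a \<noteq> x" for a using pend_same[OF that] unfolding dem_def by simp
  have pend_x: "pend E x = insert y (pend ?E x)" "y \<notin> pend ?E x" using ych y unfolding pend_def by auto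
  \<comment> \<open>A vertex with a pending child demands at least 1 + 2, which yields the three
    candidates. Embedding \<open>y\<close> lowers this demand by at least one, even if
    \<open>y\<close> was the last pending child and the slack disappears.\<close>
  have dem_x: "dem ?E x + 1 \<le> dem E x" "3 \<le> dem E x"
    using pend_x unfolding dem_def by (auto simp: max_def)
  let ?F = "free E f"
  have sum2: "sum (dem E) X \<le> card (\<Union>(?F ` X))" if X: "X \<subseteq> E" "card X \<le> mm" for X
  proof -
    have finX: "finite X" using X finE finite_subset by blast
    consider "card X = 0" | "card X = 1" | "card X = 2" | "3 \<le> card X" by linarith
    thus ?thesis
    proof cases
      case 2
      then obtain a where "X = {a}" by (meson card_1_singletonE)
      thus ?thesis using g X unfolding good_def by auto
    next
      case 3
      then obtain a b where "X = {a, b}" "a \<noteq> b" by (meson card_2_iff)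
      thus ?thesis using g X unfolding good_def by auto
    next
      case 4
      thus ?thesis using emb_le[OF st X(1) 4 X(2)] card_free_Un_ge[OF emb fA finE X(1)] by linarith
    qed (use finX in simp)
  qed
  obtain P where P: "P \<subseteq> ?F x" "dem E x \<le> card P"
    "\<And>X z. X \<subseteq> E - {x} \<Longrightarrow> card X \<le> mm \<Longrightarrow> z \<in> P \<Longrightarrow> sum (dem E) X \<le> card (\<Union>(?F ` X) - {z})"
  proof (rule hall_extension[of E x mm ?F "dem E"])
    show "sum (dem E) X < card (\<Union>(?F ` X))" if "X \<subseteq> E" "mm < card X" "card X \<le> 2 * mm" for X
      using emb_less[OF st that] card_free_Un_ge[OF emb fA finE that(1)] by linarith
  qed (use finE xE mm sum2 in auto)
  have finP: "finite P" using finite_subset[OF P(1)] by simp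
  define G where "G = (\<lambda>z. M (sg y) z - f ` E)"
  let ?m = "dem ?E y"
  have finG: "finite (G z)" for z unfolding G_def by simp
  have zP: "z \<in> nb R (sg x) (f x)" "z \<in> A (sg y)" "z \<notin> f ` E" "z \<notin> G z" "f x \<in> M (sg y) z"
    "sz (sg y) \<le> card (M (sg y) z)" if "z \<in> P" for z
  proof -
    have z: "z \<in> M (sg x) (f x)" "z \<notin> f ` E" using that P(1) unfolding free_def by auto
    show "z \<in> nb R (sg x) (f x)" "z \<in> A (sg y)" "z \<notin> f ` E" using z sgy unfolding M_def by auto
    thus "sz (sg y) \<le> card (M (sg y) z)" using card_M by simp
    show "z \<notin> G z" using nb_irrefl unfolding G_def M_def by auto
    show "f x \<in> M (sg y) z" using z(1) nb_sym[of z R "sg x" "f x"] fA xE sgy unfolding M_def by auto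
  qed
  have m1: "1 \<le> ?m" using lam_pend[OF chyE(2) yV(1)] d_pos[OF y(1)] unfolding dem_def by auto
  have single: "dem ?E a \<le> card (?F a - {z})" if a: "a \<in> E" and z: "z \<in> P" for a z
  proof (cases "a = x")
    case True
    have "card (?F x) - 1 \<le> card (?F x - {z})" by (simp add: card_Diff_singleton_if)
    moreover have "dem E x \<le> card (?F x)" using g xE unfolding good_def by blast
    ultimately show ?thesis unfolding True using dem_x by linarith
  next
    case False
    thus ?thesis using P(3)[of "{a}" z] a z mm dem_same by auto
  qed
  have pair: "dem ?E a + dem ?E b \<le> card ((?F a \<union> ?F b) - {z})"
    if ab: "a \<in> E" "b \<in> E" "a \<noteq> b" and z: "z \<in> P" for a b z
  proof (cases "a = x \<or> b = x")
    case True
    have "card (?F a \<union> ?F b) - 1 \<le> card ((?F a \<union> ?F b) - {z})" by (simp add: card_Diff_singleton_if)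
    moreover have "dem E a + dem E b \<le> card (?F a \<union> ?F b)" using g ab unfolding good_def by blast
    moreover have "dem ?E a + dem ?E b + 1 \<le> dem E a + dem E b"
      using True ab dem_x dem_same[of a] dem_same[of b] by auto
    ultimately show ?thesis by linarith
  next
    case False
    thus ?thesis using P(3)[of "{a, b}" z] ab z mm dem_same by auto
  qed
  define V1 where "V1 = (\<lambda>z. card (G z) < ?m)"
  define V2 where "V2 = (\<lambda>z a. a \<in> E \<and> card ((G z \<union> ?F a) - {z}) < ?m + dem ?E a)"
  have ok: "good ?E (f(y := z))" if z: "z \<in> P" and n1: "\<not> V1 z" and n2: "\<And>a. \<not> V2 z a" for z
  proof -
    have img: "f(y := z) ` ?E = insert z (f ` E)" using y(2) by auto
    have Fa: "free ?E (f(y := z)) a = ?F a - {z}" if "a \<in> E" for a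
      using that y(2) unfolding free_def img by auto
    have Fy: "free ?E (f(y := z)) y = G z"
      using zP(4)[OF z] nb_irrefl unfolding free_def img G_def M_def by auto
    have "emb ?E (f(y := z))"
      using emb_extend[OF cl emb yV(1,2) y(2) x] zP(1,3)[OF z] unfolding x_def by blast
    moreover have "\<forall>v\<in>?E. (f(y := z)) v \<in> A (sg v)" using fA zP(2)[OF z] y(2) by auto
    moreover have "dem ?E a \<le> card (free ?E (f(y := z)) a)" if "a \<in> ?E" for a
      using that single[OF _ z] n1 Fa Fy unfolding V1_def by (auto simp: not_less)
    moreover have "dem ?E a + dem ?E b \<le> card (free ?E (f(y := z)) a \<union> free ?E (f(y := z)) b)"
      if ab: "a \<in> ?E" "b \<in> ?E" "a \<noteq> b" for a b
    proof -
      have *: "dem ?E y + dem ?E a \<le> card (G z \<union> (?F a - {z}))" if "a \<in> E" for a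
      proof -
        have "(G z \<union> ?F a) - {z} = G z \<union> (?F a - {z})" using zP(4)[OF z] by auto
        thus ?thesis using n2[of a] that unfolding V2_def by (auto simp: not_less)
      qed
      consider "a \<in> E" "b \<in> E" | "a = y" "b \<in> E" | "a \<in> E" "b = y" using ab by auto
      thus ?thesis
      proof cases
        case 1
        have "(?F a \<union> ?F b) - {z} = (?F a - {z}) \<union> (?F b - {z})" by auto
        thus ?thesis using pair[OF 1 ab(3) z] Fa 1 by simp
      next
        case 2
        thus ?thesis using *[of b] Fa Fy by simp
      next
        case 3
        thus ?thesis using *[of a] Fa Fy by (simp add: Un_commute add.commute)
      qed
    qed
    ultimately show ?thesis unfolding good_def by blast
  qed
  have V1_diff: "card (G z - ?F a) + 1 \<le> ?m" if "V1 z" for z a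
    using that card_mono[OF finG[of z], of "G z - ?F a"] unfolding V1_def by auto
  have V2_Un: "card (G z \<union> ?F a) \<le> ?m + dem ?E a" if "V2 z a" for z a
  proof -
    have "card (G z \<union> ?F a) - 1 \<le> card ((G z \<union> ?F a) - {z})" by (simp add: card_Diff_singleton_if)
    thus ?thesis using that unfolding V2_def by linarith
  qed
  \<comment> \<open>The set \<open>?F a - {z}\<close> still meets the demand of \<open>a\<close> by
    itself, so the deficit of the pair must come from the part of \<open>G z\<close> outside
    \<open>?F a\<close>.\<close>
  have V2_diff: "card (G z - ?F a) + 1 \<le> ?m" if v: "V2 z a" and z: "z \<in> P" for z a
  proof -
    have aE: "a \<in> E" using v unfolding V2_def by blast
    have "card ((G z \<union> ?F a) - {z}) = card (G z - ?F a) + card (?F a - {z})"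
    proof -
      have "(G z \<union> ?F a) - {z} = (G z - ?F a) \<union> (?F a - {z})" using zP(4)[OF z] by auto
      moreover have "(G z - ?F a) \<inter> (?F a - {z}) = {}" by auto
      ultimately show ?thesis using finG[of z] by (simp add: card_Un_disjoint)
    qed
    thus ?thesis using v single[OF aE z] unfolding V2_def by linarith
  qed
  have card_E: "card E + 1 + (\<Sum>a\<in>X. card (pend ?E a)) + card leaves \<le> k + 1" if "finite X" for X
    using card_stage_pend[of ?E X] that Ein y card_inner finE by simp
  have Gint: "card (M (sg y) z \<inter> M (sg y) z') \<le> c" if "z \<noteq> z'" for z z' using M_common[OF that] .
  have GF: "card (M (sg y) z \<inter> M (sg a) (f a)) \<le> c" if "z \<in> P" "a \<in> E" for z a
    using M_common zP(3)[OF that(1)] that(2) by (metis image_eqI)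
  have szF: "sz (sg a) \<le> card (M (sg a) (f a))" if "a \<in> E" for a using card_M fA that by blast
  have rem: "card U \<le> card (U - f ` E) + card E" for U
    using card_image_le[OF finE, of f] finE
    by (metis (no_types, opaque_lifting) add_le_cancel_left card_Un_le card_mono finite_Diff finite_Un finite_imageI Un_Diff_cancel2 Un_upper1 card.infinite le0 order_trans)
  have three: False if z: "z1 \<in> P" "z2 \<in> P" "z3 \<in> P" "z1 \<noteq> z2" "z1 \<noteq> z3" "z2 \<noteq> z3"
    and v: "V1 z1 \<or> (\<exists>a. V2 z1 a)" "V1 z2 \<or> (\<exists>a. V2 z2 a)" "V1 z3 \<or> (\<exists>a. V2 z3 a)" for z1 z2 z3
  proof -
    \<comment> \<open>Bad pairs with different old partners \<open>a\<close> and \<open>b\<close>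
      involve four neighbourhoods that lose at most \<open>6 * c\<close> by overlaps, more than both
      deficient unions can hold. Hence all bad candidates share one partner.\<close>
    have two: False if w: "z \<in> P" "z' \<in> P" "z \<noteq> z'" "V2 z a" "V2 z' b" "a \<noteq> b" for z z' a b
    proof -
      have E: "a \<in> E" "b \<in> E" using w unfolding V2_def by auto
      let ?U = "M (sg y) z \<union> M (sg y) z' \<union> M (sg a) (f a) \<union> M (sg b) (f b)"
      have "2 * sz (sg y) + sz (sg a) + sz (sg b) \<le> card ?U + 6 * c"
        using card_Un4_ge[of "M (sg y) z" "M (sg y) z'" "M (sg a) (f a)" "M (sg b) (f b)" c]
          Gint[OF w(3)] GF w E M_common[OF finj[OF E w(6)]] zP(6)[OF w(1)] zP(6)[OF w(2)] szF[OF E(1)] szF[OF E(2)]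
        by simp
      also have "card ?U \<le> card (?U - f ` E) + card E" by (rule rem)
      also have "?U - f ` E = (G z \<union> ?F a) \<union> (G z' \<union> ?F b)" unfolding G_def free_def by auto
      also have "card \<dots> \<le> (?m + dem ?E a) + (?m + dem ?E b)"
        using card_Un_le[of "G z \<union> ?F a" "G z' \<union> ?F b"] V2_Un[OF w(4)] V2_Un[OF w(5)] by linarith
      finally have "2 * sz (sg y) + sz (sg a) + sz (sg b) \<le> 2 * ?m + dem ?E a + dem ?E b + card E + 6 * c" by simp
      moreover have "y \<noteq> a" "y \<noteq> b" using E y by auto
      moreover have "card E + 1 + (card (pend ?E y) + (card (pend ?E a) + card (pend ?E b))) + card leaves \<le> k + 1"
        using card_E[of "{y, a, b}"] \<open>y \<noteq> a\<close> \<open>y \<noteq> b\<close> w(6) by simp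
      moreover have "6 * c + k + max (2 * card (ch y)) (card (ch y) + 4) + max (card (ch a)) 2 + max (card (ch b)) 2
        < 2 * sz (sg y) + sz (sg a) + sz (sg b) + card leaves"
        using E Ein w(6) \<open>y \<noteq> a\<close> \<open>y \<noteq> b\<close> by (intro bound3[OF yV(3)]) auto
      ultimately show False
        using new_dem3(2)[OF chyE(2) yV(1)] dem_le[of ?E a] dem_le[of ?E b] by linarith
    qed
    show False
    proof (cases "V1 z1 \<and> V1 z2 \<and> V1 z3")
      case True
      let ?U = "M (sg y) z1 \<union> M (sg y) z2 \<union> M (sg y) z3"
      \<comment> \<open>The image \<open>f x\<close> of the parent is adjacent to all three
        candidates; being a common point it supplies the extra 1.\<close>
      have "3 * sz (sg y) + 1 \<le> card ?U + 3 * c"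
        using card_Un3_common_ge[of "M (sg y) z1" "M (sg y) z2" "M (sg y) z3" c "f x"] Gint z zP(5,6)[OF z(1)]
          zP(5,6)[OF z(2)] zP(5,6)[OF z(3)] by simp
      also have "card ?U \<le> card (?U - f ` E) + card E" by (rule rem)
      also have "?U - f ` E = G z1 \<union> G z2 \<union> G z3" unfolding G_def by auto
      also have "card \<dots> \<le> card (G z1) + card (G z2) + card (G z3)"
        by (meson add_le_mono card_Un_le order_refl order_trans)
      finally have "3 * sz (sg y) + 4 \<le> 3 * ?m + card E + 3 * c" using True m1 unfolding V1_def by linarith
      thus False using bound1[OF yV(3)] card_E[of "{y}"] new_dem3(1)[OF chyE(2) yV(1)] by simp
    next
      case False
      \<comment> \<open>With a single partner \<open>a\<close>, the set \<open>?F a\<close> is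
        counted once, together with \<open>G z\<close>. Outside it the two other free sets have at
        most \<open>?m - 1\<close> elements each, whether their candidate fails alone or with
        \<open>a\<close>.\<close>
      then obtain z a where za: "z \<in> {z1, z2, z3}" "V2 z a" using v by blast
      have diff: "card (G w - ?F a) + 1 \<le> ?m" if w: "w \<in> {z1, z2, z3}" for w
      proof -
        have wP: "w \<in> P" "z \<in> P" using w za z by auto
        have "V1 w \<or> (\<exists>b. V2 w b)" using w v by blast
        moreover have "b = a" if "V2 w b" "w \<noteq> z" for b using two[OF wP that(2,1) za(2)] by blast
        ultimately have "V1 w \<or> V2 w a" using za(2) by (cases "w = z") auto
        thus ?thesis using V1_diff[of w a] V2_diff[of w a] wP by blast
      qed
      have aE: "a \<in> E" using za unfolding V2_def by blast
      let ?U = "M (sg y) z1 \<union> M (sg y) z2 \<union> M (sg y) z3 \<union> M (sg a) (f a)"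
      have "3 * sz (sg y) + sz (sg a) + 1 \<le> card ?U + 6 * c"
        using card_Un4_common_ge[of "M (sg y) z1" "M (sg y) z2" "M (sg y) z3" "M (sg a) (f a)" c "f x"]
          Gint z GF aE szF[OF aE] zP(5,6)[OF z(1)] zP(5,6)[OF z(2)] zP(5,6)[OF z(3)] by simp
      moreover have "card ?U \<le> card (?U - f ` E) + card E" by (rule rem)
      moreover have "card (?U - f ` E) + 2 \<le> ?m + dem ?E a + 2 * ?m"
      proof -
        obtain w w' where ww: "{z1, z2, z3} = {z, w, w'}" using za(1) by auto
        have "?U - f ` E = (G z \<union> ?F a) \<union> ((G w - ?F a) \<union> (G w' - ?F a))"
        proof -
          have "?U - f ` E = (\<Union>v\<in>{z1, z2, z3}. G v) \<union> ?F a" unfolding G_def free_def by auto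
          thus ?thesis unfolding ww by auto
        qed
        moreover have "card ((G z \<union> ?F a) \<union> ((G w - ?F a) \<union> (G w' - ?F a)))
            \<le> card (G z \<union> ?F a) + (card (G w - ?F a) + card (G w' - ?F a))"
          by (meson add_le_mono card_Un_le order_refl order_trans)
        ultimately show ?thesis using V2_Un[OF za(2)] diff[of w] diff[of w'] ww by auto
      qed
      ultimately have "3 * sz (sg y) + sz (sg a) + 3 \<le> 3 * ?m + dem ?E a + card E + 6 * c" by linarith
      moreover have ya: "y \<noteq> a" using aE y by auto
      moreover have "card E + 1 + (card (pend ?E y) + card (pend ?E a)) + card leaves \<le> k + 1"
        using card_E[of "{y, a}"] ya by simp
      moreover have "6 * c + k + max (3 * card (ch y)) (2 * card (ch y) + 6) + max (card (ch a)) 2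
        < 3 * sz (sg y) + sz (sg a) + card leaves + 3"
        using aE Ein ya by (intro bound2[OF yV(3)]) auto
      ultimately show False
        using new_dem3(1)[OF chyE(2) yV(1)] dem_le[of ?E a] by linarith
    qed
  qed
  obtain Z where Z: "Z \<subseteq> P" "card Z = 3" using obtain_subset_with_card_n[of 3 P] P(2) dem_x by auto
  then obtain z1 z2 z3 where zz: "Z = {z1, z2, z3}" "z1 \<noteq> z2" "z2 \<noteq> z3" "z1 \<noteq> z3" by (metis card_3_iff)
  then obtain z where "z \<in> P" "\<not> V1 z" "\<And>a. \<not> V2 z a" using three[of z1 z2 z3] Z(1) by auto
  thus ?thesis using ok by blast
qed

text \<open>The root goes to any vertex of \<open>A True\<close>, and its inner children go anywhere
  into \<open>M True v\<close>. That all of them lie in one neighbourhood is what limits their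
  interference: any other neighbourhood meets it in at most \<open>c\<close> vertices.\<close>

lemma root_start:
  defines "E0 \<equiv> insert rt (ch rt \<inter> inner)"
  shows "stage E0 \<and> (\<exists>f. good E0 f)"
proof -
  let ?Q = "ch rt \<inter> inner"
  have cl: "closed E0" using closed_Un_ch[OF closed_rt, of rt ?Q] unfolding E0_def by auto
  have st: "stage E0" using cl rt_inner unfolding stage_def E0_def by auto
  obtain v where v: "v \<in> A True" using rt_A by blast
  have cM: "sz True \<le> card (M True v)" using card_M[OF v] .
  have "card ?Q \<le> card (ch rt)" by (intro card_mono) auto
  hence cQ: "card ?Q \<le> card (M True v)" using cM root_size by linarith
  have QE: "?Q \<inter> {rt} = {}" using ch_sub(2) by auto
  have vM: "v \<notin> M True v" using nb_irrefl unfolding M_def by auto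
  obtain f where f: "emb ({rt} \<union> ?Q) f" "f rt = v" "f ` ?Q \<subseteq> M True v"
  proof (rule emb_extend_set[OF closed_rt emb_rt[of "\<lambda>_. v"], of rt ?Q "M True v"])
    show "M True v \<subseteq> nb R (sg rt) v" using sg_rt M_sub by simp
    show "M True v \<inter> (\<lambda>_. v) ` {rt} = {}" using vM by auto
  qed (use QE cQ that in auto)
  have E0: "{rt} \<union> ?Q = E0" unfolding E0_def by auto
  have emb: "emb E0 f" using f(1) unfolding E0 .
  have finj: "f a \<noteq> f b" if "a \<in> E0" "b \<in> E0" "a \<noteq> b" for a b
    using emb that unfolding emb_def by (meson inj_onD)
  have img: "f ` E0 = insert v (f ` ?Q)" unfolding E0_def using f(2) by auto
  have fA: "f x \<in> A (sg x)" if "x \<in> E0" for x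
    using that f v sg_rt sg_ch[of x rt] unfolding E0_def M_def by auto
  have dem_rt: "dem E0 rt = lam rt" unfolding dem_def pend_def E0_def by auto
  have lamQ: "lam rt + card ?Q = card (ch rt)"
  proof -
    have "ch rt = (ch rt \<inter> leaves) \<union> ?Q" "(ch rt \<inter> leaves) \<inter> ?Q = {}" using V_split ch_sub by blast+
    thus ?thesis unfolding lam_def by (metis card_Un_disjoint fin_ch finite_Int)
  qed
  have free_rt: "sz True \<le> card (free E0 f rt) + card ?Q"
  proof -
    have "card (M True v) \<le> card (free E0 f rt \<union> f ` ?Q)"
      using vM img f(2) sg_rt unfolding free_def by (intro card_mono) auto
    also have "\<dots> \<le> card (free E0 f rt) + card ?Q"
      using card_Un_le[of "free E0 f rt" "f ` ?Q"] card_image_le[of ?Q f] by simp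
    finally show ?thesis using cM by linarith
  qed
  have Qy: "y \<in> E0" "y \<noteq> rt" "\<not> sg y" "f y \<noteq> v" "sz False \<le> card (M False (f y))" if y: "y \<in> ?Q" for y
  proof -
    show yE: "y \<in> E0" "y \<noteq> rt" "\<not> sg y" using y sg_ch[of y rt] sg_rt ch_sub(2) unfolding E0_def by auto
    show "f y \<noteq> v" using finj[OF yE(1) _ yE(2)] f(2) unfolding E0_def by auto
    show "sz False \<le> card (M False (f y))" using card_M[OF fA[OF yE(1)]] yE(3) by simp
  qed
  \<comment> \<open>The siblings of \<open>y\<close> lie in \<open>M True v\<close>, which shares at
    most \<open>c\<close> vertices with \<open>M False (f y)\<close>; the extra 1 is
    \<open>v\<close>. Counting only outside \<open>M True v\<close> keeps the result disjoint from
    the free set of the root, as \<open>rt_pair\<close> requires.\<close>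
  have outside: "sz False \<le> card (free E0 f y - M True v) + c + 1" if y: "y \<in> ?Q" for y
  proof -
    have "card (M False (f y)) \<le> card ((free E0 f y - M True v) \<union> (insert v (M False (f y) \<inter> M True v)))"
      using img f(3) Qy(3)[OF y] unfolding free_def by (intro card_mono) auto
    also have "\<dots> \<le> card (free E0 f y - M True v) + card (insert v (M False (f y) \<inter> M True v))"
      by (rule card_Un_le)
    also have "card (insert v (M False (f y) \<inter> M True v)) \<le> c + 1"
      using M_common[OF Qy(4)[OF y], of False True] by (simp add: card_insert_if)
    finally show ?thesis using Qy(5)[OF y] by linarith
  qed
  have single: "dem E0 y \<le> card (free E0 f y)" if y: "y \<in> ?Q" for y
  proof -
    have "card (M False (f y)) \<le> card (free E0 f y \<union> f ` (E0 - {y}))"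
      using Qy(3)[OF y] nb_irrefl unfolding free_def M_def E0_def by (intro card_mono) auto
    also have "\<dots> \<le> card (free E0 f y) + card (f ` (E0 - {y}))" by (rule card_Un_le)
    also have "card (f ` (E0 - {y})) \<le> card ?Q"
    proof -
      have "card (f ` (E0 - {y})) \<le> card (E0 - {y})" unfolding E0_def by (intro card_image_le) auto
      also have "\<dots> = card ?Q" using Qy(1)[OF y] ch_sub(2) unfolding E0_def by simp
      finally show ?thesis .
    qed
    finally have "sz False \<le> card (free E0 f y) + card ?Q" using Qy(5)[OF y] by linarith
    moreover have "card (free E0 f y - M True v) \<le> card (free E0 f y)" by (intro card_mono) auto
    ultimately show ?thesis using outside[OF y] init1[OF y] unfolding E0_def[symmetric] by linarith
  qed
  have rt_pair: "dem E0 rt + dem E0 y \<le> card (free E0 f rt \<union> free E0 f y)" if y: "y \<in> ?Q" for y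
  proof -
    have "free E0 f rt \<subseteq> M True v" using f(2) sg_rt unfolding free_def by auto
    hence "card (free E0 f rt) + card (free E0 f y - M True v) = card (free E0 f rt \<union> (free E0 f y - M True v))"
      by (subst card_Un_disjoint) auto
    also have "\<dots> \<le> card (free E0 f rt \<union> free E0 f y)" by (intro card_mono) auto
    finally show ?thesis
      using outside[OF y] free_rt dem_rt init1[OF y] lamQ unfolding E0_def[symmetric] by linarith
  qed
  have pair: "dem E0 y + dem E0 y' \<le> card (free E0 f y \<union> free E0 f y')" if yy: "y \<in> ?Q" "y' \<in> ?Q" "y \<noteq> y'" for y y'
  proof -
    have E: "y \<in> E0" "y' \<in> E0" "\<not> sg y" "\<not> sg y'" "y \<noteq> rt" "y' \<noteq> rt"
      using yy sg_ch[of y rt] sg_ch[of y' rt] sg_rt ch_sub(2) unfolding E0_def by auto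
    let ?X = "M False (f y)" and ?Y = "M False (f y')"
    have sz: "2 * sz False \<le> card (?X \<union> ?Y) + c"
      using card_Un2_ge[of ?X ?Y c] M_common[OF finj[OF E(1,2) yy(3)]]
        card_M[OF fA[OF E(1)]] card_M[OF fA[OF E(2)]] E(3,4) by simp
    have eq: "free E0 f y \<union> free E0 f y' = (?X \<union> ?Y) - f ` E0" using E unfolding free_def by auto
    have "card (?X \<union> ?Y) \<le> card ((?X \<union> ?Y) - f ` E0) + card ((?X \<union> ?Y) \<inter> f ` E0)"
      by (metis card_Un_le Un_Diff_Int)
    moreover have "card ((?X \<union> ?Y) \<inter> f ` E0) \<le> 2 * c + 1"
    proof -
      have "(?X \<union> ?Y) \<inter> f ` E0 \<subseteq> insert v (?X \<inter> M True v \<union> ?Y \<inter> M True v)" using img f(3) by auto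
      hence "card ((?X \<union> ?Y) \<inter> f ` E0) \<le> card (insert v (?X \<inter> M True v \<union> ?Y \<inter> M True v))"
        by (intro card_mono) auto
      also have "\<dots> \<le> 1 + card (?X \<inter> M True v \<union> ?Y \<inter> M True v)" by (simp add: card_insert_if)
      also have "\<dots> \<le> 1 + (card (?X \<inter> M True v) + card (?Y \<inter> M True v))" by (simp add: card_Un_le)
      also have "card (?X \<inter> M True v) \<le> c"
        using M_common[of "f y" v] finj[OF E(1) _ E(5)] f(2) unfolding E0_def by auto
      also have "card (?Y \<inter> M True v) \<le> c"
        using M_common[of "f y'" v] finj[OF E(2) _ E(6)] f(2) unfolding E0_def by auto
      finally show ?thesis by simp
    qed
    \<comment> \<open>Second bound for the same loss, better when the root has few inner children;
      \<open>init2\<close> offers one alternative for each bound.\<close>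
    moreover have "card ((?X \<union> ?Y) \<inter> f ` E0) \<le> card ?Q + 1"
    proof -
      have "card ((?X \<union> ?Y) \<inter> f ` E0) \<le> card (f ` E0)" unfolding E0_def by (intro card_mono) auto
      also have "\<dots> \<le> card E0" unfolding E0_def by (intro card_image_le) auto
      also have "\<dots> \<le> card ?Q + 1" unfolding E0_def by (simp add: card_insert_if)
      finally show ?thesis .
    qed
    ultimately show ?thesis using init2[OF yy] sz unfolding eq E0_def[symmetric] by linarith
  qed
  have "good E0 f"
    unfolding good_def
  proof (intro conjI ballI impI)
    show "dem E0 x \<le> card (free E0 f x)" if "x \<in> E0" for x
      using that single free_rt dem_rt root_size lamQ unfolding E0_def by auto
    show "dem E0 x + dem E0 y \<le> card (free E0 f x \<union> free E0 f y)" if xy: "x \<in> E0" "y \<in> E0" "x \<noteq> y" for x y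
    proof -
      consider "x = rt" "y \<in> ?Q" | "y = rt" "x \<in> ?Q" | "x \<in> ?Q" "y \<in> ?Q"
        using xy unfolding E0_def by auto
      thus ?thesis
      proof cases
        case 1
        thus ?thesis using rt_pair[of y] by simp
      next
        case 2
        thus ?thesis using rt_pair[of x] by (simp only: Un_commute add.commute)
      next
        case 3
        thus ?thesis using pair xy(3) by blast
      qed
    qed
  qed (use emb fA in auto)
  thus ?thesis using st by blast
qed

lemma stage_insert: "stage E \<Longrightarrow> y \<in> inner \<Longrightarrow> par y \<in> E \<Longrightarrow> stage (insert y E)"
  unfolding stage_def using closed_insert inner_sub by auto

lemma inner_run: "stage E \<Longrightarrow> good E f \<Longrightarrow> \<exists>f. good inner f"
proof (induction "card (inner - E)" arbitrary: E f rule: less_induct)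
  case less
  show ?case
  proof (cases "inner \<subseteq> E")
    case True
    thus ?thesis using less.prems unfolding stage_def by auto
  next
    case False
    have "closed E" "closed inner" using less.prems closed_inner rt_inner unfolding stage_def by auto
    then obtain y where y: "y \<in> inner" "y \<notin> E" "par y \<in> E" using closed_step[of E inner] False by blast
    then obtain z where z: "good (insert y E) (f(y := z))" using inner_step[OF less.prems] by blast
    have "inner - insert y E \<subset> inner - E" using y by auto
    hence "card (inner - insert y E) < card (inner - E)" by (intro psubset_card_mono) auto
    thus ?thesis using less.hyps z stage_insert[OF less.prems(1) y(1,3)] by blast
  qed
qed

theorem engine_embeds: "\<exists>f. emb V f"
proof -
  obtain f where g: "good inner f" using root_start inner_run by blast
  have emb: "emb inner f" and fA: "\<forall>x\<in>inner. f x \<in> A (sg x)" using g unfolding good_def by auto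
  have st: "stage inner" using closed_inner rt_inner unfolding stage_def by auto
  have dem: "dem inner x = lam x" for x unfolding dem_def pend_def by auto
  have sub: "\<Union>(free inner f ` X) \<subseteq> (\<Union>x\<in>X. nb R (sg x) (f x) - f ` inner)" for X
    using M_sub unfolding free_def by blast
  show ?thesis
  proof (rule emb_leaves[OF _ emb])
    show "inner \<noteq> {}" using rt_inner by auto
    fix X assume X: "X \<subseteq> inner"
    have finX: "finite X" using finite_subset[OF X] by simp
    have "(\<Sum>x\<in>X. lam x) \<le> card (\<Union>(free inner f ` X))"
    proof -
      consider "card X = 0" | "card X = 1" | "card X = 2" | "card X = 3" | "4 \<le> card X" by linarith
      thus ?thesis
      proof cases
        case 2
        then obtain a where "X = {a}" by (meson card_1_singletonE)
        thus ?thesis using g X dem unfolding good_def by auto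
      next
        case 3
        then obtain a b where "X = {a, b}" "a \<noteq> b" by (meson card_2_iff)
        thus ?thesis using g X dem unfolding good_def by auto
      next
        case 4
        have "sum (dem inner) X + c * (card X choose 2) + card inner \<le> (\<Sum>x\<in>X. sz (sg x))"
          using emb_le[OF st X] emb_less[OF st X] 4 mm by force
        thus ?thesis using card_free_Un_ge[OF emb fA fin_inner X] dem by simp
      next
        \<comment> \<open>Four inner vertices together see at least \<open>card leaves\<close> free
          vertices, and no set can demand more than that.\<close>
        case 5
        then obtain Y where Y: "Y \<subseteq> X" "card Y = 4" using obtain_subset_with_card_n by metis
        have "(\<Sum>x\<in>X. lam x) = card (\<Union>x\<in>X. ch x \<inter> leaves)"
          using finX ch_disjoint unfolding lam_def by (subst card_UN_disjoint) auto
        also have "\<dots> \<le> card leaves" by (intro card_mono) auto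
        also have "\<dots> \<le> card (\<Union>(free inner f ` Y))"
        proof -
          have YI: "Y \<subseteq> inner" using Y X by blast
          have "(4 choose 2) = (6 :: nat)" by (simp add: numeral_eq_Suc)
          thus ?thesis using four[OF YI Y(2)] card_free_Un_ge[OF emb fA fin_inner YI] card_inner Y(2) by simp
        qed
        also have "\<dots> \<le> card (\<Union>(free inner f ` X))" using Y finX by (intro card_mono) auto
        finally show ?thesis .
      qed (use finX in simp)
    qed
    also have "\<dots> \<le> card (\<Union>x\<in>X. nb R (sg x) (f x) - f ` inner)"
      using sub finX by (intro card_mono) auto
    finally show "(\<Sum>x\<in>X. card (ch x \<inter> leaves)) \<le> card (\<Union>x\<in>X. nb R (sg x) (f x) - f ` inner)"
      unfolding lam_def .
  qed
qed

end

section \<open>The numerical conditions\<close>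

text \<open>The degree bound \<open>x\<close> is chosen as close to \<open>(k + 1) / 2\<close> as possible: \<open>u\<close> is the largest
  value allowed by the fourth inequality and \<open>l\<close> the smallest one allowed by the eleventh.\<close>

lemma engine_arith:
  fixes k c D a b :: nat
  assumes c: "1 \<le> c" "12 * c < k" "k \<le> 12 * c + 12"
    and b: "1 \<le> b" "b + 1 \<le> D" and a: "a + 1 \<le> D"
    and t: "D + b + 3 * c + 1 \<le> k" "D + a + b \<le> k"
    and small: "2 * D \<le> k + 2 * c \<or> (2 * D + 3 \<le> k + 3 * c \<and> 2 * D + b < 4 * c + k)"
  obtains x y where "x + y = k + 1" "D \<le> x"
    "3 * c + k + max (2 * b) (b + 6) < 3 * y + D + (a - 1) + 3"
    "6 * c + k + max (2 * b) (b + 6) < 3 * y + x + (a - 1) + 2"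
    "6 * c + k + max (2 * b) (b + 6) < 4 * y + D"
    "6 * c + k + max b 4 + 3 < 3 * y + x + (a - 1)"
    "6 * c + max b 4 + 1 < k"
    "6 * c + k + max b 4 + 5 < 4 * y + D"
    "6 * c + max b 4 + 4 < 2 * y + D"
    "1 \<le> a \<Longrightarrow> 3 * c + k + max (2 * a) (a + 6) < 3 * x + D + b + 2"
    "1 \<le> a \<Longrightarrow> 6 * c + k + max (2 * a) (a + 6) < 4 * x + b + 1"
    "1 \<le> a \<Longrightarrow> 6 * c + max (2 * a) (a + 6) < 2 * x + 1 + D"
    "1 \<le> a \<Longrightarrow> 6 * c + max a 4 + 2 < 2 * x"
    "1 \<le> a \<Longrightarrow> 6 * c + k + max a 4 + 4 < 4 * x + b"
    "1 \<le> a \<Longrightarrow> 6 * c + k + max a 4 + 5 < 4 * x + D"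
    "1 \<le> a \<Longrightarrow> 6 * c + max a 4 + 4 < 2 * x + D"
    "6 * c + k + 1 \<le> 4 * x" "6 * c + k + 1 \<le> 4 * y" "3 * c + 3 \<le> x" "3 * c + 3 \<le> y"
    "k \<noteq> 14 \<Longrightarrow> 3 * c + 4 \<le> min x y \<or> 3 * c + 6 < min x y + D"
    "k \<noteq> 14 \<Longrightarrow> 1 \<le> a \<Longrightarrow> 3 * c + k + 4 < 3 * x \<or> 3 * c + k + 7 < 3 * x + D"
    "k \<noteq> 14 \<Longrightarrow> 1 \<le> a \<Longrightarrow> 3 * c + k + 3 < 3 * x \<or> 3 * c + k + 6 < 3 * x + b"
    "k \<noteq> 14 \<Longrightarrow> 3 * c + k + 4 < 3 * y \<or> 3 * c + k + 7 < 3 * y + D"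
    "k \<noteq> 14 \<Longrightarrow> 1 \<le> a \<Longrightarrow> 6 * c + k + 5 < 4 * x \<or> 6 * c + k + 9 < 4 * x + D"
    "k \<noteq> 14 \<Longrightarrow> 1 \<le> a \<Longrightarrow> 6 * c + k + 4 < 4 * x \<or> 6 * c + k + 8 < 4 * x + b"
    "k \<noteq> 14 \<Longrightarrow> 6 * c + k + 5 < 4 * y \<or> 6 * c + k + 9 < 4 * y + D"
    "k \<noteq> 14 \<Longrightarrow> 6 * c + 4 < 2 * min x y" "k = 14 \<Longrightarrow> 7 \<le> min x y"
    "b + c + 1 \<le> y"
    "\<And>q n. 1 \<le> a \<Longrightarrow> q \<le> b \<Longrightarrow> 1 \<le> n \<Longrightarrow> D + 2 * q + (a - 1) + n \<le> k + 1 \<Longrightarrow> q + 2 + min (c + 1) n \<le> y"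
    "c + k + 5 \<le> D + 2 * y \<or> 2 * b + 3 * c + 5 \<le> 2 * y"
proof -
  define a1 where "a1 = a - 1"
  have a1: "a = a1 + 1 \<or> (a = 0 \<and> a1 = 0)" unfolding a1_def by auto
  define u where "u = (2 * k + 4 + a1 - 6 * c - max (2 * b) (b + 6)) div 2"
  define e where "e = 6 * c + k + max (2 * a) (a + 6) - b - 1"
  define l where "l = e div 4 + 1"
  define h where "h = (k + 1) div 2"
  \<comment> \<open>The cap \<open>u\<close> overrides the wishes \<open>h\<close> and
    \<open>l\<close>, and \<open>D\<close> overrides everything because all children of the root
    must fit into one neighbourhood. The bound \<open>l\<close> concerns sources below the root and
    is dropped if there are none.\<close>
  define x where "x = max D (min u (max h (if 1 \<le> a then l else 0)))"
  define y where "y = k + 1 - x"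
  have h: "2 * h \<le> k + 1" "k \<le> 2 * h" unfolding h_def by linarith+
  have hc: "6 * c + 1 \<le> h" "k = 2 * h \<or> k + 1 = 2 * h" using c(2) h by presburger+
  have ub: "6 * c + max (2 * b) (b + 6) \<le> 2 * k + 4 + a1" using b t by auto
  have u: "2 * u + 6 * c + max (2 * b) (b + 6) \<le> 2 * k + 4 + a1"
    "2 * k + 3 + a1 \<le> 2 * u + 6 * c + max (2 * b) (b + 6)"
    using ub unfolding u_def by linarith+
  have e: "e + b + 1 = 6 * c + k + max (2 * a) (a + 6)" using b t unfolding e_def by auto
  have "e < 4 * l" "4 * l \<le> e + 4" unfolding l_def by presburger+
  hence l: "6 * c + k + max (2 * a) (a + 6) < 4 * l + b + 1" "4 * l + b \<le> 6 * c + k + max (2 * a) (a + 6) + 3"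
    using e by linarith+
  have Dx: "D \<le> x" unfolding x_def by simp
  have "x = D \<or> x \<le> u" unfolding x_def by auto
  hence up: "x = D \<or> (2 * x + 6 * c + 2 * b \<le> 2 * k + 4 + a1 \<and> 2 * x + 6 * c + b + 6 \<le> 2 * k + 4 + a1)"
    using u(1) by auto
  have xu: "2 * k + 3 + a1 \<le> 2 * x + 6 * c + 2 * b \<or> 2 * k + 3 + a1 \<le> 2 * x + 6 * c + b + 6" if "u \<le> x"
    using that u(2) by (auto simp: max_def split: if_splits)
  have "h \<le> x \<or> u \<le> x" unfolding x_def by auto
  hence lo1: "h \<le> x \<or> 2 * k + 3 + a1 \<le> 2 * x + 6 * c + 2 * b \<or> 2 * k + 3 + a1 \<le> 2 * x + 6 * c + b + 6"
    using xu by linarith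
  hence lo: "k \<le> 2 * x \<or> 2 * k + 3 + a1 \<le> 2 * x + 6 * c + 2 * b \<or> 2 * k + 3 + a1 \<le> 2 * x + 6 * c + b + 6"
    using h(2) by linarith
  have lo2: "(6 * c + k + 2 * a \<le> 4 * x + b \<and> 6 * c + k + a + 6 \<le> 4 * x + b) \<or>
    2 * k + 3 + a1 \<le> 2 * x + 6 * c + 2 * b \<or> 2 * k + 3 + a1 \<le> 2 * x + 6 * c + b + 6" if "1 \<le> a"
  proof -
    have "l \<le> x \<or> u \<le> x" using that unfolding x_def by auto
    thus ?thesis using xu l(1) by auto
  qed
  \<comment> \<open>From here on \<open>x\<close> enters only through linear disjunctions, one
    alternative for each quantity that may have determined it; every inequality is checked
    alternative by alternative.\<close>
  have "x = D \<or> x \<le> h \<or> (1 \<le> a \<and> x \<le> l)" unfolding x_def by auto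
  hence up2: "x = D \<or> x \<le> h \<or> (1 \<le> a \<and> 6 \<le> a \<and> 4 * x + b \<le> 6 * c + k + 2 * a + 3) \<or>
    (1 \<le> a \<and> a \<le> 6 \<and> 4 * x + b \<le> 6 * c + k + a + 9)"
    using l(2) by (auto simp: max_def split: if_splits)
  hence upk: "x = D \<or> 2 * x \<le> k + 1 \<or> (1 \<le> a \<and> 6 \<le> a \<and> 4 * x + b \<le> 6 * c + k + 2 * a + 3) \<or>
    (1 \<le> a \<and> a \<le> 6 \<and> 4 * x + b \<le> 6 * c + k + a + 9)" using h(1) by linarith
  have "x \<le> k" using up2 t a b c(2) h(1) by (elim disjE conjE; linarith)
  hence xy: "x + y = k + 1" unfolding y_def by simp
  note base = c(1,2) b(1) xy Dx
  have ap: "a = a1 + 1" if "1 \<le> a" using that a1 by linarith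
  show ?thesis
  proof (rule that[of x y])
    show "x + y = k + 1" "D \<le> x" by (fact xy Dx)+
    show "3 * c + k + max (2 * b) (b + 6) < 3 * y + D + (a - 1) + 3"
      using base a1 b(2) a t(1) up upk unfolding a1_def[symmetric] by (elim disjE conjE; linarith)
    show "6 * c + k + max (2 * b) (b + 6) < 3 * y + x + (a - 1) + 2"
      using base a1 t(1) up unfolding a1_def[symmetric] by (elim disjE conjE; linarith)
    show "6 * c + k + max (2 * b) (b + 6) < 4 * y + D"
      using base a1 b(2) a t(1) upk unfolding a1_def[symmetric] by (elim disjE conjE; linarith)
    show "6 * c + k + max b 4 + 3 < 3 * y + x + (a - 1)"
      using base a1 b(2) t(1) upk small unfolding a1_def[symmetric] by (elim disjE conjE; linarith)
    show "6 * c + max b 4 + 1 < k"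
      using base a1 b(2) t(1) unfolding a1_def[symmetric] by (elim disjE conjE; linarith)
    show "6 * c + k + max b 4 + 5 < 4 * y + D"
      using base a1 b(2) a t(1) upk unfolding a1_def[symmetric] by (elim disjE conjE; linarith)
    show "6 * c + max b 4 + 4 < 2 * y + D"
      using base a1 b(2) a t(1) upk unfolding a1_def[symmetric] by (elim disjE conjE; linarith)
    show "3 * c + k + max (2 * a) (a + 6) < 3 * x + D + b + 2" if "1 \<le> a"
      using base ap[OF that(1)] b(2) a lo lo2[OF that(1)] that unfolding a1_def[symmetric] by (elim disjE conjE; linarith)
    show "6 * c + k + max (2 * a) (a + 6) < 4 * x + b + 1" if "1 \<le> a"
      using base ap[OF that(1)] b(2) t(1) lo2[OF that(1)] that unfolding a1_def[symmetric] by (elim disjE conjE; linarith)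
    show "6 * c + max (2 * a) (a + 6) < 2 * x + 1 + D" if "1 \<le> a"
      using base ap[OF that(1)] b(2) a lo that unfolding a1_def[symmetric] by (elim disjE conjE; linarith)
    show "6 * c + max a 4 + 2 < 2 * x" if "1 \<le> a"
      using base ap[OF that(1)] b(2) a t(1) lo lo2[OF that(1)] that unfolding a1_def[symmetric] by (elim disjE conjE; linarith)
    show "6 * c + k + max a 4 + 4 < 4 * x + b" if "1 \<le> a"
      using base hc ap[OF that(1)] b(2) lo1 lo2[OF that(1)] that unfolding a1_def[symmetric] by (elim disjE conjE; linarith)
    show "6 * c + k + max a 4 + 5 < 4 * x + D" if "1 \<le> a"
      using base hc ap[OF that(1)] b(2) a lo1 that unfolding a1_def[symmetric] by (elim disjE conjE; linarith)
    show "6 * c + max a 4 + 4 < 2 * x + D" if "1 \<le> a"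
      using base ap[OF that(1)] b(2) a lo that unfolding a1_def[symmetric] by (elim disjE conjE; linarith)
    show "6 * c + k + 1 \<le> 4 * x"
      using base a1 b(2) lo unfolding a1_def[symmetric] by (elim disjE conjE; linarith)
    show "6 * c + k + 1 \<le> 4 * y"
      using base a1 a t(2) upk small unfolding a1_def[symmetric] by (elim disjE conjE; linarith)
    show "3 * c + 3 \<le> x"
      using base a1 b(2) lo unfolding a1_def[symmetric] by (elim disjE conjE; linarith)
    show "3 * c + 3 \<le> y"
      using base a1 a t(1) upk unfolding a1_def[symmetric] by (elim disjE conjE; linarith)
    have "3 * c + 4 \<le> x \<or> 3 * c + 6 < x + D" if "k \<noteq> 14"
    proof (rule ccontr)
      assume "\<not> ?thesis"
      hence "x \<le> 3 * c + 3" "x + D \<le> 3 * c + 6" by linarith+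
      thus False using base hc b(2) lo1 by (elim disjE conjE; linarith)
    qed
    moreover have "3 * c + 4 \<le> y \<or> 3 * c + 6 < y + D" if "k \<noteq> 14"
    proof (rule ccontr)
      assume "\<not> ?thesis"
      hence "y \<le> 3 * c + 3" "y + D \<le> 3 * c + 6" by linarith+
      thus False using c(1,2) xy hc a up2 by (elim disjE conjE; linarith)
    qed
    ultimately show "3 * c + 4 \<le> min x y \<or> 3 * c + 6 < min x y + D" if "k \<noteq> 14"
      using that unfolding min_def by presburger
    show "3 * c + k + 4 < 3 * x \<or> 3 * c + k + 7 < 3 * x + D" if "k \<noteq> 14" "1 \<le> a"
    proof (rule ccontr)
      assume "\<not> ?thesis"
      hence n: "3 * x \<le> 3 * c + k + 4" "3 * x + D \<le> 3 * c + k + 7" by linarith+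
      note ap = ap[OF that(2)]
      have k14: "k < 14 \<or> 14 < k" using that(1) by linarith
      have f0: False if "h \<le> x" "k < 14"
        using n(1) c(1) hc(1) that(1,2) by linarith
      have f1: False if "h \<le> x" "14 < k"
        using n(1) h(2) hc(1) that(1,2) by linarith
      have f2: False if "2 * k + 3 + a1 \<le> 2 * x + 6 * c + 2 * b" "k < 14"
        using n(2) c(2) b(2) t(1) that(1) by linarith
      have f3: False if "2 * k + 3 + a1 \<le> 2 * x + 6 * c + 2 * b" "14 < k"
        using n(2) c(2) b(2) t(1) that(1) by linarith
      have f4: False if "2 * k + 3 + a1 \<le> 2 * x + 6 * c + b + 6" "k < 14"
        using n(2) c(1) c(2) b(2) t(1) that(1) by linarith
      have f5: False if "2 * k + 3 + a1 \<le> 2 * x + 6 * c + b + 6" "14 < k"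
        using n(2) c(2) b(2) t(1) that(1,2) by linarith
      show False using f0 f1 f2 f3 f4 f5 lo1 k14 by blast
    qed
    show "3 * c + k + 3 < 3 * x \<or> 3 * c + k + 6 < 3 * x + b" if "k \<noteq> 14" "1 \<le> a"
    proof (rule ccontr)
      assume "\<not> ?thesis"
      hence n: "3 * x \<le> 3 * c + k + 3" "3 * x + b \<le> 3 * c + k + 6" by linarith+
      note ap = ap[OF that(2)]
      have f0: False if "h \<le> x"
        using n(1) c(1) h(2) hc(1) that by linarith
      have f1: False if "2 * k + 3 + a1 \<le> 2 * x + 6 * c + 2 * b"
        using n(2) c(2) b(2) t(1) that by linarith
      have f2: False if "2 * k + 3 + a1 \<le> 2 * x + 6 * c + b + 6"
        using n(2) c(1) c(2) b(2) t(1) that by linarith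
      show False using f0 f1 f2 lo1 by blast
    qed
    show "3 * c + k + 4 < 3 * y \<or> 3 * c + k + 7 < 3 * y + D" if "k \<noteq> 14"
    proof (rule ccontr)
      assume "\<not> ?thesis"
      hence n: "3 * y \<le> 3 * c + k + 4" "3 * y + D \<le> 3 * c + k + 7" by linarith+
      have f0: False if "x = D"
        using n(2) c(1) t(1) xy that by linarith
      have f1: False if "x \<le> h"
        using n(1) c(1) c(2) xy h(1) that by linarith
      have f2: False if "1 \<le> a" "6 \<le> a" "4 * x + b \<le> 6 * c + k + 2 * a + 3"
        using n(2) c(2) a t(2) xy that(2,3) by linarith
      have f3: False if "1 \<le> a" "a \<le> 6" "4 * x + b \<le> 6 * c + k + a + 9"
        using n(1) n(2) c(1) c(2) b(1) a xy that(3) by linarith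
      show False using f0 f1 f2 f3 up2 by blast
    qed
    show "6 * c + k + 5 < 4 * x \<or> 6 * c + k + 9 < 4 * x + D" if "k \<noteq> 14" "1 \<le> a"
    proof (rule ccontr)
      assume "\<not> ?thesis"
      hence n: "4 * x \<le> 6 * c + k + 5" "4 * x + D \<le> 6 * c + k + 9" by linarith+
      note ap = ap[OF that(2)]
      have f0: False if "h \<le> x"
        using n(1) c(1) h(2) hc(1) that by linarith
      have f1: False if "2 * k + 3 + a1 \<le> 2 * x + 6 * c + 2 * b"
        using n(2) c(2) b(2) t(1) that by linarith
      have f2: False if "2 * k + 3 + a1 \<le> 2 * x + 6 * c + b + 6"
        using n(2) c(1) c(2) b(2) t(1) that by linarith
      show False using f0 f1 f2 lo1 by blast
    qed
    show "6 * c + k + 4 < 4 * x \<or> 6 * c + k + 8 < 4 * x + b" if "k \<noteq> 14" "1 \<le> a"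
    proof (rule ccontr)
      assume "\<not> ?thesis"
      hence n: "4 * x \<le> 6 * c + k + 4" "4 * x + b \<le> 6 * c + k + 8" by linarith+
      note ap = ap[OF that(2)]
      have f0: False if "h \<le> x"
        using n(1) c(1) h(2) hc(1) that by linarith
      have f1: False if "2 * k + 3 + a1 \<le> 2 * x + 6 * c + 2 * b"
        using n(2) c(2) b(2) t(1) that by linarith
      have f2: False if "2 * k + 3 + a1 \<le> 2 * x + 6 * c + b + 6"
        using n(2) c(1) c(2) b(2) t(1) that by linarith
      show False using f0 f1 f2 lo1 by blast
    qed
    show "6 * c + k + 5 < 4 * y \<or> 6 * c + k + 9 < 4 * y + D" if "k \<noteq> 14"
    proof (rule ccontr)
      assume "\<not> ?thesis"
      hence n: "4 * y \<le> 6 * c + k + 5" "4 * y + D \<le> 6 * c + k + 9" by linarith+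
      have f0: False if "x = D"
        using n(2) b(1) t(1) xy that by linarith
      have f1: False if "x \<le> h"
        using n(1) c(1) c(2) xy h(1) that by linarith
      have f2: False if "1 \<le> a" "6 \<le> a" "4 * x + b \<le> 6 * c + k + 2 * a + 3"
        using n(2) c(2) a t(2) xy that(2,3) by linarith
      have f3: False if "1 \<le> a" "a \<le> 6" "4 * x + b \<le> 6 * c + k + a + 9"
        using n(2) c(1) c(2) a xy that(3) by linarith
      show False using f0 f1 f2 f3 up2 by blast
    qed
    have "6 * c + 4 < 2 * x" if "k \<noteq> 14"
    proof (rule ccontr)
      assume "\<not> ?thesis"
      hence n: "2 * x \<le> 6 * c + 4" by linarith+
      have f0: False if "h \<le> x"
        using n c(1) hc(1) that by linarith
      have f1: False if "2 * k + 3 + a1 \<le> 2 * x + 6 * c + 2 * b"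
        using n c(2) b(2) t(1) that by linarith
      have f2: False if "2 * k + 3 + a1 \<le> 2 * x + 6 * c + b + 6"
        using n c(1) c(2) b(2) t(1) that by linarith
      show False using f0 f1 f2 lo1 by blast
    qed
    moreover have "6 * c + 4 < 2 * y" if "k \<noteq> 14"
    proof (rule ccontr)
      assume "\<not> ?thesis"
      hence n: "2 * y \<le> 6 * c + 4" by linarith+
      have f0: False if "x = D"
        using n b(1) t(1) xy that by linarith
      have f1: False if "x \<le> h"
        using n c(1) c(2) xy h(1) that by linarith
      have f2: False if "1 \<le> a" "6 \<le> a" "4 * x + b \<le> 6 * c + k + 2 * a + 3"
        using n c(2) a t(2) xy that(2,3) by linarith
      have f3: False if "1 \<le> a" "a \<le> 6" "4 * x + b \<le> 6 * c + k + a + 9"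
        using n c(1) c(2) xy that(2,3) by linarith
      show False using f0 f1 f2 f3 up2 by blast
    qed
    ultimately show "6 * c + 4 < 2 * min x y" if "k \<noteq> 14" using that by (simp add: min_def)
    have "7 \<le> x" if "k = 14"
    proof (rule ccontr)
      assume "\<not> ?thesis"
      hence n: "x < 7" by linarith+
      have c1: "c = 1" "h = 7" using that c hc by linarith+
      note K = that and h7 = c1(2)
      have f0: False if "h \<le> x"
        using n h7 that by linarith
      have f1: False if "2 * k + 3 + a1 \<le> 2 * x + 6 * c + 2 * b"
        using n b(2) t(1) K c1(1) that by linarith
      have f2: False if "2 * k + 3 + a1 \<le> 2 * x + 6 * c + b + 6"
        using n b(2) t(1) K c1(1) that by linarith
      show False using f0 f1 f2 lo1 by blast
    qed
    moreover have "7 \<le> y" if "k = 14"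
    proof (rule ccontr)
      assume "\<not> ?thesis"
      hence n: "y < 7" by linarith+
      have c1: "c = 1" "h = 7" using that c hc by linarith+
      note K = that and h7 = c1(2)
      have f0: False if "x = D" "2 * D \<le> k + 2 * c"
        using n xy K c1(1) that(1,2) by linarith
      have f1: False if "x = D" "2 * D + 3 \<le> k + 3 * c" "2 * D + b < 4 * c + k"
        using n xy K c1(1) that(1,2) by linarith
      have f2: False if "x \<le> h" "2 * D \<le> k + 2 * c"
        using n xy K h7 that(1) by linarith
      have f3: False if "x \<le> h" "2 * D + 3 \<le> k + 3 * c" "2 * D + b < 4 * c + k"
        using n xy K h7 that(1) by linarith
      have f4: False if "1 \<le> a" "6 \<le> a" "4 * x + b \<le> 6 * c + k + 2 * a + 3" "2 * D \<le> k + 2 * c"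
        using n b(1) a t(2) xy K c1(1) that(3) by linarith
      have f5: False if "1 \<le> a" "6 \<le> a" "4 * x + b \<le> 6 * c + k + 2 * a + 3" "2 * D + 3 \<le> k + 3 * c" "2 * D + b < 4 * c + k"
        using n b(1) a t(2) xy K c1(1) that(3) by linarith
      have f6: False if "1 \<le> a" "a \<le> 6" "4 * x + b \<le> 6 * c + k + a + 9" "2 * D \<le> k + 2 * c"
        using n xy K c1(1) that(2,3) by linarith
      have f7: False if "1 \<le> a" "a \<le> 6" "4 * x + b \<le> 6 * c + k + a + 9" "2 * D + 3 \<le> k + 3 * c" "2 * D + b < 4 * c + k"
        using n xy K c1(1) that(2,3) by linarith
      show False using f0 f1 f2 f3 f4 f5 f6 f7 up2 small by blast
    qed
    ultimately show "7 \<le> min x y" if "k = 14" using that by simp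
    show "b + c + 1 \<le> y"
    proof (rule ccontr)
      assume "\<not> ?thesis"
      hence n: "y < b + c + 1" by linarith+
      have f0: False if "x = D"
        using n t(1) xy that by linarith
      have f1: False if "x \<le> h"
        using n b(2) t(1) xy h(1) that by linarith
      have f2: False if "1 \<le> a" "6 \<le> a" "4 * x + b \<le> 6 * c + k + 2 * a + 3"
        using n c(2) b(2) t(2) xy that(3) by linarith
      have f3: False if "1 \<le> a" "a \<le> 6" "4 * x + b \<le> 6 * c + k + a + 9"
        using n c(1) c(2) b(2) t(1) xy that(2,3) by linarith
      show False using f0 f1 f2 f3 up2 by blast
    qed
    show "q + 2 + min (c + 1) n \<le> y" if "1 \<le> a" "q \<le> b" "1 \<le> n" "D + 2 * q + (a - 1) + n \<le> k + 1" for q n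
    proof (rule ccontr)
      assume "\<not> ?thesis"
      hence n: "y < q + 2 + c + 1" "y < q + 2 + n" by linarith+
      note ap = ap[OF that(1)] and qb = that(2)
      have q3: "D + 2 * q + a1 + n \<le> k + 1" using that(4) unfolding a1_def .
      have f0: False if "x = D"
        using n(1) c(1) t(1) xy qb that by linarith
      have f1: False if "x \<le> h"
        using n(1) n(2) c(1) c(2) b(2) xy h(1) qb q3 that by linarith
      have f2: False if "1 \<le> a" "6 \<le> a" "4 * x + b \<le> 6 * c + k + 2 * a + 3"
        using n(1) c(2) a xy ap q3 that(2,3) by linarith
      have f3: False if "1 \<le> a" "a \<le> 6" "4 * x + b \<le> 6 * c + k + a + 9"
        using n(1) c(1) c(2) b(2) xy ap qb q3 that(3) by linarith
      show False using f0 f1 f2 f3 up2 by blast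
    qed
    show "c + k + 5 \<le> D + 2 * y \<or> 2 * b + 3 * c + 5 \<le> 2 * y"
    proof (rule ccontr)
      assume "\<not> ?thesis"
      hence n: "D + 2 * y < c + k + 5" "2 * y < 2 * b + 3 * c + 5" by linarith+
      have f0: False if "x = D"
        using n(1) c(1) t(1) xy that by linarith
      have f1: False if "x \<le> h"
        using n(1) n(2) c(1) c(2) b(2) xy h(1) that by linarith
      have f2: False if "1 \<le> a" "6 \<le> a" "4 * x + b \<le> 6 * c + k + 2 * a + 3"
        using n(1) n(2) c(2) a t(2) xy that(2,3) by linarith
      have f3: False if "1 \<le> a" "a \<le> 6" "4 * x + b \<le> 6 * c + k + a + 9"
        using n(1) n(2) c(1) c(2) b(2) a xy that(3) by linarith
      show False using f0 f1 f2 f3 up2 by blast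
    qed
  qed
qed

section \<open>Leaves forced by two, three or four inner vertices\<close>

context rooted_tree
begin

lemma leaves_ge2:
  assumes "x \<in> inner" "y \<in> inner" "x \<noteq> y"
  shows "card (ch x) + card (ch y) \<le> card leaves + 1"
  using leaves_ge[of "{x, y}"] d_pos assms by fastforce

lemma leaves_ge3:
  assumes "x \<in> inner" "y \<in> inner" "z \<in> inner" "x \<noteq> y" "x \<noteq> z" "y \<noteq> z"
  shows "card (ch x) + card (ch y) + card (ch z) \<le> card leaves + 2"
proof -
  have "1 + (card (ch x) - 1 + (card (ch y) - 1 + (card (ch z) - 1))) \<le> card leaves"
    using leaves_ge[of "{x, y, z}"] assms by simp
  thus ?thesis using d_pos[OF assms(1)] d_pos[OF assms(2)] d_pos[OF assms(3)] by linarith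
qed

lemma leaves_ge4:
  assumes "x \<in> inner" "y \<in> inner" "z \<in> inner" "w \<in> inner"
    "x \<noteq> y" "x \<noteq> z" "x \<noteq> w" "y \<noteq> z" "y \<noteq> w" "z \<noteq> w"
  shows "card (ch x) + card (ch y) + card (ch z) + card (ch w) \<le> card leaves + 3"
proof -
  have "1 + (card (ch x) - 1 + (card (ch y) - 1 + (card (ch z) - 1 + (card (ch w) - 1)))) \<le> card leaves"
    using leaves_ge[of "{x, y, z, w}"] assms by simp
  thus ?thesis using d_pos[OF assms(1)] d_pos[OF assms(2)] d_pos[OF assms(3)] d_pos[OF assms(4)] by linarith
qed

end

section \<open>Total demand of a set of embedded vertices\<close>

context engine
begin

lemma dem_le': "dem E x \<le> lam x + 2 * card (pend E x) + 1"
proof (cases "pend E x = {}")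
  case False
  hence "1 \<le> card (pend E x)" by (simp add: Suc_le_eq card_gt_0_iff)
  thus ?thesis using False unfolding dem_def by auto
qed (simp add: dem_def)

lemma stage_root: "stage E \<Longrightarrow> dem E rt = lam rt" "stage E \<Longrightarrow> pend E rt = {}"
  unfolding stage_def dem_def pend_def by auto

text \<open>Each leaf child and each pending child begins a branch outside \<open>E\<close>, and
  different branches contain different leaves. In numbers: the embedded children amount to
  \<open>card E - 1\<close>, and the other children are bounded through
  \<open>leaves_ge\<close>.\<close>

lemma stage_leaves:
  assumes "stage E"
  shows "(\<Sum>x\<in>E. lam x + card (pend E x)) \<le> card leaves"
proof -
  have E: "closed E" "E \<subseteq> inner" "finite E" "rt \<in> E" "E \<subseteq> V"
    using assms finite_subset[of E inner] unfolding stage_def closed_def by auto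
  have ch: "card (ch x) = lam x + card (pend E x) + card (ch x \<inter> E)" if "x \<in> E" for x
  proof -
    have "ch x = ((ch x \<inter> leaves) \<union> pend E x) \<union> (ch x \<inter> E)"
      using V_split ch_sub unfolding pend_def by blast
    moreover have "((ch x \<inter> leaves) \<union> pend E x) \<inter> (ch x \<inter> E) = {}" "(ch x \<inter> leaves) \<inter> pend E x = {}"
      using V_split E(2) unfolding pend_def by blast+
    ultimately show ?thesis unfolding lam_def
      by (metis card_Un_disjoint fin_ch finite_Int fin_pend finite_UnI)
  qed
  have "(\<Sum>x\<in>E. card (ch x \<inter> E)) = card (\<Union>x\<in>E. ch x \<inter> E)"
    using E(3) ch_disjoint by (subst card_UN_disjoint) auto
  also have "(\<Union>x\<in>E. ch x \<inter> E) = E - {rt}"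
  proof
    show "(\<Union>x\<in>E. ch x \<inter> E) \<subseteq> E - {rt}" using ch_sub(2) by blast
    show "E - {rt} \<subseteq> (\<Union>x\<in>E. ch x \<inter> E)"
    proof
      fix y assume y: "y \<in> E - {rt}"
      hence "par y \<in> E" "y \<in> ch (par y)" using E(1,5) chI unfolding closed_def by auto
      thus "y \<in> (\<Union>x\<in>E. ch x \<inter> E)" using y by blast
    qed
  qed
  finally have s: "(\<Sum>x\<in>E. card (ch x \<inter> E)) + 1 = card E"
    using E(3,4) by (metis card_Suc_Diff1 Suc_eq_plus1)
  have "(\<Sum>x\<in>E. card (ch x)) = (\<Sum>x\<in>E. card (ch x) - 1) + (\<Sum>x\<in>E. 1)"
    unfolding sum.distrib[symmetric] using E(2) d_pos by (intro sum.cong refl) fastforce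
  moreover have "(\<Sum>x\<in>E. card (ch x)) = (\<Sum>x\<in>E. lam x + card (pend E x)) + (\<Sum>x\<in>E. card (ch x \<inter> E))"
    unfolding sum.distrib[symmetric] using ch by (intro sum.cong refl) simp
  ultimately show ?thesis using leaves_ge[OF E(2)] s by simp
qed

text \<open>A demand is at most \<open>lam x + 2 * card (pend E x) + 1\<close>, and the 1 is absent
  for the root. One copy of \<open>pend\<close> is paid by the leaves together with
  \<open>lam\<close>, the other one by the inner vertices outside \<open>E\<close>.\<close>

lemma sum_dem_le:
  assumes st: "stage E" and X: "X \<subseteq> E"
  shows "sum (dem E) X + card E \<le> k + 1 + card (X - {rt})"
proof -
  have E: "E \<subseteq> inner" "finite E" using assms finite_subset[of E inner] unfolding stage_def by auto
  have finX: "finite X" using finite_subset[OF X E(2)] .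
  have "sum (dem E) X \<le> (\<Sum>x\<in>X. lam x + card (pend E x) + card (pend E x) + (if x = rt then 0 else 1))"
    using stage_root[OF st] dem_le' by (intro sum_mono) (fastforce simp: mult_2 add.assoc)
  also have "\<dots> = (\<Sum>x\<in>X. lam x + card (pend E x)) + (\<Sum>x\<in>X. card (pend E x)) + card (X - {rt})"
  proof -
    have "(\<Sum>x\<in>X. if x = rt then 0 else 1) = card {x \<in> X. x \<noteq> rt}"
      using finX by (simp add: sum.If_cases Int_def)
    moreover have "{x \<in> X. x \<noteq> rt} = X - {rt}" by auto
    ultimately show ?thesis unfolding sum.distrib by simp
  qed
  also have "(\<Sum>x\<in>X. lam x + card (pend E x)) \<le> (\<Sum>x\<in>E. lam x + card (pend E x))"
    using X E(2) by (intro sum_mono2) auto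
  finally show ?thesis using stage_leaves[OF st] card_stage_pend[OF E(1) finX] card_inner by linarith
qed

text \<open>A heavy inner vertex \<open>h\<close> outside \<open>X\<close> forces leaves that
  \<open>X\<close> does not demand. This saves \<open>card (ch h)\<close> at the price of a further
  \<open>card X\<close>; it is applied with the root or with the largest sink as
  \<open>h\<close>.\<close>

lemma sum_dem_heavy:
  assumes st: "stage E" and X: "X \<subseteq> E" and h: "h \<in> inner" "h \<notin> X"
  shows "sum (dem E) X + card E + card (ch h) \<le> k + 1 + card X + card (X - {rt})"
proof -
  have E: "E \<subseteq> inner" "finite E" using assms finite_subset[of E inner] unfolding stage_def by auto
  have finX: "finite X" using finite_subset[OF X E(2)] .
  have dem1: "dem E x \<le> card (pend E x) + (card (ch x) - 1) + 1 + (if x = rt then 0 else 1)" if "x \<in> X" for x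
  proof -
    have d: "1 \<le> card (ch x)" using d_pos that X E(1) by blast
    show ?thesis
    proof (cases "x = rt")
      case True
      thus ?thesis using d lam_le[of rt] stage_root[OF st] by simp
    next
      case False
      thus ?thesis using d dem_le[of E x] by auto
    qed
  qed
  have XE: "X \<subseteq> inner" using X E(1) by blast
  have "sum (dem E) X \<le> (\<Sum>x\<in>X. card (pend E x) + (card (ch x) - 1) + 1 + (if x = rt then 0 else 1))"
    using dem1 by (intro sum_mono) auto
  also have "\<dots> = (\<Sum>x\<in>X. card (pend E x)) + (\<Sum>x\<in>X. card (ch x) - 1) + card X + card (X - {rt})"
  proof -
    have "(\<Sum>x\<in>X. if x = rt then 0 else 1) = card {x \<in> X. x \<noteq> rt}"
      using finX by (simp add: sum.If_cases Int_def)
    moreover have "{x \<in> X. x \<noteq> rt} = X - {rt}" by auto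
    ultimately show ?thesis unfolding sum.distrib by simp
  qed
  finally have "sum (dem E) X \<le> (\<Sum>x\<in>X. card (pend E x)) + (\<Sum>x\<in>X. card (ch x) - 1) + card X + card (X - {rt})" .
  moreover have "(\<Sum>x\<in>X. card (ch x) - 1) + card (ch h) \<le> card leaves"
    using leaves_ge[of "insert h X"] h finX XE d_pos[OF h(1)] by auto
  ultimately show ?thesis using card_stage_pend[OF E(1) finX] card_inner by linarith
qed

lemma sum_sz:
  assumes "finite X"
  shows "(\<Sum>x\<in>X. sz (sg x)) = card {x\<in>X. sg x} * sz True + card {x\<in>X. \<not> sg x} * sz False"
    and "card {x\<in>X. sg x} + card {x\<in>X. \<not> sg x} = card X"
proof -
  have X: "X = {x\<in>X. sg x} \<union> {x\<in>X. \<not> sg x}" "{x\<in>X. sg x} \<inter> {x\<in>X. \<not> sg x} = {}" by auto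
  have "(\<Sum>x\<in>X. sz (sg x)) = (\<Sum>x\<in>{x\<in>X. sg x}. sz (sg x)) + (\<Sum>x\<in>{x\<in>X. \<not> sg x}. sz (sg x))"
    by (subst X(1), rule sum.union_disjoint) (use assms X(2) in auto)
  thus "(\<Sum>x\<in>X. sz (sg x)) = card {x\<in>X. sg x} * sz True + card {x\<in>X. \<not> sg x} * sz False" by simp
  show "card {x\<in>X. sg x} + card {x\<in>X. \<not> sg x} = card X"
    by (subst (3) X(1), rule card_Un_disjoint[symmetric]) (use assms X(2) in auto)
qed

end

section \<open>The balanced case\<close>

context tree_host
begin

text \<open>All hypotheses of the engine are verified in the same way: the children of the vertices
  involved are charged to leaves, with the root, \<open>g\<close> or a largest source added when it
  is not among them. What is left is an inequality between \<open>x\<close>, \<open>y\<close>,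
  \<open>D\<close>, \<open>a\<close> and \<open>b\<close> from \<open>engine_arith\<close>.\<close>

theorem embed_balanced:
  assumes W: "finite W" "R \<subseteq> W \<times> W" "(k - 1) * card W < card R" and kV: "card V = k + 1"
    and c: "1 \<le> c" "12 * c < k" "k \<le> 12 * c + 12"
    and deg: "\<And>x. x \<in> V \<Longrightarrow> x \<noteq> rt \<Longrightarrow> card (ch x) + 1 \<le> card (ch rt)"
    and g: "g \<in> inner" "\<not> sg g" "\<And>x. x \<in> inner \<Longrightarrow> \<not> sg x \<Longrightarrow> card (ch x) \<le> card (ch g)"
    and t: "card (ch rt) + card (ch g) + 3 * c + 1 \<le> k"
    and small: "2 * card (ch rt) \<le> k + 2 * c \<or>
      (2 * card (ch rt) + 3 \<le> k + 3 * c \<and> 2 * card (ch rt) + card (ch g) < 4 * c + k)"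
  shows "\<exists>f. emb V f"
proof -
  define D where "D = card (ch rt)"
  define b where "b = card (ch g)"
  define S where "S = {x \<in> inner - {rt}. sg x}"
  \<comment> \<open>\<open>a\<close> is the largest number of children of an inner source other than
    the root, with 0 standing for the absence of such a source. In either case \<open>a - 1\<close>
    is the number of additional leaves that it guarantees.\<close>
  have "\<exists>a. (\<forall>x\<in>S. card (ch x) \<le> a) \<and> (1 \<le> a \<longrightarrow> (\<exists>h\<in>S. card (ch h) = a)) \<and> (a = 0 \<longrightarrow> S = {})"
  proof (cases "S = {}")
    case True
    thus ?thesis by (intro exI[of _ 0]) auto
  next
    case False
    have fin: "finite S" unfolding S_def by simp
    have m: "Max ((\<lambda>x. card (ch x)) ` S) \<in> (\<lambda>x. card (ch x)) ` S" using fin False by (intro Max_in) auto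
    hence "Max ((\<lambda>x. card (ch x)) ` S) \<noteq> 0" unfolding S_def inner_def by auto
    thus ?thesis using m fin by (intro exI[of _ "Max ((\<lambda>x. card (ch x)) ` S)"]) auto
  qed
  then obtain a where aS: "(\<forall>x\<in>S. card (ch x) \<le> a) \<and>
    (1 \<le> a \<longrightarrow> (\<exists>h\<in>S. card (ch h) = a)) \<and> (a = 0 \<longrightarrow> S = {})" ..
  note a = aS[THEN conjunct1, rule_format] aS[THEN conjunct2, THEN conjunct1, THEN mp]
    aS[THEN conjunct2, THEN conjunct2, THEN mp]
  have gr: "g \<noteq> rt" using g(2) sg_rt by auto
  have b1: "1 \<le> b" "b + 1 \<le> D" using d_pos[OF g(1)] deg[of g] g(1) gr inner_sub unfolding b_def D_def by auto
  have rti: "rt \<in> inner" using b1 rtV unfolding inner_def D_def by auto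
  have heavy: "\<exists>h. h \<in> inner \<and> h \<noteq> rt \<and> sg h \<and> card (ch h) = a" if "1 \<le> a" using a(2)[OF that] unfolding S_def by auto
  have a1: "a + 1 \<le> D"
  proof (cases "1 \<le> a")
    case True
    then obtain h where "h \<in> inner" "h \<noteq> rt" "card (ch h) = a" using heavy by blast
    thus ?thesis using deg[of h] inner_sub unfolding D_def by blast
  qed (use b1 in auto)
  have ab: "D + a + b \<le> k"
  proof (cases "1 \<le> a")
    case True
    then obtain h where h: "h \<in> inner" "h \<noteq> rt" "sg h" "card (ch h) = a" using heavy by blast
    have "h \<noteq> g" using h(3) g(2) by auto
    hence "(\<Sum>x\<in>{rt, h, g}. card (ch x)) = D + a + b" "{rt, h, g} \<subseteq> V"
      using h(1,2,4) gr g(1) rtV inner_sub unfolding D_def b_def by auto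
    thus ?thesis using sum_d_le[of "{rt, h, g}"] kV by linarith
  qed (use t in \<open>auto simp: D_def b_def\<close>)
  obtain x y where N: "x + y = k + 1" "D \<le> x"
    "3 * c + k + max (2 * b) (b + 6) < 3 * y + D + (a - 1) + 3"
    "6 * c + k + max (2 * b) (b + 6) < 3 * y + x + (a - 1) + 2"
    "6 * c + k + max (2 * b) (b + 6) < 4 * y + D"
    "6 * c + k + max b 4 + 3 < 3 * y + x + (a - 1)"
    "6 * c + max b 4 + 1 < k"
    "6 * c + k + max b 4 + 5 < 4 * y + D"
    "6 * c + max b 4 + 4 < 2 * y + D"
    "1 \<le> a \<Longrightarrow> 3 * c + k + max (2 * a) (a + 6) < 3 * x + D + b + 2"
    "1 \<le> a \<Longrightarrow> 6 * c + k + max (2 * a) (a + 6) < 4 * x + b + 1"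
    "1 \<le> a \<Longrightarrow> 6 * c + max (2 * a) (a + 6) < 2 * x + 1 + D"
    "1 \<le> a \<Longrightarrow> 6 * c + max a 4 + 2 < 2 * x"
    "1 \<le> a \<Longrightarrow> 6 * c + k + max a 4 + 4 < 4 * x + b"
    "1 \<le> a \<Longrightarrow> 6 * c + k + max a 4 + 5 < 4 * x + D"
    "1 \<le> a \<Longrightarrow> 6 * c + max a 4 + 4 < 2 * x + D"
    and N4: "6 * c + k + 1 \<le> 4 * x" "6 * c + k + 1 \<le> 4 * y" "3 * c + 3 \<le> x" "3 * c + 3 \<le> y"
    and NE: "k \<noteq> 14 \<Longrightarrow> 3 * c + 4 \<le> min x y \<or> 3 * c + 6 < min x y + D"
    "k \<noteq> 14 \<Longrightarrow> 1 \<le> a \<Longrightarrow> 3 * c + k + 4 < 3 * x \<or> 3 * c + k + 7 < 3 * x + D"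
    "k \<noteq> 14 \<Longrightarrow> 1 \<le> a \<Longrightarrow> 3 * c + k + 3 < 3 * x \<or> 3 * c + k + 6 < 3 * x + b"
    "k \<noteq> 14 \<Longrightarrow> 3 * c + k + 4 < 3 * y \<or> 3 * c + k + 7 < 3 * y + D"
    "k \<noteq> 14 \<Longrightarrow> 1 \<le> a \<Longrightarrow> 6 * c + k + 5 < 4 * x \<or> 6 * c + k + 9 < 4 * x + D"
    "k \<noteq> 14 \<Longrightarrow> 1 \<le> a \<Longrightarrow> 6 * c + k + 4 < 4 * x \<or> 6 * c + k + 8 < 4 * x + b"
    "k \<noteq> 14 \<Longrightarrow> 6 * c + k + 5 < 4 * y \<or> 6 * c + k + 9 < 4 * y + D"
    "k \<noteq> 14 \<Longrightarrow> 6 * c + 4 < 2 * min x y" "k = 14 \<Longrightarrow> 7 \<le> min x y"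
    and NI: "b + c + 1 \<le> y"
    "\<And>q n. 1 \<le> a \<Longrightarrow> q \<le> b \<Longrightarrow> 1 \<le> n \<Longrightarrow> D + 2 * q + (a - 1) + n \<le> k + 1 \<Longrightarrow> q + 2 + min (c + 1) n \<le> y"
    "c + k + 5 \<le> D + 2 * y \<or> 2 * b + 3 * c + 5 \<le> 2 * y"
    by (rule engine_arith[OF c b1 a1 t[folded D_def b_def] ab small[folded D_def b_def]], rule that) (assumption | blast)+
  have "(x - 1) * card W + (y - 1) * card W = (k - 1) * card W"
    unfolding add_mult_distrib[symmetric] using N(1) N4(3,4) by simp
  hence "(x - 1) * card W + (y - 1) * card W < card (R \<inter> W \<times> W)" using W(2,3) by (simp add: Int_absorb2)
  then obtain A where A: "A True \<noteq> {}" "core R (\<lambda>\<sigma>. if \<sigma> then x else y) A"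
    using weighted_core'[of R W W x y] W(1) finR by metis
  define sz where "sz \<sigma> = (if \<sigma> then x else y)" for \<sigma> :: bool
  have sz: "sz True = x" "sz False = y" unfolding sz_def by auto
  have core: "core R sz A" using A(2) unfolding sz_def .
  interpret engine V rt par dep sg R c A sz k
    by unfold_locales (use core kV in auto)
  define m6 where "m6 d = max (2 * d) (d + 6)" for d :: nat
  define m4 where "m4 d = max d 4" for d :: nat
  have m6: "max (3 * d) (2 * d + 6) = d + m6 d" for d unfolding m6_def by auto
  have m4: "max (2 * d) (d + 4) = d + m4 d" for d unfolding m4_def by auto
  have m6_mono: "m6 d \<le> m6 d'" if "d \<le> d'" for d d' using that unfolding m6_def by auto
  have m4_mono: "m4 d \<le> m4 d'" if "d \<le> d'" for d d' using that unfolding m4_def by auto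
  note N = N[folded m6_def m4_def]
  have D2: "max (card (ch rt)) 2 = D" using b1 unfolding D_def by auto
  have m2: "max (card (ch v)) 2 \<le> card (ch v) + 1" if "v \<in> inner" for v using d_pos[OF that] by auto
  have up: "1 \<le> a" "m6 (card (ch v)) \<le> m6 a" "m4 (card (ch v)) \<le> m4 a" if "v \<in> inner" "v \<noteq> rt" "sg v" for v
  proof -
    have "v \<in> S" using that unfolding S_def by simp
    thus "1 \<le> a" "m6 (card (ch v)) \<le> m6 a" "m4 (card (ch v)) \<le> m4 a" using a(3) m6_mono[OF a(1)] m4_mono[OF a(1)]
      by (auto simp: Suc_le_eq)
  qed
  have dn: "m6 (card (ch v)) \<le> m6 b" "m4 (card (ch v)) \<le> m4 b" if "v \<in> inner" "\<not> sg v" for v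
    using m6_mono[OF g(3)[OF that]] m4_mono[OF g(3)[OF that]] unfolding b_def by auto
  have l2: "D + card (ch v) \<le> card leaves + 1" if "v \<in> inner" "v \<noteq> rt" for v
    using leaves_ge2[OF rti that(1)] that unfolding D_def by auto
  have l3: "D + card (ch v) + card (ch w) \<le> card leaves + 2" if "v \<in> inner" "v \<noteq> rt" "w \<in> inner" "w \<noteq> rt" "v \<noteq> w" for v w
    using leaves_ge3[OF rti that(1,3)] that unfolding D_def by auto
  have l4: "D + card (ch v) + card (ch w) + card (ch u) \<le> card leaves + 3"
    if "v \<in> inner" "v \<noteq> rt" "w \<in> inner" "w \<noteq> rt" "v \<noteq> w" "u \<in> inner" "u \<noteq> rt" "u \<noteq> w" "v \<noteq> u" for v w u
    using leaves_ge4[OF rti that(1,3,6)] that unfolding D_def by auto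
  \<comment> \<open>A source attaining \<open>a\<close> differs from the sink \<open>v\<close> and
    from the root, so it contributes \<open>a - 1\<close> further leaves.\<close>
  have la2: "D + card (ch v) + (a - 1) \<le> card leaves + 1" if "v \<in> inner" "\<not> sg v" for v
  proof (cases "1 \<le> a")
    case True
    then obtain h where h: "h \<in> inner" "h \<noteq> rt" "sg h" "card (ch h) = a" using heavy by blast
    hence "D + card (ch v) + card (ch h) \<le> card leaves + 2" using that sg_rt by (intro l3) auto
    thus ?thesis using True h(4) by linarith
  next
    case False
    have "v \<noteq> rt" using that(2) sg_rt by auto
    thus ?thesis using l2[OF that(1)] False by simp
  qed
  have la3: "D + card (ch v) + card (ch w) + (a - 1) \<le> card leaves + 2"
    if "v \<in> inner" "\<not> sg v" "w \<in> inner" "\<not> sg w" "v \<noteq> w" for v w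
  proof -
    have rt: "v \<noteq> rt" "w \<noteq> rt" using that sg_rt by auto
    show ?thesis
    proof (cases "1 \<le> a")
      case True
      then obtain h where h: "h \<in> inner" "h \<noteq> rt" "sg h" "card (ch h) = a" using heavy by blast
      have "D + card (ch v) + card (ch w) + card (ch h) \<le> card leaves + 3"
        using h that rt by (intro l4) auto
      thus ?thesis using True h(4) by linarith
    next
      case False
      thus ?thesis using l3[of v w] that rt by simp
    qed
  qed
  have lb2: "D + card (ch v) + b \<le> card leaves + 2" if "v \<in> inner" "v \<noteq> rt" "sg v" for v
    unfolding b_def using that g(1,2) gr by (intro l3) auto
  have lb3: "D + card (ch v) + card (ch w) + b \<le> card leaves + 3"
    if "v \<in> inner" "v \<noteq> rt" "sg v" "w \<in> inner" "w \<noteq> rt" "sg w" "v \<noteq> w" for v w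
    unfolding b_def using that g(1,2) gr by (intro l4) auto
  have ni: "h \<in> inner" "h \<noteq> rt" if "h \<in> inner - {rt}" for h using that by auto
  have B1: "3 * c + k + max (3 * card (ch v)) (2 * card (ch v) + 6) < 3 * sz (sg v) + card leaves + 4"
    if v: "v \<in> inner - {rt}" for v
  proof (cases "sg v")
    case True
    note u = up[OF ni[OF v] True]
    show ?thesis unfolding m6 using True lb2[OF ni[OF v] True] u(2) N(10)[OF u(1)] by (simp add: sz)
  next
    case False
    show ?thesis unfolding m6 using False la2[OF ni(1)[OF v] False] dn(1)[OF ni(1)[OF v] False] N(3) by (simp add: sz)
  qed
  have B2: "6 * c + k + max (3 * card (ch v)) (2 * card (ch v) + 6) + max (card (ch w)) 2
      < 3 * sz (sg v) + sz (sg w) + card leaves + 3"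
    if v: "v \<in> inner - {rt}" and w: "w \<in> inner" "w \<noteq> v" for v w
  proof (cases "w = rt")
    case True
    have s: "sz (sg rt) = x" using True sg_rt sz by simp
    show ?thesis
    proof (cases "sg v")
      case v1: True
      note u = up[OF ni[OF v] v1]
      show ?thesis unfolding True m6 D2 s using v1 lb2[OF ni[OF v] v1] u(2) N(11)[OF u(1)] by (simp add: sz)
    next
      case v1: False
      show ?thesis unfolding True m6 D2 s using v1 la2[OF ni(1)[OF v] v1] dn(1)[OF ni(1)[OF v] v1] N(4) by (simp add: sz)
    qed
  next
    case wr: False
    have l: "D + card (ch v) + card (ch w) \<le> card leaves + 2" using l3[OF ni[OF v] w(1) wr] w by auto
    have k: "6 * c + k + m6 (card (ch v)) < 3 * sz (sg v) + sz (sg w) + D"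
    proof (cases "sg v")
      case v1: True
      note u = up[OF ni[OF v] v1]
      show ?thesis using v1 u(2) N(1) N(11)[OF u(1)] N(12)[OF u(1)] b1 by (cases "sg w") (auto simp: sz)
    next
      case v1: False
      note u = dn(1)[OF ni(1)[OF v] v1]
      show ?thesis
      proof (cases "sg w")
        case w1: True
        show ?thesis using v1 w1 u N(4) a1 up(1)[OF w(1) wr w1] by (simp add: sz)
      next
        case w1: False
        show ?thesis using v1 w1 u N(5) by (simp add: sz)
      qed
    qed
    show ?thesis unfolding m6 using k l m2[OF w(1)] by linarith
  qed
  have B3r: "6 * c + k + max (2 * card (ch v)) (card (ch v) + 4) + D + max (card (ch w)) 2
      < 2 * sz (sg v) + x + sz (sg w) + card leaves"
    if v: "v \<in> inner - {rt}" and w: "w \<in> inner" "w \<noteq> v" "w \<noteq> rt" for v w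
  proof (cases "sg v")
    case v1: True
    note u = up[OF ni[OF v] v1]
    show ?thesis
    proof (cases "sg w")
      case w1: True
      have "D + card (ch v) + card (ch w) + b \<le> card leaves + 3" using lb3[OF ni[OF v] v1 w(1,3) w1] w by auto
      thus ?thesis unfolding m4 using v1 w1 u(3) N(14)[OF u(1)] m2[OF w(1)] by (simp add: sz)
    next
      case w1: False
      have "D + card (ch v) + card (ch w) \<le> card leaves + 2" using l3[OF ni[OF v] w(1,3)] w by auto
      thus ?thesis unfolding m4 using v1 w1 u(3) N(1) N(13)[OF u(1)] m2[OF w(1)] by (simp add: sz)
    qed
  next
    case v1: False
    note u = dn(2)[OF ni(1)[OF v] v1]
    show ?thesis
    proof (cases "sg w")
      case w1: True
      have "D + card (ch v) + card (ch w) \<le> card leaves + 2" using l3[OF ni[OF v] w(1,3)] w by auto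
      thus ?thesis unfolding m4 using v1 w1 u N(1) N(7) m2[OF w(1)] by (simp add: sz)
    next
      case w1: False
      have "D + card (ch v) + card (ch w) + (a - 1) \<le> card leaves + 2" using la3[OF ni(1)[OF v] v1 w(1) w1] w by auto
      thus ?thesis unfolding m4 using v1 w1 u N(6) m2[OF w(1)] by (simp add: sz)
    qed
  qed
  have B3n: "6 * c + k + m4 (card (ch v)) + 5 < 2 * sz (sg v) + sz (sg w) + sz (sg u) + D"
    if v: "v \<in> inner - {rt}" for v w u
  proof (cases "sg v")
    case v1: True
    note p = up[OF ni[OF v] v1]
    have "6 * c + m4 a + 3 < k + D" using c(1,2) a1 b1 unfolding m4_def by auto
    thus ?thesis using v1 p(3) N(1) N(15)[OF p(1)] N(16)[OF p(1)] by (cases "sg w"; cases "sg u") (auto simp: sz)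
  next
    case v1: False
    show ?thesis using v1 dn(2)[OF ni(1)[OF v] v1] N(1,7,8,9) b1 by (cases "sg w"; cases "sg u") (auto simp: sz)
  qed
  have B3: "6 * c + k + max (2 * card (ch v)) (card (ch v) + 4) + max (card (ch w)) 2 + max (card (ch u)) 2
      < 2 * sz (sg v) + sz (sg w) + sz (sg u) + card leaves"
    if v: "v \<in> inner - {rt}" and w: "w \<in> inner" and u: "u \<in> inner" and ne: "w \<noteq> v" "u \<noteq> v" "w \<noteq> u" for v w u
  proof -
    consider "w = rt" | "u = rt" "w \<noteq> rt" | "w \<noteq> rt" "u \<noteq> rt" by blast
    thus ?thesis
    proof cases
      case 1
      have "sz (sg w) = x" using 1 sg_rt sz by simp
      thus ?thesis using B3r[OF v u ne(2)] 1 ne D2 by auto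
    next
      case 2
      have "sz (sg u) = x" using 2 sg_rt sz by simp
      thus ?thesis using B3r[OF v w ne(1)] 2 ne D2 by auto
    next
      case 3
      have "D + card (ch v) + card (ch w) + card (ch u) \<le> card leaves + 3"
        using 3 ne l4[OF ni[OF v] w 3(1) _ u 3(2)] by auto
      thus ?thesis unfolding m4 using B3n[OF v, of w u] m2[OF w] m2[OF u] by linarith
    qed
  qed
  have NE1: "3 * c + 4 \<le> x \<or> 3 * c + 6 < x + D" "3 * c + 4 \<le> y \<or> 3 * c + 6 < y + D"
    "6 * c + 4 < 2 * x" "6 * c + 4 < 2 * y" if "k \<noteq> 14"
    using NE(1,8)[OF that] by (auto simp: min_def split: if_splits)
  have cnt: "(\<Sum>v\<in>X. sz (sg v)) = p * x + (card X - p) * y \<and> p \<le> card X \<and>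
      (p = card X \<longrightarrow> (\<forall>v\<in>X. sg v)) \<and> (p = 0 \<longrightarrow> (\<forall>v\<in>X. \<not> sg v))" if "finite X" "p = card {v\<in>X. sg v}" for X p
  proof -
    note s = sum_sz[OF that(1)]
    have q: "card X - p = card {v\<in>X. \<not> sg v}" "p \<le> card X" using s(2) that(2) by auto
    have "(\<Sum>v\<in>X. sz (sg v)) = p * x + (card X - p) * y" unfolding s(1) q(1) sz that(2)[symmetric] ..
    moreover note q(2)
    moreover have "\<forall>v\<in>X. sg v" if "p = card X"
    proof -
      have "card {v\<in>X. \<not> sg v} = 0" using s(2) that \<open>p = card {v\<in>X. sg v}\<close> by simp
      thus ?thesis using \<open>finite X\<close> by auto
    qed
    moreover have "\<forall>v\<in>X. \<not> sg v" if "p = 0" using that \<open>p = card {v\<in>X. sg v}\<close> \<open>finite X\<close> by auto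
    ultimately show ?thesis by blast
  qed
  have F: "6 * c + k + 1 \<le> (\<Sum>v\<in>X. sz (sg v))" if X: "X \<subseteq> inner" "card X = 4" for X
  proof -
    have "finite X" using finite_subset[OF X(1)] by simp
    note fin = this
    define p where "p = card {v\<in>X. sg v}"
    have p: "(\<Sum>v\<in>X. sz (sg v)) = p * x + (4 - p) * y" "p \<le> 4" using cnt[OF fin p_def] unfolding X(2) by blast+
    from p(2) consider "p = 0" | "p = 1" | "p = 2" | "p = 3" | "p = 4" by linarith
    thus ?thesis using p(1) N(1) N4 by cases auto
  qed
  have two: "1 \<le> a" if X: "X \<subseteq> inner" "\<forall>v\<in>X. sg v" "2 \<le> card X" for X
  proof -
    have "\<not> X \<subseteq> {rt}" using card_mono[of "{rt}" X] X(3) by auto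
    then obtain v where "v \<in> X" "v \<noteq> rt" by blast
    thus ?thesis using X(1,2) up(1)[of v] by blast
  qed
  have EX: "sum (dem E) X + c * (card X choose 2) + card E < (\<Sum>v\<in>X. sz (sg v))"
    if st: "stage E" and X: "X \<subseteq> E" and cX: "3 \<le> card X" "card X \<le> 4" and k: "k \<noteq> 14" for E X
  proof -
    have Xi: "X \<subseteq> inner" using X st unfolding stage_def by blast
    have finX: "finite X" using finite_subset[OF Xi] by simp
    define p where "p = card {v\<in>X. sg v}"
    note p = cnt[OF finX p_def]
    note ps = p[THEN conjunct1]
    define r where "r = (if rt \<in> X then 1 else 0 :: nat)"
    have r: "card (X - {rt}) + r = card X"
      using finX cX card_Suc_Diff1[of X rt] unfolding r_def by auto
    \<comment> \<open>If \<open>X\<close> consists of sinks, the root lies outside and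
      \<open>g2\<close> applies; if it consists of sources, \<open>g\<close> lies outside and
      \<open>g3\<close> applies. In mixed sets \<open>x + y = k + 1\<close> already pays for most of
      the demand.\<close>
    have g1: "sum (dem E) X + card E + r \<le> k + 1 + card X" using sum_dem_le[OF st X] r by linarith
    have g2: "sum (dem E) X + card E + D \<le> k + 1 + 2 * card X" if "rt \<notin> X"
      using sum_dem_heavy[OF st X rti that] r unfolding D_def by linarith
    have g3: "sum (dem E) X + card E + b + r \<le> k + 1 + 2 * card X" if "g \<notin> X"
      using sum_dem_heavy[OF st X g(1) that] r unfolding b_def by linarith
    have gX: "g \<notin> X" if "p = card X" using p that g(2) by auto
    have rX: "r = 0 \<and> rt \<notin> X" if "p = 0" using p that sg_rt unfolding r_def by auto
    have r01: "(r = 0 \<and> rt \<notin> X) \<or> r = 1" unfolding r_def by auto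
    have a0: "1 \<le> a" if "p = card X" using two[OF Xi] p that cX by auto
    consider "card X = 3" | "card X = 4" using cX by linarith
    thus ?thesis
    proof cases
      case 1
      have c3: "(3::nat) choose 2 = 3" by (simp add: numeral_eq_Suc)
      have "p \<le> 3" using p 1 by simp
      then consider "p = 0" | "p = 1" | "p = 2" | "p = 3" by linarith
      thus ?thesis
      proof cases
        case p0: 1
        have "(\<Sum>v\<in>X. sz (sg v)) = 3 * y" using ps p0 1 by simp
        thus ?thesis using g1 g2 rX[OF p0] NE(4)[OF k] 1 c3 by auto
      next
        case p0: 2
        have "(\<Sum>v\<in>X. sz (sg v)) = x + 2 * y" using ps p0 1 by simp
        thus ?thesis using g1 g2 r01 NE1(2)[OF k] N(1) N4(4) 1 c3 by auto
      next
        case p0: 3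
        have "(\<Sum>v\<in>X. sz (sg v)) = 2 * x + y" using ps p0 1 by simp
        thus ?thesis using g1 g2 r01 NE1(1)[OF k] N(1) N4(3) 1 c3 by auto
      next
        case p0: 4
        have s: "(\<Sum>v\<in>X. sz (sg v)) = 3 * x" and pc: "p = card X" using ps p0 1 by simp_all
        note al = a0[OF pc]
        have g3: "sum (dem E) X + card E + b + r \<le> k + 7" using g3[OF gX[OF pc]] 1 by simp
        have g2: "sum (dem E) X + card E + D \<le> k + 7" if "rt \<notin> X" using g2[OF that] 1 by simp
        have g1: "sum (dem E) X + card E + r \<le> k + 4" using g1 1 by simp
        show ?thesis unfolding s 1 c3 using r01
        proof
          assume "r = 0 \<and> rt \<notin> X"
          thus "sum (dem E) X + c * 3 + card E < 3 * x" using g1 g2 NE(2)[OF k al] by linarith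
        next
          assume "r = 1"
          thus "sum (dem E) X + c * 3 + card E < 3 * x" using g1 g3 NE(3)[OF k al] by linarith
        qed
      qed
    next
      case 2
      have c4: "(4::nat) choose 2 = 6" by (simp add: numeral_eq_Suc)
      have "p \<le> 4" using p 2 by simp
      then consider "p = 0" | "p = 1" | "p = 2" | "p = 3" | "p = 4" by linarith
      thus ?thesis
      proof cases
        case p0: 1
        have "(\<Sum>v\<in>X. sz (sg v)) = 4 * y" using ps p0 2 by simp
        thus ?thesis using g1 g2 rX[OF p0] NE(7)[OF k] 2 c4 by auto
      next
        case p0: 2
        have "(\<Sum>v\<in>X. sz (sg v)) = x + 3 * y" using ps p0 2 by simp
        thus ?thesis using g1 NE1(4)[OF k] N(1) 2 c4 by simp
      next
        case p0: 3
        have "(\<Sum>v\<in>X. sz (sg v)) = 2 * x + 2 * y" using ps p0 2 by simp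
        thus ?thesis using g1 NE1(3,4)[OF k] N(1) 2 c4 by simp
      next
        case p0: 4
        have "(\<Sum>v\<in>X. sz (sg v)) = 3 * x + y" using ps p0 2 by simp
        thus ?thesis using g1 NE1(3)[OF k] N(1) 2 c4 by simp
      next
        case p0: 5
        have s: "(\<Sum>v\<in>X. sz (sg v)) = 4 * x" and pc: "p = card X" using ps p0 2 by simp_all
        note al = a0[OF pc]
        have g3: "sum (dem E) X + card E + b + r \<le> k + 9" using g3[OF gX[OF pc]] 2 by simp
        have g2: "sum (dem E) X + card E + D \<le> k + 9" if "rt \<notin> X" using g2[OF that] 2 by simp
        have g1: "sum (dem E) X + card E + r \<le> k + 5" using g1 2 by simp
        show ?thesis unfolding s 2 c4 using r01
        proof
          assume "r = 0 \<and> rt \<notin> X"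
          thus "sum (dem E) X + c * 6 + card E < 4 * x" using g1 g2 NE(5)[OF k al] by linarith
        next
          assume "r = 1"
          thus "sum (dem E) X + c * 6 + card E < 4 * x" using g1 g3 NE(6)[OF k al] by linarith
        qed
      qed
    qed
  qed
  have E14: "sum (dem E) X + c * (card X choose 2) + card E \<le> (\<Sum>v\<in>X. sz (sg v)) \<and>
      (4 \<le> card X \<longrightarrow> sum (dem E) X + c * (card X choose 2) + card E < (\<Sum>v\<in>X. sz (sg v)))"
    if st: "stage E" and X: "X \<subseteq> E" and cX: "3 \<le> card X" "card X \<le> 6" and k: "k = 14" for E X
  proof -
    have c1: "c = 1" using c k by linarith
    have "card (X - {rt}) \<le> card X" using cX by (intro card_mono) (auto intro: card_ge_0_finite)
    hence g1: "sum (dem E) X + card E \<le> 15 + card X" using sum_dem_le[OF st X] k by linarith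
    have "7 * card X = (\<Sum>v\<in>X. 7)" by simp
    also have "\<dots> \<le> (\<Sum>v\<in>X. sz (sg v))" using NE(9)[OF k] unfolding sz_def by (intro sum_mono) auto
    finally have s: "7 * card X \<le> (\<Sum>v\<in>X. sz (sg v))" .
    have ch: "(3::nat) choose 2 = 3" "(4::nat) choose 2 = 6" "(5::nat) choose 2 = 10" "(6::nat) choose 2 = 15"
      by (simp_all add: numeral_eq_Suc)
    consider "card X = 3" | "card X = 4" | "card X = 5" | "card X = 6" using cX by linarith
    thus ?thesis using g1 s c1 ch by cases auto
  qed
  let ?Q = "ch rt \<inter> inner" and ?E0 = "insert rt (ch rt \<inter> inner)"
  have st0: "stage ?E0"
    using closed_Un_ch[OF closed_rt, of rt ?Q] rti unfolding stage_def by auto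
  have Q: "v \<in> inner" "v \<noteq> rt" "\<not> sg v" "card (ch v) \<le> b" "ch v \<inter> ?E0 = {}" if "v \<in> ?Q" for v
  proof -
    show v: "v \<in> inner" "v \<noteq> rt" "\<not> sg v" using that ch_sub(2) sg_ch sg_rt by auto
    show "card (ch v) \<le> b" using g(3)[OF v(1,3)] unfolding b_def .
    show "ch v \<inter> ?E0 = {}" using ch_disjoint[OF v(2)] ch_sub(2) by blast
  qed
  have dQ: "dem ?E0 v \<le> b \<or> (dem ?E0 v = card (pend ?E0 v) + 2 \<and> 1 \<le> card (pend ?E0 v) \<and> card (pend ?E0 v) \<le> card (ch v))"
    if "v \<in> ?Q" for v
  proof -
    have "v \<in> V" using that inner_sub by blast
    hence l: "lam v + card (pend ?E0 v) = card (ch v)" by (rule lam_pend[OF Q(5)[OF that]])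
    show ?thesis
    proof (cases "pend ?E0 v = {}")
      case True
      thus ?thesis using l Q(4)[OF that] unfolding dem_def by simp
    next
      case False
      hence "1 \<le> card (pend ?E0 v)" by (simp add: Suc_le_eq card_gt_0_iff)
      thus ?thesis using False l Q(4)[OF that] unfolding dem_def by (auto simp: max_def)
    qed
  qed
  have I1: "dem ?E0 v + min (c + 1) (card ?Q) \<le> sz False \<and> card (ch rt) + dem ?E0 v + c + 1 \<le> sz True + sz False"
    if v: "v \<in> ?Q" for v
    using dQ[OF v]
  proof
    assume "dem ?E0 v \<le> b"
    thus ?thesis using NI(1) t[folded D_def b_def] N(1) unfolding sz D_def[symmetric] by auto
  next
    assume d: "dem ?E0 v = card (pend ?E0 v) + 2 \<and> 1 \<le> card (pend ?E0 v) \<and> card (pend ?E0 v) \<le> card (ch v)"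
    define P where "P = pend ?E0 v"
    have P: "P \<subseteq> inner" "P \<subseteq> ch v" "finite P" unfolding P_def pend_def by auto
    have "P \<noteq> {}" using d unfolding P_def by auto
    note P = P this
    have Ps: "sg w" "w \<noteq> rt" if "w \<in> P" for w
    proof -
      have "w \<in> ch v" using that P(2) by blast
      thus "sg w" "w \<noteq> rt" using sg_ch Q(3)[OF v] ch_sub(2) by auto
    qed
    obtain w where w: "w \<in> P" using P(4) by blast
    have al: "1 \<le> a" using P(1) w Ps[OF w] by (intro up(1)[of w]) auto
    then obtain h where h: "h \<in> inner" "h \<noteq> rt" "sg h" "card (ch h) = a" using heavy by blast
    have hQ: "h \<notin> ?Q" using Q(3) h(3) by blast
    have PQ: "(P \<union> {h}) \<inter> ?Q = {}" using Ps Q(3) h(3) by blast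
    have n1: "1 \<le> card ?Q" using v by (simp add: Suc_le_eq card_gt_0_iff) blast
    \<comment> \<open>The root, its inner children, the pending children of \<open>v\<close> and the
      largest source \<open>h\<close> have k children at most in total, and each of them has at
      least one. So many pending children of \<open>v\<close> leave room for only few inner children
      of the root, which is the premise of the inequality used for \<open>y\<close>.\<close>
    have "(\<Sum>w\<in>insert rt (P \<union> {h} \<union> ?Q). card (ch w)) = D + ((\<Sum>w\<in>P \<union> {h}. card (ch w)) + (\<Sum>w\<in>?Q. card (ch w)))"
      using P(3) PQ h(2) Ps(2) ch_sub(2) unfolding D_def
      by (subst sum.insert, simp, blast, subst sum.union_disjoint) auto
    moreover have "(\<Sum>w\<in>insert rt (P \<union> {h} \<union> ?Q). card (ch w)) + 1 \<le> card V"
      using P(1) h(1) rtV inner_sub by (intro sum_d_le) blast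
    ultimately have tot: "D + ((\<Sum>w\<in>P \<union> {h}. card (ch w)) + (\<Sum>w\<in>?Q. card (ch w))) \<le> k" using kV by simp
    have s1: "card P + (a - 1) \<le> (\<Sum>w\<in>P \<union> {h}. card (ch w))"
    proof -
      have "(\<Sum>w\<in>P \<union> {h}. card (ch w)) = card (ch h) + (\<Sum>w\<in>P - {h}. card (ch w))"
        using P(3) by (simp add: sum.insert_remove)
      moreover have "card (P - {h}) \<le> (\<Sum>w\<in>P - {h}. card (ch w))"
        using sum_mono[of "P - {h}" "\<lambda>_. 1" "\<lambda>w. card (ch w)"] P(1) d_pos by (simp add: subset_iff)
      moreover have "card P \<le> card (P - {h}) + 1" using card_Suc_Diff1[OF P(3), of h] by (cases "h \<in> P") auto
      ultimately show ?thesis using h(4) al by linarith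
    qed
    have s2: "card (pend ?E0 v) + card ?Q \<le> (\<Sum>w\<in>?Q. card (ch w)) + 1"
    proof -
      have "(\<Sum>w\<in>?Q. card (ch w)) = card (ch v) + (\<Sum>w\<in>?Q - {v}. card (ch w))"
        using v by (intro sum.remove) auto
      moreover have "card (?Q - {v}) \<le> (\<Sum>w\<in>?Q - {v}. card (ch w))"
        using sum_mono[of "?Q - {v}" "\<lambda>_. 1" "\<lambda>w. card (ch w)"] d_pos by simp
      moreover have "card ?Q = card (?Q - {v}) + 1" using card_Suc_Diff1[of ?Q v] v by simp
      ultimately show ?thesis using d by linarith
    qed
    have "D + 2 * card (pend ?E0 v) + (a - 1) + card ?Q \<le> k + 1"
      using tot s1 s2 unfolding P_def by linarith
    hence "card (pend ?E0 v) + 2 + min (c + 1) (card ?Q) \<le> y"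
      using d Q(4)[OF v] by (intro NI(2)[OF al _ n1]) auto
    thus ?thesis using d Q(4)[OF v] t[folded D_def b_def] N(1) c(1) unfolding sz D_def[symmetric] by auto
  qed
  have I2: "dem ?E0 v + dem ?E0 w + 3 * c + 1 \<le> 2 * sz False \<or> dem ?E0 v + dem ?E0 w + c + card ?Q + 1 \<le> 2 * sz False"
    if v: "v \<in> ?Q" and w: "w \<in> ?Q" and vw: "v \<noteq> w" for v w
    using NI(3)
  proof
    assume "2 * b + 3 * c + 5 \<le> 2 * y"
    moreover have "dem ?E0 v \<le> b + 2" "dem ?E0 w \<le> b + 2" using dQ[OF v] dQ[OF w] Q(4)[OF v] Q(4)[OF w] by auto
    ultimately show ?thesis unfolding sz by simp
  next
    assume y: "c + k + 5 \<le> D + 2 * y"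
    have "sum (dem ?E0) {v, w} + card ?E0 + D \<le> k + 1 + card {v, w} + card ({v, w} - {rt})"
      unfolding D_def using v w Q(2) rti by (intro sum_dem_heavy[OF st0]) auto
    moreover have "card ?E0 = card ?Q + 1" using ch_sub(2) by simp
    moreover have "card ({v, w} - {rt}) \<le> 2" using card_mono[of "{v, w}" "{v, w} - {rt}"] vw by simp
    ultimately show ?thesis using y vw unfolding sz by simp
  qed
  interpret engine_bounds V rt par dep sg R c A sz k "if k = 14 then 3 else 2"
  proof (unfold_locales, goal_cases)
    case (5 E X)
    thus ?case using E14[of E X] by (auto split: if_splits)
  next
    case (6 E X)
    thus ?case using E14[of E X] EX[of E X] by (auto split: if_splits)
  next
    case (2 v)
    thus ?case by (rule B1)
  next
    case (3 v w)
    thus ?case by (rule B2)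
  next
    case (4 v w u)
    thus ?case by (rule B3)
  next
    case (8 v)
    thus ?case by (rule I1)
  next
    case (9 v w)
    thus ?case by (rule I2)
  next
    case (10 X)
    thus ?case by (rule F)
  qed (use N(2) rti A(1) in \<open>auto simp: sz D_def\<close>)
  show ?thesis by (rule engine_embeds)
qed

end

section \<open>A dominating root\<close>

context tree_host
begin

text \<open>Induction over subtrees for an arbitrary invariant \<open>P\<close>. A step may return
  more than \<open>insert y E\<close>, since one of the methods embeds a sink together with all its
  children.\<close>

lemma grow:
  assumes "closed E" "closed F" "E \<subseteq> F" "P E f"
    and step: "\<And>E f y. closed E \<Longrightarrow> E \<subseteq> F \<Longrightarrow> P E f \<Longrightarrow> y \<in> F \<Longrightarrow> y \<notin> E \<Longrightarrow> y \<noteq> rt \<Longrightarrow> par y \<in> E \<Longrightarrow>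
      \<exists>E' f'. closed E' \<and> insert y E \<subseteq> E' \<and> E' \<subseteq> F \<and> P E' f'"
  shows "\<exists>f. P F f"
  using assms(1,3,4)
proof (induction "card (F - E)" arbitrary: E f rule: less_induct)
  case less
  have finF: "finite F" using assms(2) finV finite_subset unfolding closed_def by blast
  show ?case
  proof (cases "F \<subseteq> E")
    case True
    thus ?thesis using less.prems by auto
  next
    case False
    obtain y where y: "y \<in> F" "y \<notin> E" "y \<in> V" "y \<noteq> rt" "par y \<in> E"
      using closed_step[OF less.prems(1) assms(2) False] .
    obtain E' f' where E': "closed E'" "insert y E \<subseteq> E'" "E' \<subseteq> F" "P E' f'"
      using step[OF less.prems y(1,2,4,5)] by blast
    have "card (F - E') < card (F - E)" using y E' finF by (intro psubset_card_mono) auto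
    thus ?thesis using less.hyps E'(1,3,4) by blast
  qed
qed

text \<open>Any \<open>w\<close> other than \<open>u\<close> shares at most \<open>c\<close>
  neighbours with \<open>u\<close> and so is adjacent to at most \<open>c\<close> vertices of
  \<open>Z\<close>. By double counting fewer than \<open>2 * c\<close> vertices of \<open>Z\<close>
  can have \<open>b\<close> or more neighbours in \<open>W\<close>. The vertex \<open>u\<close>
  itself is adjacent to all of \<open>Z\<close> and must be kept out of \<open>W\<close>.\<close>

lemma averaging:
  assumes "Z \<subseteq> nb R \<sigma> u" "finite W" "u \<notin> W" "card W < 2 * b" "2 * c \<le> card Z" "0 < c"
  shows "\<exists>z\<in>Z. card (nb R (\<not> \<sigma>) z \<inter> W) < b"
proof (rule ccontr)
  assume neg: "\<not> ?thesis"
  have finZ: "finite Z" using finite_subset[OF assms(1)] by simp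
  have "card {z \<in> Z. w \<in> nb R (\<not> \<sigma>) z} \<le> c" if "w \<in> W" for w
  proof -
    have "{z \<in> Z. w \<in> nb R (\<not> \<sigma>) z} \<subseteq> nb R \<sigma> u \<inter> nb R \<sigma> w" using assms(1) nb_sym[of _ R \<sigma> w] by auto
    hence "card {z \<in> Z. w \<in> nb R (\<not> \<sigma>) z} \<le> card (nb R \<sigma> u \<inter> nb R \<sigma> w)" by (intro card_mono) auto
    also have "\<dots> \<le> c" using that assms(3) by (intro common) auto
    finally show ?thesis .
  qed
  hence "card {z \<in> Z. b \<le> card (nb R (\<not> \<sigma>) z \<inter> W)} < 2 * c"
    using few_many_hits[OF finZ assms(2) _ assms(4,6)] by blast
  moreover have "{z \<in> Z. b \<le> card (nb R (\<not> \<sigma>) z \<inter> W)} = Z" using neg by (auto simp: not_less)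
  ultimately show False using assms(5) by simp
qed

definition rest :: "'c set" where "rest = V - {rt} - ch rt"

lemma fin_rest [simp]: "finite rest" unfolding rest_def using finV by simp

lemma card_rest: "card V = k + 1 \<Longrightarrow> card rest + card (ch rt) = k"
proof -
  assume k: "card V = k + 1"
  have "card (V - {rt}) = k" using k rtV by simp
  moreover have "card (V - {rt} - ch rt) = card (V - {rt}) - card (ch rt)"
    using ch_sub by (intro card_Diff_subset) auto
  moreover have "card (ch rt) \<le> card (V - {rt})" using ch_sub finV by (intro card_mono) auto
  ultimately show ?thesis unfolding rest_def by simp
qed

lemma ch_rest: "x \<in> V \<Longrightarrow> x \<noteq> rt \<Longrightarrow> ch x \<subseteq> rest"
  using ch_sub ch_disjoint[of x rt] unfolding rest_def by blast

lemma rest_par: "y \<in> V \<Longrightarrow> y \<noteq> rt \<Longrightarrow> y \<notin> ch rt \<Longrightarrow> y \<in> rest" unfolding rest_def by blast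

lemma source_rest: "u \<in> V \<Longrightarrow> u \<noteq> rt \<Longrightarrow> sg u \<Longrightarrow> u \<in> rest"
  using sg_ch sg_rt unfolding rest_def by blast

text \<open>Every inner child of the root has a child of its own, and these are distinct vertices of
  \<open>rest\<close>.\<close>

lemma card_root_inner:
  assumes "Q \<subseteq> ch rt \<inter> inner" "\<And>q. q \<in> Q \<Longrightarrow> ch q \<subseteq> X" "X \<subseteq> rest"
  shows "card Q \<le> card X"
proof -
  have QV: "Q \<subseteq> V" using assms(1) ch_sub by blast
  have "card Q = (\<Sum>q\<in>Q. 1)" by simp
  also have "\<dots> \<le> (\<Sum>q\<in>Q. card (ch q))" using assms(1) d_pos by (intro sum_mono) auto
  also have "\<dots> = card (\<Union>q\<in>Q. ch q)" using sum_ch[OF QV] by simp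
  also have "\<dots> \<le> card X" using assms(2) finite_subset[OF assms(3)] by (intro card_mono) auto
  finally show ?thesis .
qed

text \<open>The neighbourhood of the root is kept for the children of the root, all other vertices avoid it.\<close>

lemma embed_reserved:
  assumes A: "core R m A" and z: "z \<in> A True" "card (ch rt) \<le> card (nb R True z)"
    and m: "\<And>\<sigma>. card rest + c + 1 \<le> m \<sigma>"
  shows "\<exists>f. emb V f"
proof -
  let ?Q = "ch rt \<inter> inner" and ?L = "ch rt \<inter> leaves" and ?N = "nb R True z"
  let ?E0 = "insert rt ?Q"
  have chrt: "ch rt = ?Q \<union> ?L" "?Q \<inter> ?L = {}" using V_split ch_sub by blast+
  have QV: "q \<in> V \<and> q \<noteq> rt" if "q \<in> ?Q" for q using that ch_sub by auto
  have Qr: "card ?Q \<le> card rest" using ch_rest QV by (intro card_root_inner) auto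
  have clF: "closed (V - ?L)" using ch_sub(2) by (intro closed_Diff_leaves) auto
  have cl0: "closed ?E0" using closed_Un_ch[OF closed_rt, of rt ?Q] by simp
  have E0F: "?E0 \<subseteq> V - ?L" using rtV ch_sub V_split by blast
  have M: "m \<sigma> \<le> card (nb R \<sigma> u \<inter> A (\<not> \<sigma>))" if "u \<in> A \<sigma>" for \<sigma> u using A that unfolding core_def by blast
  obtain f0 where f0: "emb ({rt} \<union> ?Q) f0" "\<And>y. y \<in> {rt} \<Longrightarrow> f0 y = z" "f0 ` ?Q \<subseteq> ?N \<inter> A False"
  proof (rule emb_extend_set[OF closed_rt emb_rt[of "\<lambda>_. z"], of rt ?Q "?N \<inter> A False"])
    show "card ?Q \<le> card (?N \<inter> A False)" using M[OF z(1)] m[of True] Qr by simp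
    show "?N \<inter> A False \<inter> (\<lambda>_. z) ` {rt} = {}" using nb_irrefl by auto
    show "?Q \<inter> {rt} = {}" using ch_sub(2) by auto
  qed (use sg_rt in auto)
  define P where "P E f \<longleftrightarrow> ?E0 \<subseteq> E \<and> emb E f \<and> (\<forall>x\<in>E. f x \<in> A (sg x)) \<and> f rt = z \<and> f ` (E - ?E0) \<inter> ?N = {}" for E f
  have "P ?E0 f0" unfolding P_def using f0 z(1) sg_rt sg_ch by fastforce
  hence "\<exists>f. P (V - ?L) f"
  proof (rule grow[where P = P, OF cl0 clF E0F])
    fix E f y
    assume E: "closed E" "E \<subseteq> V - ?L" "P E f" and y: "y \<in> V - ?L" "y \<notin> E" "y \<noteq> rt" "par y \<in> E"
    have emb: "emb E f" and fA: "\<And>x. x \<in> E \<Longrightarrow> f x \<in> A (sg x)" and fz: "f rt = z" and E0: "?E0 \<subseteq> E"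
      and fN: "f ` (E - ?E0) \<inter> ?N = {}" using E(3) unfolding P_def by auto
    have finE: "finite E" using E(2) finite_subset[OF _ finV] by blast
    have inj: "inj_on f E" using emb unfolding emb_def by blast
    define p where "p = par y"
    have yV: "y \<in> V" using y(1) by blast
    \<comment> \<open>The inner children of the root are embedded from the beginning and its leaf
      children are postponed, so only vertices of \<open>rest\<close> occur here.\<close>
    have pr: "p \<noteq> rt"
    proof
      assume "p = rt"
      hence "y \<in> ch rt" using chI[OF yV y(3)] unfolding p_def by simp
      thus False using y(1,2) E0 chrt by blast
    qed
    have yr: "y \<in> rest" using pr chD[of y rt] yV y(3) unfolding p_def by (intro rest_par) auto
    have pz: "f p \<noteq> z" using pr y(4) E0 inj fz unfolding p_def inj_on_def by (metis insert_subset)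
    have sgy: "A (\<not> sg p) = A (sg y)" using sg_par[OF yV y(3)] unfolding p_def by simp
    let ?M = "nb R (sg p) (f p) \<inter> A (\<not> sg p)"
    have cM: "card rest + c + 1 \<le> card ?M" using M[OF fA] m[of "sg p"] y(4) unfolding p_def by (meson order_trans)
    have ER: "E - ?E0 \<subseteq> rest - {y}" using E(2) y(2) chrt unfolding rest_def by blast
    have "card (f ` (E - ?E0)) \<le> card (E - ?E0)" using finE by (intro card_image_le) auto
    also have "\<dots> \<le> card (rest - {y})" using ER by (intro card_mono) auto
    finally have c1: "card (f ` (E - ?E0)) + 1 \<le> card rest" using yr card_Suc_Diff1[of rest y] by simp
    have "card (?M \<inter> ?N) \<le> c" using pz by (intro common_sub[of "f p" z _ "sg p" _ True]) auto
    hence "card (?M \<inter> ?N) + card {z} + card (f ` (E - ?E0)) < card ?M" using c1 cM by simp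
    moreover have "card ((?M \<inter> ?N) \<union> {z} \<union> f ` (E - ?E0)) \<le> card (?M \<inter> ?N) + card {z} + card (f ` (E - ?E0))"
      using card_Un_le[of "(?M \<inter> ?N) \<union> {z}" "f ` (E - ?E0)"] card_Un_le[of "?M \<inter> ?N" "{z}"] by linarith
    ultimately have "\<not> ?M \<subseteq> (?M \<inter> ?N) \<union> {z} \<union> f ` (E - ?E0)"
      using card_mono[of "(?M \<inter> ?N) \<union> {z} \<union> f ` (E - ?E0)" ?M] finE by auto
    then obtain w where w: "w \<in> ?M" "w \<notin> ?N" "w \<noteq> z" "w \<notin> f ` (E - ?E0)" by blast
    have "f ` ?Q \<subseteq> nb R (sg rt) (f rt)" using E0 by (intro emb_ch[OF emb E(1)]) auto
    hence "f ` ?E0 \<subseteq> insert z ?N" using fz sg_rt by auto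
    moreover have "f ` E \<subseteq> f ` (E - ?E0) \<union> f ` ?E0" by blast
    ultimately have wE: "w \<notin> f ` E" using w(2-4) by blast
    have "P (insert y E) (f(y := w))"
    proof -
      have "emb (insert y E) (f(y := w))"
        using emb_extend[OF E(1) emb yV y(3,2,4)] w(1) wE unfolding p_def by blast
      moreover have "f(y := w) ` (insert y E - ?E0) = insert w (f ` (E - ?E0))" using y(2) E0 by (auto simp: image_iff)
      ultimately show ?thesis unfolding P_def using E0 fA y(2,3) fz w(1,2) fN sgy by auto
    qed
    moreover have "closed (insert y E)" using closed_insert[OF E(1) yV y(4)] .
    ultimately show "\<exists>E' f'. closed E' \<and> insert y E \<subseteq> E' \<and> E' \<subseteq> V - ?L \<and> P E' f'"
      using y(1) E(2) by (intro exI[of _ "insert y E"] exI[of _ "f(y := w)"]) auto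
  qed
  then obtain f where f: "P (V - ?L) f" ..
  \<comment> \<open>By the reservation only inner children of the root occupy its neighbourhood,
    hence its leaf children still fit.\<close>
  have "?N \<inter> f ` (V - ?L) \<subseteq> f ` ?Q"
    using f nb_irrefl[of z] unfolding P_def by blast
  hence "card (?N \<inter> f ` (V - ?L)) \<le> card ?Q"
    by (meson card_image_le card_mono fin_ch finite_Int finite_imageI order_trans)
  moreover have "card ?N \<le> card (?N - f ` (V - ?L)) + card (?N \<inter> f ` (V - ?L))"
    using card_Un_le[of "?N - f ` (V - ?L)" "?N \<inter> f ` (V - ?L)"] by (simp add: Un_Diff_Int)
  moreover have "card (ch rt) = card ?Q + card ?L" using chrt card_Un_disjoint[of ?Q ?L] by simp
  ultimately have "card ?L \<le> card (?N - f ` (V - ?L))" using z(2) by linarith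
  thus ?thesis using f sg_rt unfolding P_def by (intro emb_rt_leaves) auto
qed

text \<open>Each sink is embedded together with its children; averaging yields an image that still has
  enough free in-neighbours for them.\<close>

lemma embed_batches:
  assumes kV: "card V = k + 1" and c: "0 < c"
    and A: "core R (\<lambda>\<sigma>. if \<sigma> then card (ch rt) else k + 1 - card (ch rt)) A"
    and v: "v \<in> A True" "k \<le> card (nb R True v \<inter> A False)"
    and D: "card rest + 2 * c + 1 \<le> card (ch rt)"
    and big: "card rest + 3 * c \<le> card (ch rt) + 2 \<or>
      (\<exists>g. g \<in> V \<and> \<not> sg g \<and> 4 * c + card rest \<le> card (ch rt) + card (ch g))"
  shows "\<exists>f. emb V f"
proof -
  let ?L = "ch rt \<inter> leaves" and ?D = "card (ch rt)" and ?e = "card rest"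
  have ke: "k + 1 - ?D = ?e + 1" "k = ?D + ?e" using card_rest[OF kV] by auto
  have clF: "closed (V - ?L)" using ch_sub(2) by (intro closed_Diff_leaves) auto
  have rtF: "{rt} \<subseteq> V - ?L" using rtV ch_sub by blast
  have Mt: "?D \<le> card (nb R True u \<inter> A False)" if "u \<in> A True" for u using A that unfolding core_def by fastforce
  have Mf: "?e + 1 \<le> card (nb R False u \<inter> A True)" if "u \<in> A False" for u
    using A that unfolding core_def ke(1) by fastforce
  define P where "P E f \<longleftrightarrow> emb E f \<and> (\<forall>x\<in>E. f x \<in> A (sg x)) \<and> f rt = v \<and> (\<forall>x\<in>E. \<not> sg x \<longrightarrow> ch x \<subseteq> E)" for E f
  have "P {rt} (\<lambda>_. v)" unfolding P_def using emb_rt v(1) sg_rt by auto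
  hence "\<exists>f. P (V - ?L) f"
  proof (rule grow[where P = P, OF closed_rt clF rtF])
    fix E f y
    assume E: "closed E" "E \<subseteq> V - ?L" "P E f" and y: "y \<in> V - ?L" "y \<notin> E" "y \<noteq> rt" "par y \<in> E"
    have emb: "emb E f" and fA: "\<And>x. x \<in> E \<Longrightarrow> f x \<in> A (sg x)" and fv: "f rt = v"
      and full: "\<And>x. x \<in> E \<Longrightarrow> \<not> sg x \<Longrightarrow> ch x \<subseteq> E" using E(3) unfolding P_def by auto
    have finE: "finite E" using E(2) finite_subset[OF _ finV] by blast
    have EV: "E \<subseteq> V" using E(2) by blast
    have rtE: "rt \<in> E" using E(1) unfolding closed_def by blast
    have inj: "inj_on f E" using emb unfolding emb_def by blast
    define u where "u = par y"
    have yV: "y \<in> V" using y(1) by blast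
    have uE: "u \<in> E" and yu: "y \<in> ch u" using y(4) chI[OF yV y(3)] unfolding u_def by auto
    have su: "sg u" using full[OF uE] yu y(2) by blast
    have sy: "\<not> sg y" using sg_ch[OF yu] su by simp
    have uA: "f u \<in> A True" using fA[OF uE] su by simp
    have chyr: "ch y \<subseteq> rest" using ch_rest[OF yV y(3)] .
    have chyE: "ch y \<inter> E = {}" using closed_ch[OF E(1) y(2)] .
    let ?d = "card (ch y)"
    let ?Z = "nb R True (f u) \<inter> A False - f ` E"
    have split: "E = insert rt (E \<inter> ch rt) \<union> (E \<inter> rest)" using EV rtE unfolding rest_def by blast
    have Qin: "E \<inter> ch rt \<subseteq> ch rt \<inter> inner" using E(2) not_leafD by blast
    \<comment> \<open>Sinks come with all their children, so every embedded child of the root has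
      brought a vertex of \<open>rest\<close> along. Thus \<open>E\<close> is at most about twice as
      large as \<open>E \<inter> rest\<close>.\<close>
    have cQ: "card (E \<inter> ch rt) \<le> card (E \<inter> rest)"
    proof (rule card_root_inner[OF Qin])
      fix q assume q: "q \<in> E \<inter> ch rt"
      hence "q \<in> V" "q \<noteq> rt" "\<not> sg q" using EV ch_sub(2) sg_ch sg_rt by auto
      thus "ch q \<subseteq> E \<inter> rest" using full[of q] q ch_rest by blast
    qed simp
    have "card (E \<inter> rest) \<le> card (rest - ch y)" using chyE by (intro card_mono) auto
    also have "\<dots> = ?e - ?d" using chyr by (intro card_Diff_subset) auto
    finally have cR: "card (E \<inter> rest) + ?d \<le> ?e" using card_mono[OF fin_rest chyr] by linarith
    have cE: "card E \<le> 1 + card (E \<inter> ch rt) + card (E \<inter> rest)"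
    proof -
      have "card E \<le> card (insert rt (E \<inter> ch rt)) + card (E \<inter> rest)" by (subst split, rule card_Un_le)
      also have "card (insert rt (E \<inter> ch rt)) \<le> 1 + card (E \<inter> ch rt)" by (simp add: card_insert_le_m1 card_insert_if)
      finally show ?thesis by simp
    qed
    have cW: "card (f ` E - {f u}) < 2 * (?e + 1 - ?d)"
    proof -
      have "card (f ` E - {f u}) = card E - 1" using card_image[OF inj] uE finE by simp
      thus ?thesis using cE cQ cR by linarith
    qed
    \<comment> \<open>Averaging asks for \<open>2 * c\<close> candidates; if \<open>y\<close> is a
      leaf, a single one will do.\<close>
    have Z: "2 * c \<le> card ?Z \<or> (?d = 0 \<and> 1 \<le> card ?Z)"
    proof (cases "u = rt")
      case True
      have "card (f ` E) \<le> 1 + 2 * (?e - ?d)" using card_image[OF inj] cE cQ cR by linarith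
      moreover have "card (nb R True (f u) \<inter> A False) - card (f ` E) \<le> card ?Z" using finE by (intro diff_card_le_card_Diff) auto
      moreover have "k \<le> card (nb R True (f u) \<inter> A False)" using True fv v(2) by simp
      ultimately show ?thesis using ke(2) D by linarith
    next
      case False
      have ur: "u \<in> rest" using uE EV su False by (intro source_rest) auto
      have yr: "y \<in> rest" using yu False ch_rest[of u] uE EV by blast
      have fuv: "f u \<noteq> v" using False inj uE rtE fv unfolding inj_on_def by blast
      have "f ` (E \<inter> ch rt) \<subseteq> nb R True v" using emb_ch[OF emb E(1), of "E \<inter> ch rt" rt] fv sg_rt by simp
      hence k1: "card (nb R True (f u) \<inter> f ` (E \<inter> ch rt)) \<le> c" using fuv by (intro common_sub[of "f u" v _ True _ True]) auto
      have Zge: "?D \<le> card ?Z + n" if n: "card (nb R True (f u) \<inter> f ` E) \<le> n" for n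
      proof -
        have "card (nb R True (f u) \<inter> A False) \<le> card (?Z \<union> (nb R True (f u) \<inter> f ` E))" by (intro card_mono) (auto simp: finE)
        also have "\<dots> \<le> card ?Z + card (nb R True (f u) \<inter> f ` E)" by (rule card_Un_le)
        finally show ?thesis using Mt[OF uA] n by linarith
      qed
      have sub: "nb R True (f u) \<inter> f ` E \<subseteq> {v} \<union> (nb R True (f u) \<inter> f ` (E \<inter> ch rt)) \<union> f ` (E \<inter> rest - {u})"
      proof
        fix w assume w: "w \<in> nb R True (f u) \<inter> f ` E"
        then obtain x where x: "x \<in> E" "w = f x" by blast
        hence "x \<noteq> u" using w nb_irrefl[of "f u" True] by auto
        moreover have "x = rt \<or> x \<in> E \<inter> ch rt \<or> x \<in> E \<inter> rest" using x(1) split by blast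
        ultimately show "w \<in> {v} \<union> (nb R True (f u) \<inter> f ` (E \<inter> ch rt)) \<union> f ` (E \<inter> rest - {u})"
          using x w fv by blast
      qed
      have ER: "E \<inter> rest - {u} \<subseteq> rest - insert u (insert y (ch y))" using y(2) chyE by blast
      have uy: "u \<notin> insert y (ch y)" "y \<notin> ch y" using uE y(2) chyE ch_irrefl by auto
      have "card (rest - insert u (insert y (ch y))) = ?e - card (insert u (insert y (ch y)))"
        using ur yr chyr by (intro card_Diff_subset) auto
      moreover have "card (insert u (insert y (ch y))) = ?d + 2" using uy by simp
      moreover have "card (insert u (insert y (ch y))) \<le> ?e" using ur yr chyr by (intro card_mono) auto
      ultimately have cER: "card (rest - insert u (insert y (ch y))) + ?d + 2 = ?e" by linarith
      show ?thesis using big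
      proof
        assume b: "?e + 3 * c \<le> ?D + 2"
        have "card (f ` (E \<inter> rest - {u})) \<le> card (E \<inter> rest - {u})" by (intro card_image_le) auto
        also have "\<dots> \<le> card (rest - insert u (insert y (ch y)))" using ER by (intro card_mono) auto
        finally have k2: "card (f ` (E \<inter> rest - {u})) + ?d + 2 \<le> ?e" using cER by linarith
        have "card (nb R True (f u) \<inter> f ` E) \<le> card ({v} \<union> (nb R True (f u) \<inter> f ` (E \<inter> ch rt)) \<union> f ` (E \<inter> rest - {u}))"
          using sub finE by (intro card_mono) auto
        also have "\<dots> \<le> card {v} + card (nb R True (f u) \<inter> f ` (E \<inter> ch rt)) + card (f ` (E \<inter> rest - {u}))"
          by (meson add_le_mono card_Un_le order_trans order_refl)
        finally have "card (nb R True (f u) \<inter> f ` E) \<le> 1 + c + (?e - ?d - 2)" using k1 k2 by simp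
        hence "?D \<le> card ?Z + (1 + c + (?e - ?d - 2))" by (rule Zge)
        thus ?thesis using b D c cER by linarith
      next
        assume "\<exists>g. g \<in> V \<and> \<not> sg g \<and> 4 * c + ?e \<le> ?D + card (ch g)"
        then obtain g where g: "g \<in> V" "\<not> sg g" and b: "4 * c + ?e \<le> ?D + card (ch g)" by blast
        have gr: "g \<noteq> rt" using g(2) sg_rt by auto
        have chg: "ch g \<subseteq> rest" using ch_rest[OF g(1) gr] .
        \<comment> \<open>The images of the children of \<open>g\<close> lie in one
          in-neighbourhood, so all but \<open>c\<close> of these numerous vertices are out of the
          way of \<open>f u\<close>.\<close>
        have k3: "card (nb R True (f u) \<inter> f ` (E \<inter> ch g)) \<le> c"
        proof (cases "g \<in> E")
          case True
          have "f g \<noteq> f u" using True uE inj g(2) su unfolding inj_on_def by auto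
          moreover have "f ` (E \<inter> ch g) \<subseteq> nb R False (f g)" using emb_ch[OF emb E(1), of "E \<inter> ch g" g] g(2) by simp
          ultimately show ?thesis by (intro common_sub[of "f u" "f g" _ True _ False]) auto
        next
          case False
          hence "E \<inter> ch g = {}" using closed_ch[OF E(1)] by blast
          thus ?thesis by simp
        qed
        have "card (E \<inter> rest - {u} - ch g) + card (ch g) + (if ?d = 0 then 1 else 2) \<le> ?e"
        proof (cases "g = y")
          case True
          have "card (E \<inter> rest - {u} - ch g) \<le> card (rest - insert u (insert y (ch y)))" using ER by (intro card_mono) auto
          moreover have "card (ch g) = ?d" using True by simp
          ultimately have "card (E \<inter> rest - {u} - ch g) + card (ch g) + 2 \<le> ?e" using cER by linarith
          thus ?thesis by (cases "?d = 0") auto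
        next
          case False
          have "y \<notin> ch g" using sg_ch[of y g] sy g(2) by auto
          hence "insert y (ch y) \<inter> ch g = {}" using ch_disjoint[of y g] False by auto
          hence "card (insert y (ch y) \<union> ch g) = ?d + 1 + card (ch g)"
            using uy(2) by (subst card_Un_disjoint) auto
          moreover have "card (E \<inter> rest - {u} - ch g) \<le> card (rest - (insert y (ch y) \<union> ch g))"
            using ER by (intro card_mono) auto
          moreover have "card (rest - (insert y (ch y) \<union> ch g)) = ?e - card (insert y (ch y) \<union> ch g)"
            using yr chyr chg by (intro card_Diff_subset) auto
          moreover have "card (insert y (ch y) \<union> ch g) \<le> ?e" using yr chyr chg by (intro card_mono) auto
          ultimately have n: "card (E \<inter> rest - {u} - ch g) + card (ch g) + ?d + 1 \<le> ?e" by linarith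
          have "(if d = 0 then 1 else 2) \<le> d + 1" for d :: nat by simp
          from this[of ?d] show ?thesis using n by linarith
        qed
        moreover have "card (f ` (E \<inter> rest - {u} - ch g)) \<le> card (E \<inter> rest - {u} - ch g)" by (intro card_image_le) auto
        ultimately have k2: "card (f ` (E \<inter> rest - {u} - ch g)) + card (ch g) + (if ?d = 0 then 1 else 2) \<le> ?e" by linarith
        have "nb R True (f u) \<inter> f ` E \<subseteq> {v} \<union> (nb R True (f u) \<inter> f ` (E \<inter> ch rt)) \<union>
            (nb R True (f u) \<inter> f ` (E \<inter> ch g)) \<union> f ` (E \<inter> rest - {u} - ch g)" using sub by blast
        hence "card (nb R True (f u) \<inter> f ` E) \<le> card ({v} \<union> (nb R True (f u) \<inter> f ` (E \<inter> ch rt)) \<union>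
            (nb R True (f u) \<inter> f ` (E \<inter> ch g)) \<union> f ` (E \<inter> rest - {u} - ch g))"
          using finE by (intro card_mono) auto
        also have "\<dots> \<le> card {v} + card (nb R True (f u) \<inter> f ` (E \<inter> ch rt)) +
            card (nb R True (f u) \<inter> f ` (E \<inter> ch g)) + card (f ` (E \<inter> rest - {u} - ch g))"
          by (meson add_le_mono card_Un_le order_trans order_refl)
        finally have "card (nb R True (f u) \<inter> f ` E) \<le> 1 + c + c + card (f ` (E \<inter> rest - {u} - ch g))"
          using k1 k3 by simp
        hence "?D \<le> card ?Z + (1 + c + c + card (f ` (E \<inter> rest - {u} - ch g)))" by (rule Zge)
        thus ?thesis using b k2 c by (cases "?d = 0") auto
      qed
    qed
    have "\<exists>z\<in>?Z. ?d \<le> card (nb R False z \<inter> A True - f ` E)"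
    proof (cases "2 * c \<le> card ?Z")
      case True
      have "\<exists>z\<in>?Z. card (nb R (\<not> True) z \<inter> (f ` E - {f u})) < ?e + 1 - ?d"
        using cW True c finE by (intro averaging[of _ True "f u"]) auto
      then obtain z where z: "z \<in> ?Z" "card (nb R False z \<inter> (f ` E - {f u})) < ?e + 1 - ?d" by auto
      have "card (nb R False z \<inter> A True) \<le> card ((nb R False z \<inter> A True - f ` E) \<union> insert (f u) (nb R False z \<inter> (f ` E - {f u})))"
        by (intro card_mono) (auto simp: finE)
      also have "\<dots> \<le> card (nb R False z \<inter> A True - f ` E) + card (insert (f u) (nb R False z \<inter> (f ` E - {f u})))" by (rule card_Un_le)
      also have "card (insert (f u) (nb R False z \<inter> (f ` E - {f u}))) \<le> 1 + card (nb R False z \<inter> (f ` E - {f u}))"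
        using finE by (simp add: card_insert_if)
      finally have "?d \<le> card (nb R False z \<inter> A True - f ` E)" using Mf[of z] z by auto
      thus ?thesis using z(1) by blast
    next
      case False
      hence "?d = 0" "1 \<le> card ?Z" using Z by auto
      moreover have "?Z \<noteq> {}" using \<open>1 \<le> card ?Z\<close> by (metis card.empty not_one_le_zero)
      ultimately show ?thesis by auto
    qed
    then obtain z where z: "z \<in> nb R True (f u)" "z \<in> A False" "z \<notin> f ` E" "?d \<le> card (nb R False z \<inter> A True - f ` E)" by blast
    let ?f = "f(y := z)"
    have e1: "emb (insert y E) ?f" using emb_extend[OF E(1) emb yV y(3,2,4)] z(1,3) su unfolding u_def by simp
    have c1: "closed (insert y E)" using closed_insert[OF E(1) yV y(4)] .
    have im: "?f ` insert y E = insert z (f ` E)" using y(2) by auto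
    obtain f' where f': "emb (insert y E \<union> ch y) f'" "\<And>x. x \<in> insert y E \<Longrightarrow> f' x = ?f x" "f' ` ch y \<subseteq> nb R False z \<inter> A True - f ` E"
    proof (rule emb_extend_set[OF c1 e1, of y "ch y" "nb R False z \<inter> A True - f ` E"])
      show "(nb R False z \<inter> A True - f ` E) \<inter> ?f ` insert y E = {}" unfolding im using nb_irrefl[of z False] by auto
      show "ch y \<inter> insert y E = {}" using chyE ch_irrefl by auto
    qed (use sy z(4) in auto)
    have "P (insert y E \<union> ch y) f'" unfolding P_def
    proof (intro conjI ballI impI)
      show "emb (insert y E \<union> ch y) f'" by (rule f'(1))
      show "f' rt = v" using f'(2)[of rt] rtE y(3) fv by simp
      fix x assume x: "x \<in> insert y E \<union> ch y"
      show "f' x \<in> A (sg x)"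
      proof (cases "x \<in> ch y")
        case True
        thus ?thesis using f'(3) sg_ch[OF True] sy by auto
      next
        case False
        hence "x \<in> insert y E" using x by blast
        thus ?thesis using f'(2)[of x] fA z(2) sy by (cases "x = y") auto
      qed
      show "ch x \<subseteq> insert y E \<union> ch y" if "\<not> sg x"
      proof (cases "x = y")
        case False
        hence "x \<in> E" using x that sg_ch[of x y] sy by auto
        thus ?thesis using full that by blast
      qed auto
    qed
    moreover have "closed (insert y E \<union> ch y)" using closed_Un_ch[OF c1, of y "ch y"] by simp
    moreover have "insert y E \<union> ch y \<subseteq> V - ?L" using y(1) E(2) chyr unfolding rest_def by blast
    ultimately show "\<exists>E' f'. closed E' \<and> insert y E \<subseteq> E' \<and> E' \<subseteq> V - ?L \<and> P E' f'" by blast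
  qed
  then obtain f where f: "P (V - ?L) f" ..
  \<comment> \<open>The tree has k vertices besides the root and \<open>v\<close> has k
    out-neighbours, so the leaf children of the root fit wherever the others are.\<close>
  have "card (V - ?L - {rt}) + card ?L = k"
  proof -
    have "V - {rt} = (V - ?L - {rt}) \<union> ?L" "(V - ?L - {rt}) \<inter> ?L = {}" using ch_sub by auto
    hence "card (V - {rt}) = card (V - ?L - {rt}) + card ?L" using finV card_Un_disjoint[of "V - ?L - {rt}" ?L] by simp
    thus ?thesis using kV rtV by simp
  qed
  moreover have "card (f ` (V - ?L - {rt})) \<le> card (V - ?L - {rt})" using finV by (intro card_image_le) auto
  moreover have "card (nb R True v) \<le> card ((nb R True v - f ` (V - ?L)) \<union> f ` (V - ?L - {rt}))"
    using nb_irrefl[of v True] f finV unfolding P_def by (intro card_mono) auto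
  moreover have "\<dots> \<le> card (nb R True v - f ` (V - ?L)) + card (f ` (V - ?L - {rt}))" by (rule card_Un_le)
  moreover have "k \<le> card (nb R True v)" by (rule order_trans[OF v(2)]) (intro card_mono, auto)
  ultimately have "card ?L \<le> card (nb R True v - f ` (V - ?L))" by linarith
  thus ?thesis using f sg_rt unfolding P_def by (intro emb_rt_leaves) auto
qed

text \<open>\<open>core_dichotomy\<close> is used with the constant degrees
  \<open>card rest + c + 1\<close> and \<open>\<theta> = card (ch rt)\<close>; the hypothesis
  \<open>D\<close> says exactly that twice this constant is at most k + 1. One alternative gives
  room to reserve a neighbourhood, the other a vertex of degree k from which sinks are embedded in
  batches.\<close>

theorem embed_dominating_root:
  assumes W: "finite W" "R \<subseteq> W \<times> W" "(k - 1) * card W < card R" and kV: "card V = k + 1" and c: "0 < c"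
    and D: "k + 2 * c + 1 \<le> 2 * card (ch rt)"
    and big: "k + 3 * c \<le> 2 * card (ch rt) + 2 \<or>
      (\<exists>g. g \<in> V \<and> \<not> sg g \<and> 4 * c + k \<le> 2 * card (ch rt) + card (ch g))"
  shows "\<exists>f. emb V f"
proof -
  note e = card_rest[OF kV]
  have "(\<exists>A z. core R (\<lambda>_. card rest + c + 1) A \<and> z \<in> A True \<and> card (ch rt) \<le> card (nb R True z)) \<or>
    (\<exists>A v. core R (\<lambda>\<sigma>. if \<sigma> then card (ch rt) else k + 1 - card (ch rt)) A \<and> v \<in> A True \<and>
      k \<le> card (nb R True v \<inter> A False))"
    using D e by (intro core_dichotomy[OF W]) auto
  thus ?thesis
  proof (elim disjE exE conjE)
    fix A z assume "core R (\<lambda>_. card rest + c + 1) A" "z \<in> A True" "card (ch rt) \<le> card (nb R True z)"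
    thus ?thesis by (intro embed_reserved) auto
  next
    fix A v assume "core R (\<lambda>\<sigma>. if \<sigma> then card (ch rt) else k + 1 - card (ch rt)) A" "v \<in> A True"
      "k \<le> card (nb R True v \<inter> A False)"
    moreover have "card rest + 2 * c + 1 \<le> card (ch rt)" using D e by linarith
    moreover have "card rest + 3 * c \<le> card (ch rt) + 2 \<or>
      (\<exists>g. g \<in> V \<and> \<not> sg g \<and> 4 * c + card rest \<le> card (ch rt) + card (ch g))" using big
    proof
      assume "k + 3 * c \<le> 2 * card (ch rt) + 2"
      thus ?thesis using e by linarith
    next
      assume "\<exists>g. g \<in> V \<and> \<not> sg g \<and> 4 * c + k \<le> 2 * card (ch rt) + card (ch g)"
      then obtain g where "g \<in> V" "\<not> sg g" "4 * c + k \<le> 2 * card (ch rt) + card (ch g)" by blast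
      hence "4 * c + card rest \<le> card (ch rt) + card (ch g)" using e by linarith
      thus ?thesis using \<open>g \<in> V\<close> \<open>\<not> sg g\<close> by blast
    qed
    ultimately show ?thesis by (rule embed_batches[OF kV c])
  qed
qed

end

section \<open>A dominating pair\<close>

context tree_host
begin

text \<open>The set built is the path from the root to \<open>g\<close>; recorded are only that it
  contains no child of \<open>g\<close> and at most one child of the root. The invariant takes the
  current end of the path as an argument because averaging controls the conflicts of that vertex
  alone.\<close>

lemma path_grow:
  fixes P :: "'c \<Rightarrow> 'c set \<Rightarrow> ('c \<Rightarrow> 'a) \<Rightarrow> bool"
  assumes g: "g \<in> V" "g \<noteq> rt"
    and base: "\<And>x. x \<in> ch rt \<Longrightarrow> \<exists>f. P x {rt, x} f"
    and step: "\<And>x E f. closed E \<Longrightarrow> par x \<in> E \<Longrightarrow> par x \<noteq> rt \<Longrightarrow> x \<notin> E \<Longrightarrow> x \<in> rest - ch g \<Longrightarrow> E \<inter> ch g = {} \<Longrightarrow>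
      E \<subseteq> V \<Longrightarrow> card (E \<inter> ch rt) \<le> 1 \<Longrightarrow> P (par x) E f \<Longrightarrow> \<exists>w. P x (insert x E) (f(x := w))"
  obtains E f where "closed E" "g \<in> E" "E \<subseteq> insert g inner" "E \<inter> ch g = {}" "card (E \<inter> ch rt) \<le> 1" "P g E f"
proof -
  have "\<exists>E f. closed E \<and> x \<in> E \<and> E \<subseteq> insert x inner \<and> (\<forall>w\<in>E. w = rt \<or> dep w \<le> dep x) \<and> card (E \<inter> ch rt) \<le> 1 \<and> P x E f"
    if "x \<in> V" "x \<noteq> rt" "dep x \<le> dep g" for x
    using that
  proof (induction "dep x" arbitrary: x rule: less_induct)
    case less
    show ?case
    proof (cases "x \<in> ch rt")
      case True
      obtain f where "P x {rt, x} f" using base[OF True] by blast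
      moreover have "closed {rt, x}" using closed_insert[OF closed_rt less.prems(1)] chD[OF True] by (simp add: insert_commute)
      moreover have "rt \<in> inner" using ch_inner[OF True] .
      moreover have "{rt, x} \<inter> ch rt = {x}" using True ch_sub(2) by blast
      ultimately show ?thesis by (intro exI[of _ "{rt, x}"] exI[of _ f]) auto
    next
      case False
      let ?p = "par x"
      have xp: "x \<in> ch ?p" using chI less.prems by blast
      have p: "?p \<noteq> rt" "?p \<in> V" "dep ?p < dep x" "?p \<in> inner"
        using xp False parV dep_par ch_inner[OF xp] less.prems by auto
      obtain E f where E: "closed E" "?p \<in> E" "E \<subseteq> insert ?p inner" "\<forall>w\<in>E. w = rt \<or> dep w \<le> dep ?p"
        "card (E \<inter> ch rt) \<le> 1" "P ?p E f"
        using less.hyps[OF p(3,2,1)] p(3) less.prems(3) by auto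
      have xE: "x \<notin> E" using E(4) less.prems(2) p(3) by auto
      have notg: "w \<notin> ch g" if "w = rt \<or> dep w \<le> dep x" for w
        using that ch_sub(2) ch_dep[of w g] less.prems(3) by auto
      have Eg: "E \<inter> ch g = {}" using E(4) p(3) notg by force
      have xr: "x \<in> rest - ch g" using rest_par[OF less.prems(1,2) False] notg by simp
      have EV: "E \<subseteq> V" using E(1) unfolding closed_def by blast
      obtain w where w: "P x (insert x E) (f(x := w))"
        using step[OF E(1,2) p(1) xE xr Eg EV E(5,6)] by blast
      have "insert x E \<inter> ch rt = E \<inter> ch rt" using False by blast
      moreover have "closed (insert x E)" using closed_insert[OF E(1) less.prems(1) E(2)] .
      moreover have "\<forall>v\<in>insert x E. v = rt \<or> dep v \<le> dep x" using E(4) p(3) by auto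
      moreover have "insert x E \<subseteq> insert x inner" using E(3) p(4) by blast
      ultimately show ?thesis using w E(5) by (intro exI[of _ "insert x E"] exI[of _ "f(x := w)"]) auto
    qed
  qed
  from this[OF g order_refl] obtain E f where E: "closed E" "g \<in> E" "E \<subseteq> insert g inner" "\<forall>w\<in>E. w = rt \<or> dep w \<le> dep g"
    "card (E \<inter> ch rt) \<le> 1" "P g E f" by blast
  have "E \<inter> ch g = {}" using E(4) ch_sub(2) ch_dep[of _ g] by fastforce
  thus ?thesis using that E by blast
qed

lemma card_avoid:
  assumes "card ((M \<inter> N) \<union> Y) < card M" "finite M" "finite Y"
  obtains w where "w \<in> M" "w \<notin> N" "w \<notin> Y"
proof -
  have "\<not> M \<subseteq> (M \<inter> N) \<union> Y" using assms card_mono[of "(M \<inter> N) \<union> Y" M] by auto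
  thus ?thesis using that by blast
qed

text \<open>Once the children of \<open>g\<close> are embedded, they block any other neighbourhood
  in at most \<open>c\<close> vertices, and so does the neighbourhood of the root. Every further
  vertex outside \<open>ch rt\<close> therefore competes only with \<open>rest - ch g\<close>. The
  two \<open>room\<close> conditions compensate for vertices that have already strayed into the
  root's neighbourhood.\<close>

lemma embed_after_heavy:
  assumes A: "core R m A" and m: "\<And>\<sigma>. 2 * c + card (rest - ch g) + 1 \<le> m \<sigma>"
    and E1: "closed E1" "E1 \<subseteq> V - (ch rt \<inter> leaves)" and g: "g \<in> E1" "g \<noteq> rt" "ch g \<subseteq> E1"
    and f1: "emb E1 f1" "\<forall>x\<in>E1. f1 x \<in> A (sg x)" "f1 rt = z"
    and room: "card (ch rt) + card (nb R True z \<inter> f1 ` (E1 \<inter> rest)) \<le> card (nb R True z)"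
      "card (ch rt \<inter> inner) + card (nb R True z \<inter> f1 ` (E1 \<inter> rest)) \<le> card (nb R True z \<inter> A False)"
  shows "\<exists>f. emb V f"
proof -
  let ?Q = "ch rt \<inter> inner" and ?L = "ch rt \<inter> leaves" and ?N = "nb R True z"
  let ?X = "?N \<inter> f1 ` (E1 \<inter> rest)"
  have chrt: "ch rt = ?Q \<union> ?L" "?Q \<inter> ?L = {}" using V_split ch_sub by blast+
  have clF: "closed (V - ?L)" using ch_sub(2) by (intro closed_Diff_leaves) auto
  have M: "m \<sigma> \<le> card (nb R \<sigma> u \<inter> A (\<not> \<sigma>))" if "u \<in> A \<sigma>" for \<sigma> u using A that unfolding core_def by blast
  have finX: "finite ?X" by simp
  define P where "P E f \<longleftrightarrow> E1 \<subseteq> E \<and> emb E f \<and> (\<forall>x\<in>E. f x \<in> A (sg x)) \<and> (\<forall>x\<in>E1. f x = f1 x) \<and> f ` (E \<inter> rest - E1) \<inter> ?N = {}" for E f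
  have fN: "?N \<inter> f ` E \<subseteq> ?X \<union> f ` (E \<inter> ch rt)" if E: "E \<subseteq> V" "P E f" for E f
  proof
    fix w assume "w \<in> ?N \<inter> f ` E"
    then obtain x where x: "x \<in> E" "w = f x" "w \<in> ?N" by blast
    have "rt \<in> E1" using E1(1) unfolding closed_def by blast
    hence "f rt = z" using E(2) f1(3) unfolding P_def by auto
    hence "x \<noteq> rt" using x nb_irrefl[of z True] by auto
    moreover have "w \<in> ?X" if "x \<in> rest"
    proof -
      have "x \<in> E1" using x that E(2) unfolding P_def by blast
      moreover have "f x = f1 x" using calculation E(2) unfolding P_def by blast
      ultimately show ?thesis using x that by auto
    qed
    ultimately show "w \<in> ?X \<union> f ` (E \<inter> ch rt)" using x E(1) unfolding rest_def by blast
  qed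
  have "P E1 f1" unfolding P_def using f1 by auto
  hence "\<exists>f. P (V - ?L) f"
  proof (rule grow[where P = P, OF E1(1) clF E1(2)])
    fix E f y
    assume E: "closed E" "E \<subseteq> V - ?L" "P E f" and y: "y \<in> V - ?L" "y \<notin> E" "y \<noteq> rt" "par y \<in> E"
    have emb: "emb E f" and fA: "\<And>x. x \<in> E \<Longrightarrow> f x \<in> A (sg x)" and EE: "E1 \<subseteq> E" and ff: "\<And>x. x \<in> E1 \<Longrightarrow> f x = f1 x"
      and fr: "f ` (E \<inter> rest - E1) \<inter> ?N = {}" using E(3) unfolding P_def by auto
    have rtE: "rt \<in> E" "rt \<in> E1" using E(1) E1(1) unfolding closed_def by auto
    have fz: "f rt = z" using ff[OF rtE(2)] f1(3) by simp
    have finE: "finite E" and EV: "E \<subseteq> V" using E(2) finite_subset[OF _ finV] by blast+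
    have inj: "inj_on f E" using emb unfolding emb_def by blast
    have yV: "y \<in> V" using y(1) by blast
    define p where "p = par y"
    have yp: "y \<in> ch p" and pE: "p \<in> E" using chI[OF yV y(3)] y(4) unfolding p_def by auto
    have sgy: "sg y \<longleftrightarrow> \<not> sg p" using sg_ch[OF yp] .
    have EN: "?N \<inter> f ` E \<subseteq> ?X \<union> f ` (E \<inter> ch rt)" using fN[OF EV E(3)] .
    have "\<exists>w. w \<in> nb R (sg p) (f p) \<and> w \<in> A (sg y) \<and> w \<notin> f ` E \<and> (y \<in> rest \<longrightarrow> w \<notin> ?N)"
    proof (cases "p = rt")
      case True
      have yQ: "y \<in> ?Q" using yp y(1) chrt True by blast
      hence yr: "y \<notin> rest" unfolding rest_def by blast
      have "card (f ` (E \<inter> ch rt)) \<le> card (E \<inter> ch rt)" using finE by (intro card_image_le) auto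
      also have "\<dots> \<le> card (?Q - {y})" using E(2) chrt y(2) by (intro card_mono) auto
      also have "\<dots> < card ?Q" using yQ by (intro psubset_card_mono) auto
      finally have "card (?X \<union> f ` (E \<inter> ch rt)) < card (?N \<inter> A False)"
        using room(2) card_Un_le[of ?X "f ` (E \<inter> ch rt)"] by linarith
      hence "\<not> ?N \<inter> A False \<subseteq> ?X \<union> f ` (E \<inter> ch rt)"
        using card_mono[of "?X \<union> f ` (E \<inter> ch rt)" "?N \<inter> A False"] finE by auto
      then obtain w where "w \<in> ?N" "w \<in> A False" "w \<notin> ?X \<union> f ` (E \<inter> ch rt)" by blast
      thus ?thesis using EN True fz sg_rt sgy yr by auto
    next
      case False
      have pg: "p \<noteq> g" using g(3) EE y(2) yp by blast
      have yr: "y \<in> rest - ch g" using yp False pg ch_rest[of p] pE EV ch_disjoint[of p g] by blast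
      have ne: "f p \<noteq> z" "f p \<noteq> f g" using False pg pE rtE(1) g(1) EE inj fz unfolding inj_on_def by blast+
      let ?M = "nb R (sg p) (f p) \<inter> A (\<not> sg p)"
      let ?Y = "insert z ((?M \<inter> f ` ch g) \<union> f ` (E \<inter> rest - ch g))"
      have cM: "2 * c + card (rest - ch g) + 1 \<le> card ?M" using M[OF fA[OF pE]] m[of "sg p"] by linarith
      have "f ` ch g \<subseteq> nb R (sg g) (f g)" using g(3) EE by (intro emb_ch[OF emb E(1)]) auto
      hence k1: "card (?M \<inter> f ` ch g) \<le> c" using ne(2) by (intro common_sub[of "f p" "f g" _ "sg p" _ "sg g"]) auto
      have k2: "card (?M \<inter> ?N) \<le> c" using ne(1) by (intro common_sub[of "f p" z _ "sg p" _ True]) auto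
      have "card (f ` (E \<inter> rest - ch g)) \<le> card (E \<inter> rest - ch g)" by (intro card_image_le) auto
      also have "\<dots> < card (rest - ch g)" using yr y(2) by (intro psubset_card_mono) auto
      finally have k3: "card (f ` (E \<inter> rest - ch g)) < card (rest - ch g)" .
      have "card ?Y \<le> 1 + card ((?M \<inter> f ` ch g) \<union> f ` (E \<inter> rest - ch g))"
        by (simp add: card_insert_if)
      also have "\<dots> \<le> 1 + (card (?M \<inter> f ` ch g) + card (f ` (E \<inter> rest - ch g)))" by (intro add_left_mono card_Un_le)
      finally have "card ?Y \<le> c + card (rest - ch g)" using k1 k3 by linarith
      hence "card ((?M \<inter> ?N) \<union> ?Y) < card ?M" using card_Un_le[of "?M \<inter> ?N" ?Y] k2 cM by linarith
      then obtain w where w: "w \<in> ?M" "w \<notin> ?N" "w \<notin> ?Y" by (rule card_avoid) auto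
      have "w \<notin> f ` E"
      proof
        assume "w \<in> f ` E"
        then obtain x where x: "x \<in> E" "w = f x" by blast
        have "x \<noteq> rt" "x \<notin> ch g" "x \<notin> E \<inter> rest - ch g" using w x fz by auto
        hence "x \<in> ch rt" using x EV unfolding rest_def by blast
        hence "f x \<in> nb R (sg rt) (f rt)" using emb_ch[OF emb E(1), of "{x}" rt] x by simp
        thus False using x w(2) fz sg_rt by simp
      qed
      thus ?thesis using w sgy by auto
    qed
    then obtain w where w: "w \<in> nb R (sg p) (f p)" "w \<in> A (sg y)" "w \<notin> f ` E" "y \<in> rest \<Longrightarrow> w \<notin> ?N" by blast
    have "emb (insert y E) (f(y := w))"
      using emb_extend[OF E(1) emb yV y(3,2,4)] w(1,3) unfolding p_def by blast
    moreover have "f(y := w) ` (insert y E \<inter> rest - E1) \<subseteq> f ` (E \<inter> rest - E1) \<union> (if y \<in> rest then {w} else {})" by auto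
    ultimately have "P (insert y E) (f(y := w))" unfolding P_def using EE fA y(2) ff w(2,4) fr by (auto split: if_splits)
    moreover have "closed (insert y E)" using closed_insert[OF E(1) yV y(4)] .
    ultimately show "\<exists>E' f'. closed E' \<and> insert y E \<subseteq> E' \<and> E' \<subseteq> V - ?L \<and> P E' f'"
      using y(1) E(2) by (intro exI[of _ "insert y E"] exI[of _ "f(y := w)"]) auto
  qed
  then obtain f where f: "P (V - ?L) f" ..
  have rtE: "rt \<in> E1" using E1(1) unfolding closed_def by blast
  have fz: "f rt = z" using f f1(3) rtE unfolding P_def by auto
  have "?N \<inter> f ` (V - ?L) \<subseteq> ?X \<union> f ` ((V - ?L) \<inter> ch rt)" by (rule fN[OF _ f]) auto
  hence "?N \<subseteq> (?N - f ` (V - ?L)) \<union> (?X \<union> f ` ((V - ?L) \<inter> ch rt))" by blast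
  hence "card ?N \<le> card ((?N - f ` (V - ?L)) \<union> (?X \<union> f ` ((V - ?L) \<inter> ch rt)))" by (intro card_mono) auto
  also have "\<dots> \<le> card (?N - f ` (V - ?L)) + (card ?X + card (f ` ((V - ?L) \<inter> ch rt)))"
    by (meson add_le_mono card_Un_le order_refl order_trans)
  also have "card (f ` ((V - ?L) \<inter> ch rt)) \<le> card ?Q"
  proof -
    have "(V - ?L) \<inter> ch rt \<subseteq> ?Q" using chrt by blast
    hence "card ((V - ?L) \<inter> ch rt) \<le> card ?Q" by (intro card_mono) auto
    thus ?thesis using card_image_le[of "(V - ?L) \<inter> ch rt" f] by simp
  qed
  finally have "card ?N \<le> card (?N - f ` (V - ?L)) + (card ?X + card ?Q)" by simp
  moreover have "card (ch rt) = card ?Q + card ?L" using chrt card_Un_disjoint[of ?Q ?L] by simp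
  ultimately have "card ?L \<le> card (?N - f ` (V - ?L))" using room(1) by linarith
  thus ?thesis using f fz sg_rt unfolding P_def by (intro emb_rt_leaves) auto
qed

lemma emb_first:
  assumes "core R m A" "1 \<le> m True" "z \<in> A True" "x \<in> ch rt"
  obtains f where "emb {rt, x} f" "\<forall>y\<in>{rt, x}. f y \<in> A (sg y)" "f rt = z"
proof -
  have "m True \<le> card (nb R True z \<inter> A (\<not> True))" using assms(1,3) unfolding core_def by blast
  hence "1 \<le> card (nb R True z \<inter> A (\<not> True))" using assms(2) by linarith
  then obtain w where w: "w \<in> nb R True z" "w \<in> A False" by (metis IntE One_nat_def card.empty equals0I not_one_le_zero)
  have "w \<noteq> z" using w(1) nb_irrefl by auto
  hence "emb (insert x {rt}) ((\<lambda>_. z)(x := w))"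
    using w(1) chD[OF assms(4)] sg_rt by (intro emb_extend[OF closed_rt emb_rt]) auto
  moreover have "x \<noteq> rt" "\<not> sg x" using chD[OF assms(4)] sg_ch[OF assms(4)] sg_rt by auto
  ultimately show ?thesis using that[of "(\<lambda>_. z)(x := w)"] assms(3) w(2) sg_rt by (simp add: insert_commute)
qed

text \<open>The vertices outside the neighbourhood of the root avoid it. Along the path from the root to the
  heavy sink, averaging ensures that at most half of the vertices embedded so far are adjacent to the current end.\<close>

lemma embed_pair_reserved:
  assumes c: "0 < c" and A: "core R m A" and z: "z \<in> A True" "card (ch rt) \<le> card (nb R True z)"
    and g: "g \<in> inner" "\<not> sg g"
    and m: "\<And>\<sigma>. 2 * c + card (rest - ch g) + 1 \<le> m \<sigma>" "\<And>\<sigma>. 6 * c + 1 + card (rest - ch g) \<le> 2 * m \<sigma>"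
      "card (ch g) + c + 1 + card (rest - ch g) div 2 \<le> m False"
  shows "\<exists>f. emb V f"
proof -
  let ?N = "nb R True z" and ?t = "card (rest - ch g)"
  have gV: "g \<in> V" "g \<noteq> rt" using g inner_sub sg_rt by auto
  have M: "m \<sigma> \<le> card (nb R \<sigma> u \<inter> A (\<not> \<sigma>))" if "u \<in> A \<sigma>" for \<sigma> u using A that unfolding core_def by blast
  define conf where "conf x E f = card (nb R (sg x) (f x) \<inter> f ` (E \<inter> rest))" for x E and f :: "'c \<Rightarrow> 'a"
  define P where "P x E f \<longleftrightarrow> emb E f \<and> (\<forall>y\<in>E. f y \<in> A (sg y)) \<and> f rt = z \<and> f ` (E \<inter> rest) \<inter> ?N = {} \<and>
    2 * conf x E f \<le> card (E \<inter> rest)" for x E f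
  have avoid: "m (sg p) \<le> card (nb R (sg p) (f p) \<inter> A (\<not> sg p) - ?N - {z} - f ` (E \<inter> rest)) + c + 1 + conf p E f"
    if E: "emb E f" "\<forall>y\<in>E. f y \<in> A (sg y)" "f rt = z" "p \<in> E" "p \<noteq> rt" "rt \<in> E" for p E f
  proof -
    let ?M = "nb R (sg p) (f p) \<inter> A (\<not> sg p)"
    have "f p \<noteq> z" using E unfolding emb_def inj_on_def by blast
    hence k: "card (?M \<inter> ?N) \<le> c" by (intro common_sub[of "f p" z _ "sg p" _ True]) auto
    have "m (sg p) \<le> card ?M" using M E(2,4) by blast
    also have "\<dots> \<le> card ((?M - ?N - {z} - f ` (E \<inter> rest)) \<union> (?M \<inter> ?N) \<union> {z} \<union> (nb R (sg p) (f p) \<inter> f ` (E \<inter> rest)))"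
      by (intro card_mono) auto
    also have "\<dots> \<le> card (?M - ?N - {z} - f ` (E \<inter> rest)) + card (?M \<inter> ?N) + card {z} + conf p E f"
      unfolding conf_def by (meson add_le_mono card_Un_le order_refl order_trans)
    finally show ?thesis using k by simp
  qed
  have notin: "w \<notin> f ` E" if "w \<notin> ?N" "w \<noteq> z" "w \<notin> f ` (E \<inter> rest)" "emb E f" "closed E" "f rt = z" for w E f
  proof
    assume "w \<in> f ` E"
    then obtain x where x: "x \<in> E" "w = f x" by blast
    have "x \<noteq> rt" "x \<notin> rest" using that x by auto
    hence "x \<in> ch rt" using x that(5) unfolding rest_def closed_def by blast
    hence "f x \<in> nb R (sg rt) (f rt)" using emb_ch[OF that(4,5), of "{x}" rt] x by simp
    thus False using x that(1,6) sg_rt by simp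
  qed
  have base: "\<exists>f. P x {rt, x} f" if x: "x \<in> ch rt" for x
  proof -
    have "1 \<le> m True" using m(1)[of True] by simp
    then obtain f where "emb {rt, x} f" "\<forall>y\<in>{rt, x}. f y \<in> A (sg y)" "f rt = z" using emb_first[OF A _ z(1) x] by blast
    moreover have "{rt, x} \<inter> rest = {}" using x unfolding rest_def by blast
    ultimately have "P x {rt, x} f" unfolding P_def conf_def by auto
    thus ?thesis by blast
  qed
  have step: "\<exists>w. P x (insert x E) (f(x := w))"
    if E: "closed E" "par x \<in> E" "par x \<noteq> rt" "x \<notin> E" "x \<in> rest - ch g" "E \<inter> ch g = {}" "E \<subseteq> V" "P (par x) E f" for x E f
  proof -
    let ?p = "par x" let ?Z = "nb R (sg ?p) (f ?p) \<inter> A (\<not> sg ?p) - ?N - {z} - f ` (E \<inter> rest)"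
    let ?W = "f ` (E \<inter> rest) - {f ?p}"
    have fE: "emb E f" "\<forall>y\<in>E. f y \<in> A (sg y)" "f rt = z" "f ` (E \<inter> rest) \<inter> ?N = {}" "2 * conf ?p E f \<le> card (E \<inter> rest)"
      using E(8) unfolding P_def by auto
    have rtE: "rt \<in> E" using E(1) unfolding closed_def by blast
    have inj: "inj_on f E" using fE(1) unfolding emb_def by blast
    have xV: "x \<in> V" "x \<noteq> rt" using E(5) unfolding rest_def by auto
    have sgx: "sg x \<longleftrightarrow> \<not> sg ?p" using sg_par[OF xV] .
    have "card (E \<inter> rest) < ?t" using E(4-6) by (intro psubset_card_mono) auto
    hence Z: "2 * c \<le> card ?Z" using avoid[OF fE(1-3) E(2,3) rtE] fE(5) m(2)[of "sg ?p"] by linarith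
    have "\<exists>w\<in>?Z. card (nb R (\<not> sg ?p) w \<inter> ?W) < card ?W div 2 + 1"
      using Z c by (intro averaging[of _ "sg ?p" "f ?p"]) auto
    then obtain w where wZ: "w \<in> ?Z" "card (nb R (\<not> sg ?p) w \<inter> ?W) < card ?W div 2 + 1" ..
    have "card (nb R (sg x) w \<inter> ?W) \<le> card ?W div 2" unfolding sgx using wZ(2) by linarith
    note w = wZ(1) this
    have wE: "w \<notin> f ` E" using notin[OF _ _ _ fE(1) E(1) fE(3), of w] w(1) by blast
    let ?f = "f(x := w)"
    have im: "?f ` (insert x E \<inter> rest) = insert w (f ` (E \<inter> rest))" using E(4,5) by auto
    have crd: "card (insert x E \<inter> rest) = card (E \<inter> rest) + 1" using E(4,5) by simp
    \<comment> \<open>The parent's image is always adjacent to \<open>w\<close>, so it is left out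
      of the averaging and counted separately. With n vertices of \<open>rest\<close> embedded this
      gives 1 + (n - 1) div 2, still at most half of n + 1.\<close>
    have "2 * conf x (insert x E) ?f \<le> card (E \<inter> rest) + 1"
    proof (cases "?p \<in> rest")
      case True
      have "nb R (sg x) w \<inter> insert w (f ` (E \<inter> rest)) \<subseteq> insert (f ?p) (nb R (sg x) w \<inter> ?W)"
        using nb_irrefl[of w "sg x"] by blast
      hence "conf x (insert x E) ?f \<le> card (insert (f ?p) (nb R (sg x) w \<inter> ?W))"
        unfolding conf_def im by (intro card_mono) auto
      also have "\<dots> \<le> 1 + card ?W div 2" using w(2) by (simp add: card_insert_if)
      finally have k: "conf x (insert x E) ?f \<le> 1 + card ?W div 2" .
      have "card (f ` (E \<inter> rest)) = card (E \<inter> rest)" using inj by (intro card_image) (auto intro: inj_on_subset)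
      moreover have "f ?p \<in> f ` (E \<inter> rest)" using True E(2) by blast
      ultimately have "card ?W + 1 = card (E \<inter> rest)" by (metis Suc_eq_plus1 card_Suc_Diff1 fin_rest finite_Int finite_imageI)
      thus ?thesis using k by linarith
    next
      case False
      have "f ?p \<notin> f ` (E \<inter> rest)" using False inj E(2) unfolding inj_on_def by blast
      hence "nb R (sg x) w \<inter> insert w (f ` (E \<inter> rest)) \<subseteq> nb R (sg x) w \<inter> ?W" using nb_irrefl[of w "sg x"] by blast
      hence "conf x (insert x E) ?f \<le> card (nb R (sg x) w \<inter> ?W)"
        unfolding conf_def im by (simp add: card_mono)
      moreover have "card ?W \<le> card (f ` (E \<inter> rest))" by (intro card_mono) auto
      moreover have "card (f ` (E \<inter> rest)) \<le> card (E \<inter> rest)" by (intro card_image_le) auto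
      ultimately show ?thesis using w(2) by linarith
    qed
    moreover have "emb (insert x E) ?f" using emb_extend[OF E(1) fE(1) xV E(4,2)] w(1) wE by blast
    ultimately have "P x (insert x E) ?f" unfolding P_def im crd using fE(2-4) w(1) E(4) xV(2) sgx by auto
    thus ?thesis by blast
  qed
  obtain E f where E: "closed E" "g \<in> E" "E \<subseteq> insert g inner" "E \<inter> ch g = {}" "P g E f"
  proof (rule path_grow[of g P])
    show "\<exists>f. P x {rt, x} f" if "x \<in> ch rt" for x using base[OF that] .
    show "\<exists>w. P x (insert x E) (f(x := w))"
      if "closed E" "par x \<in> E" "par x \<noteq> rt" "x \<notin> E" "x \<in> rest - ch g" "E \<inter> ch g = {}" "E \<subseteq> V"
        "card (E \<inter> ch rt) \<le> 1" "P (par x) E f" for x E f using step[OF that(1-7,9)] .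
  qed (use gV that in auto)
  have fE: "emb E f" "\<forall>y\<in>E. f y \<in> A (sg y)" "f rt = z" "f ` (E \<inter> rest) \<inter> ?N = {}" "2 * conf g E f \<le> card (E \<inter> rest)"
    using E(5) unfolding P_def by auto
  have rtE: "rt \<in> E" and EV: "E \<subseteq> V" using E(1) unfolding closed_def by auto
  let ?B = "nb R (sg g) (f g) \<inter> A (\<not> sg g) - ?N - {z} - f ` (E \<inter> rest)"
  have "card (E \<inter> rest) \<le> ?t" using E(4) by (intro card_mono) auto
  hence "conf g E f \<le> ?t div 2" using fE(5) by linarith
  hence B: "card (ch g) \<le> card ?B" using avoid[OF fE(1-3) E(2) gV(2) rtE] m(3) g(2) by simp
  have Bf: "?B \<inter> f ` E = {}" using notin[OF _ _ _ fE(1) E(1) fE(3)] by blast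
  obtain f1 where f1: "emb (E \<union> ch g) f1" "\<And>y. y \<in> E \<Longrightarrow> f1 y = f y" "f1 ` ch g \<subseteq> ?B"
    by (rule emb_extend_set[OF E(1) fE(1) E(2), of "ch g" ?B]) (use B Bf E(4) in auto)
  have X: "?N \<inter> f1 ` ((E \<union> ch g) \<inter> rest) = {}"
  proof -
    have "f1 ` (E \<inter> rest) = f ` (E \<inter> rest)" using f1(2) by (intro image_cong) auto
    thus ?thesis using fE(4) f1(3) by blast
  qed
  \<comment> \<open>Inner children of the root other than \<open>g\<close> have children in
    \<open>rest - ch g\<close>; the extra 1 covers the case that \<open>g\<close> is itself a child
    of the root.\<close>
  have Q: "card (ch rt \<inter> inner) \<le> ?t + 1"
  proof -
    have "card (ch rt \<inter> inner - {g}) \<le> ?t"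
    proof (rule card_root_inner)
      fix q assume q: "q \<in> ch rt \<inter> inner - {g}"
      hence "ch q \<subseteq> rest" using ch_sub ch_rest[of q] by blast
      thus "ch q \<subseteq> rest - ch g" using ch_disjoint[of q g] q by blast
    qed auto
    moreover have "card (ch rt \<inter> inner) \<le> card (insert g (ch rt \<inter> inner - {g}))" by (intro card_mono) auto
    ultimately show ?thesis by (simp add: card_insert_if split: if_splits)
  qed
  show ?thesis
  proof (rule embed_after_heavy[OF A m(1), of "E \<union> ch g" f1 z])
    show "closed (E \<union> ch g)" using closed_Un_ch[OF E(1,2)] by simp
    show "E \<union> ch g \<subseteq> V - (ch rt \<inter> leaves)"
      using EV E(3) g(1) ch_sub V_split ch_disjoint[OF gV(2)] by blast
    show "\<forall>x\<in>E \<union> ch g. f1 x \<in> A (sg x)"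
    proof
      fix x assume "x \<in> E \<union> ch g"
      thus "f1 x \<in> A (sg x)"
      proof
        assume "x \<in> ch g"
        thus ?thesis using f1(3) sg_ch[of x g] by auto
      qed (use f1(2) fE(2) in auto)
    qed
    show "f1 rt = z" using f1(2)[OF rtE] fE(3) by simp
    show "card (ch rt) + card (?N \<inter> f1 ` ((E \<union> ch g) \<inter> rest)) \<le> card ?N" unfolding X using z(2) by simp
    show "card (ch rt \<inter> inner) + card (?N \<inter> f1 ` ((E \<union> ch g) \<inter> rest)) \<le> card (?N \<inter> A False)"
      unfolding X using Q m(1)[of True] M[OF z(1)] by simp
  qed (use E(2) gV f1(1) in auto)
qed

text \<open>With k neighbours in \<open>A False\<close> the root can spare any vertices taken from
  its neighbourhood by \<open>rest\<close>. At most \<open>card (rest - ch g) + 1\<close> vertices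
  precede the children of \<open>g\<close> besides \<open>g\<close> itself, so the degree
  \<open>card rest + 1\<close> leaves room for all of them.\<close>

lemma embed_pair_large:
  assumes c: "0 < c" and kV: "card V = k + 1" and A: "core R m A" and v: "v \<in> A True" "k \<le> card (nb R True v \<inter> A False)"
    and g: "g \<in> inner" "\<not> sg g"
    and m: "\<And>\<sigma>. 2 * c + card (rest - ch g) + 1 \<le> m \<sigma>" "card rest + 1 \<le> m False"
  shows "\<exists>f. emb V f"
proof -
  let ?N = "nb R True v" and ?t = "card (rest - ch g)"
  have gV: "g \<in> V" "g \<noteq> rt" using g inner_sub sg_rt by auto
  have M: "m \<sigma> \<le> card (nb R \<sigma> u \<inter> A (\<not> \<sigma>))" if "u \<in> A \<sigma>" for \<sigma> u using A that unfolding core_def by blast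
  have et: "card rest = ?t + card (ch g)"
    using ch_rest[OF gV] card_Diff_subset[of "ch g" rest] card_mono[of rest "ch g"] by simp
  define P where "P x E f \<longleftrightarrow> emb E f \<and> (\<forall>y\<in>E. f y \<in> A (sg y)) \<and> f rt = v" for x :: 'c and E f
  have cE: "card (E - {x}) \<le> ?t + (if x \<in> E then 1 else 2)"
    if "E \<subseteq> V" "E \<inter> ch g = {}" "card (E \<inter> ch rt) \<le> 1" "x \<noteq> rt" for E x
  proof -
    have fin: "finite E" using finite_subset[OF that(1) finV] .
    have "card E \<le> card ({rt} \<union> (E \<inter> ch rt) \<union> (rest - ch g))"
      using that(1,2) fin finV unfolding rest_def by (intro card_mono) auto
    also have "\<dots> \<le> card {rt} + card (E \<inter> ch rt) + ?t" by (meson add_le_mono card_Un_le order_refl order_trans)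
    finally have "card E \<le> ?t + 2" using that(3) by simp
    thus ?thesis using fin by (auto simp: card_Diff_singleton_if)
  qed
  have base: "\<exists>f. P x {rt, x} f" if x: "x \<in> ch rt" for x
  proof -
    have "1 \<le> m True" using m(1)[of True] by simp
    then obtain f where "emb {rt, x} f" "\<forall>y\<in>{rt, x}. f y \<in> A (sg y)" "f rt = v" using emb_first[OF A _ v(1) x] by blast
    thus ?thesis unfolding P_def by blast
  qed
  have step: "\<exists>w. P x (insert x E) (f(x := w))"
    if E: "closed E" "par x \<in> E" "par x \<noteq> rt" "x \<notin> E" "x \<in> rest - ch g" "E \<inter> ch g = {}" "E \<subseteq> V"
      "card (E \<inter> ch rt) \<le> 1" "P (par x) E f" for x E f
  proof -
    let ?p = "par x" let ?M = "nb R (sg ?p) (f ?p) \<inter> A (\<not> sg ?p)"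
    have fE: "emb E f" "\<forall>y\<in>E. f y \<in> A (sg y)" "f rt = v" using E(9) unfolding P_def by auto
    have fin: "finite E" using finite_subset[OF E(7) finV] .
    have xV: "x \<in> V" "x \<noteq> rt" using E(5) unfolding rest_def by auto
    have "card (f ` (E - {?p})) \<le> card (E - {?p})" using fin by (intro card_image_le) auto
    also have "\<dots> \<le> ?t + 1" using cE[OF E(7,6,8,3)] E(2) by simp
    also have "?t + 1 < m (sg ?p)" using m(1)[of "sg ?p"] c by simp
    finally have "card (f ` (E - {?p})) < m (sg ?p)" .
    hence "card (f ` (E - {?p})) < card ?M" using M[of "f ?p" "sg ?p"] fE(2) E(2) by simp
    hence "\<not> ?M \<subseteq> f ` (E - {?p})" using card_mono[of "f ` (E - {?p})" ?M] fin by auto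
    then obtain w where w: "w \<in> ?M" "w \<notin> f ` (E - {?p})" by blast
    have wE: "w \<notin> f ` E" using w nb_irrefl[of "f ?p" "sg ?p"] by auto
    have "emb (insert x E) (f(x := w))" using emb_extend[OF E(1) fE(1) xV E(4,2)] w(1) wE by blast
    hence "P x (insert x E) (f(x := w))" unfolding P_def using fE(2,3) w(1) E(4) xV(2) sg_par[OF xV] by auto
    thus ?thesis by blast
  qed
  obtain E f where E: "closed E" "g \<in> E" "E \<subseteq> insert g inner" "E \<inter> ch g = {}" "card (E \<inter> ch rt) \<le> 1" "P g E f"
  proof (rule path_grow[of g P])
    show "\<exists>f. P x {rt, x} f" if "x \<in> ch rt" for x using base[OF that] .
    show "\<exists>w. P x (insert x E) (f(x := w))"
      if "closed E" "par x \<in> E" "par x \<noteq> rt" "x \<notin> E" "x \<in> rest - ch g" "E \<inter> ch g = {}" "E \<subseteq> V"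
        "card (E \<inter> ch rt) \<le> 1" "P (par x) E f" for x E f using step[OF that] .
  qed (use gV that in auto)
  have fE: "emb E f" "\<forall>y\<in>E. f y \<in> A (sg y)" "f rt = v" using E(6) unfolding P_def by auto
  have rtE: "rt \<in> E" and EV: "E \<subseteq> V" using E(1) unfolding closed_def by auto
  have fin: "finite E" using finite_subset[OF EV finV] .
  let ?M = "nb R (sg g) (f g) \<inter> A (\<not> sg g)"
  have "card (f ` (E - {g})) \<le> card (E - {g})" using fin by (intro card_image_le) auto
  hence c1: "card (f ` (E - {g})) \<le> ?t + 1" using cE[OF EV E(4,5) gV(2)] E(2) by simp
  have "card ?M \<le> card ((?M - f ` E) \<union> f ` (E - {g}))"
    using nb_irrefl[of "f g" "sg g"] fin by (intro card_mono) auto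
  also have "\<dots> \<le> card (?M - f ` E) + card (f ` (E - {g}))" by (rule card_Un_le)
  finally have B: "card (ch g) \<le> card (?M - f ` E)" using c1 m(2) M[of "f g" False] fE(2) E(2) g(2) et by auto
  obtain f1 where f1: "emb (E \<union> ch g) f1" "\<And>y. y \<in> E \<Longrightarrow> f1 y = f y" "f1 ` ch g \<subseteq> ?M - f ` E"
    by (rule emb_extend_set[OF E(1) fE(1) E(2), of "ch g" "?M - f ` E"]) (use B E(4) in auto)
  have "card (?N \<inter> f1 ` ((E \<union> ch g) \<inter> rest)) \<le> card (f1 ` ((E \<union> ch g) \<inter> rest))" by (intro card_mono) auto
  also have "\<dots> \<le> card ((E \<union> ch g) \<inter> rest)" by (intro card_image_le) auto
  also have "\<dots> \<le> card rest" by (intro card_mono) auto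
  finally have X: "card (ch rt) + card (?N \<inter> f1 ` ((E \<union> ch g) \<inter> rest)) \<le> k" using card_rest[OF kV] by linarith
  show ?thesis
  proof (rule embed_after_heavy[OF A m(1), of "E \<union> ch g" f1 v])
    show "closed (E \<union> ch g)" using closed_Un_ch[OF E(1,2)] by simp
    show "E \<union> ch g \<subseteq> V - (ch rt \<inter> leaves)"
      using EV E(3) g(1) ch_sub V_split ch_disjoint[OF gV(2)] by blast
    show "\<forall>x\<in>E \<union> ch g. f1 x \<in> A (sg x)"
    proof
      fix x assume "x \<in> E \<union> ch g"
      thus "f1 x \<in> A (sg x)"
      proof
        assume "x \<in> ch g"
        thus ?thesis using f1(3) sg_ch[of x g] by auto
      qed (use f1(2) fE(2) in auto)
    qed
    show "f1 rt = v" using f1(2)[OF rtE] fE(3) by simp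
    have "card (?N \<inter> A False) \<le> card ?N" by (intro card_mono) auto
    thus "card (ch rt) + card (?N \<inter> f1 ` ((E \<union> ch g) \<inter> rest)) \<le> card ?N" using X v(2) by linarith
    have "card (ch rt \<inter> inner) \<le> card (ch rt)" by (intro card_mono) auto
    thus "card (ch rt \<inter> inner) + card (?N \<inter> f1 ` ((E \<union> ch g) \<inter> rest)) \<le> card (?N \<inter> A False)"
      using X v(2) by linarith
  qed (use E(2) gV f1(1) in auto)
qed

text \<open>Only t \<le> 3c vertices lie outside the root and the children of the root and of
  \<open>g\<close>. The children of \<open>g\<close> are the hardest to place after those of the
  root, so the sink degree is made just large enough for them and the source degree receives the
  rest of k + 1.\<close>

theorem embed_dominating_pair:
  assumes W: "finite W" "R \<subseteq> W \<times> W" "(k - 1) * card W < card R" and kV: "card V = k + 1"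
    and c: "0 < c" "12 * c < k"
    and g: "g \<in> V" "\<not> sg g" "card (ch g) + 1 \<le> card (ch rt)" "2 * c + 1 \<le> card (ch g)"
    and t: "k \<le> card (ch rt) + card (ch g) + 3 * c"
  shows "\<exists>f. emb V f"
proof -
  define t where "t = card (rest - ch g)"
  define D where "D = card (ch rt)"
  define d where "d = card (ch g)"
  have gr: "g \<noteq> rt" "g \<in> inner" using g sg_rt unfolding inner_def by auto
  have k: "D + d + t = k"
    using card_rest[OF kV] ch_rest[OF g(1) gr(1)] card_Diff_subset[of "ch g" rest] card_mono[of rest "ch g"]
    unfolding D_def d_def t_def by simp
  have n: "t \<le> 3 * c" "d + 1 \<le> D" "2 * c + 1 \<le> d" using t g(3,4) k unfolding D_def d_def by auto
  \<comment> \<open>The two lower bounds on sink degrees: the first for the vertices embedded after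
    the children of \<open>g\<close>, the second for those children themselves when up to half of
    the t other vertices, the image of the root and \<open>c\<close> reserved vertices are
    blocked.\<close>
  define mn where "mn = max (2 * c + t + 1) (d + c + 1 + t div 2)"
  define mp where "mp = k + 1 - mn"
  define m where "m \<sigma> = (if \<sigma> then mp else mn)" for \<sigma> :: bool
  have mn: "2 * c + t + 1 \<le> mn" "d + c + 1 + t div 2 \<le> mn" "mn = 2 * c + t + 1 \<or> mn = d + c + 1 + t div 2"
    unfolding mn_def by auto
  have mp: "mp + mn = k + 1" "2 * c + t + 1 \<le> mp" "6 * c + 1 + t \<le> 2 * mp"
  proof -
    \<comment> \<open>The tight case is the second value of \<open>mn\<close>: it asks for
      \<open>3 * c + 1 + t div 2 \<le> D\<close>. Since D \<ge> d + 1 and D + d + t = k, this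
      amounts for t = 3c to k > 12c.\<close>
    have "mn + (2 * c + t + 1) \<le> k + 1 \<and> 2 * mn + 6 * c + 1 + t \<le> 2 * k + 2" using mn(3)
    proof
      assume "mn = 2 * c + t + 1"
      thus ?thesis using n k c(2) by linarith
    next
      assume "mn = d + c + 1 + t div 2"
      moreover have "2 * (t div 2) \<le> t" by simp
      ultimately show ?thesis using n k c(2) by linarith
    qed
    thus "mp + mn = k + 1" "2 * c + t + 1 \<le> mp" "6 * c + 1 + t \<le> 2 * mp" unfolding mp_def by auto
  qed
  have reserved: "\<exists>f. emb V f" if "core R m A" "z \<in> A True" "D \<le> card (nb R True z)" for A z
  proof (rule embed_pair_reserved[OF c(1) that(1,2) _ gr(2) g(2)])
    show "card (ch rt) \<le> card (nb R True z)" using that(3) unfolding D_def .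
    show "2 * c + card (rest - ch g) + 1 \<le> m \<sigma>" for \<sigma> using mn(1) mp(2) unfolding m_def t_def by simp
    have "6 * c + 1 + t \<le> 2 * mn" using mn(2) n(3) by linarith
    thus "6 * c + 1 + card (rest - ch g) \<le> 2 * m \<sigma>" for \<sigma> using mp(3) unfolding m_def t_def by simp
    show "card (ch g) + c + 1 + card (rest - ch g) div 2 \<le> m False" using mn(2) unfolding m_def t_def d_def by simp
  qed
  \<comment> \<open>The threshold must be at least \<open>m True\<close> for the dichotomy and at
    least \<open>D\<close> for the reservation. If it equals \<open>mp\<close>, both alternatives
    have degrees \<open>m\<close>; if it equals \<open>D\<close>, the second core has in-degrees of
    at least k + 1 - D, which is \<open>card rest + 1\<close>.\<close>
  have "(\<exists>A z. core R m A \<and> z \<in> A True \<and> max D mp \<le> card (nb R True z)) \<or>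
    (\<exists>A v. core R (\<lambda>\<sigma>. if \<sigma> then max D mp else k + 1 - max D mp) A \<and> v \<in> A True \<and> k \<le> card (nb R True v \<inter> A False))"
    using mp mn(1) k c(1) by (intro core_dichotomy[OF W]) (auto simp: m_def)
  thus ?thesis
  proof (elim disjE exE conjE)
    fix A z assume "core R m A" "z \<in> A True" "max D mp \<le> card (nb R True z)"
    thus ?thesis using reserved by simp
  next
    fix A v assume A: "core R (\<lambda>\<sigma>. if \<sigma> then max D mp else k + 1 - max D mp) A" "v \<in> A True"
      "k \<le> card (nb R True v \<inter> A False)"
    show ?thesis
    proof (cases "D \<le> mp")
      case True
      have "(\<lambda>\<sigma>. if \<sigma> then max D mp else k + 1 - max D mp) = m" using True mp(1) unfolding m_def by (auto simp: fun_eq_iff max_def)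
      moreover have "card (nb R True v \<inter> A False) \<le> card (nb R True v)" by (intro card_mono) auto
      ultimately show ?thesis using A reserved[of A v] k by simp
    next
      case False
      hence "max D mp = D" by simp
      note A = A[unfolded this]
      have et: "card rest = d + t" using card_rest[OF kV] k unfolding D_def by linarith
      have kD: "k + 1 - D = d + t + 1" using k by simp
      have "2 * c + t + 1 \<le> D" using False mp(2) by linarith
      hence "2 * c + card (rest - ch g) + 1 \<le> (if \<sigma> then D else k + 1 - D)" for \<sigma>
        unfolding kD t_def[symmetric] using n(3) by auto
      moreover have "card rest + 1 \<le> (if False then D else k + 1 - D)" unfolding kD et by simp
      ultimately show ?thesis by (rule embed_pair_large[OF c(1) kV A gr(2) g(2)])
    qed
  qed
qed

end

section \<open>Choice between the methods\<close>

context tree_host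
begin

text \<open>The hypotheses fit together without a gap. If the balanced method fails because
  \<open>D\<close> is large, the failure itself gives one of the two alternatives for a dominating
  root; if it fails because \<open>D + b\<close> is large, the size of \<open>b\<close> decides
  between a dominating pair and a dominating root. A tree without inner sinks is a star.\<close>

theorem embed_tree:
  assumes W: "finite W" "R \<subseteq> W \<times> W" "(k - 1) * card W < card R" and kV: "card V = k + 1"
    and c: "1 \<le> c" "12 * c < k" "k \<le> 12 * c + 12"
    and deg: "\<And>x. x \<in> V \<Longrightarrow> x \<noteq> rt \<Longrightarrow> card (ch x) + 1 \<le> card (ch rt)"
  shows "\<exists>f. emb V f"
proof -
  define D where "D = card (ch rt)"
  have dom: "\<exists>f. emb V f" if "k + 2 * c + 1 \<le> 2 * D"
    "k + 3 * c \<le> 2 * D + 2 \<or> (\<exists>g. g \<in> V \<and> \<not> sg g \<and> 4 * c + k \<le> 2 * D + card (ch g))"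
    using embed_dominating_root[OF W kV] that c(1) unfolding D_def by simp
  have e: "card rest + D = k" using card_rest[OF kV] unfolding D_def .
  define S where "S = {x \<in> inner. \<not> sg x}"
  show ?thesis
  proof (cases "S = {}")
    case True
    have cl: "closed ({rt} \<union> ch rt)" using closed_Un_ch[OF closed_rt, of rt "ch rt"] by simp
    have "V \<subseteq> {rt} \<union> ch rt"
    proof (rule ccontr)
      assume "\<not> ?thesis"
      then obtain y where y: "y \<notin> {rt} \<union> ch rt" "y \<in> V" "y \<noteq> rt" "par y \<in> {rt} \<union> ch rt"
        using closed_step[OF cl closed_V] by blast
      have ych: "y \<in> ch (par y)" using chI y by blast
      hence "par y \<in> ch rt" using y by auto
      hence "\<not> sg (par y)" using sg_ch sg_rt by blast
      thus False using ch_inner[OF ych] True unfolding S_def by blast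
    qed
    hence "rest = {}" unfolding rest_def by blast
    hence "D = k" using e by simp
    thus ?thesis using c by (intro dom) auto
  next
    case False
    have finS: "finite S" unfolding S_def by simp
    define b where "b = Max ((\<lambda>x. card (ch x)) ` S)"
    have "b \<in> (\<lambda>x. card (ch x)) ` S" unfolding b_def using finS False by (intro Max_in) auto
    then obtain g where g: "g \<in> S" "b = card (ch g)" by blast
    have gmax: "card (ch x) \<le> card (ch g)" if "x \<in> inner" "\<not> sg x" for x
      using that finS unfolding g(2)[symmetric] b_def S_def by auto
    have gi: "g \<in> inner" "g \<in> V" "\<not> sg g" "g \<noteq> rt" using g(1) inner_sub sg_rt unfolding S_def by auto
    show ?thesis
    proof (cases "D + b + 3 * c + 1 \<le> k")
      case True
      show ?thesis
      proof (cases "2 * D \<le> k + 2 * c \<or> (2 * D + 3 \<le> k + 3 * c \<and> 2 * D + b < 4 * c + k)")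
        case small: True
        show ?thesis
          using embed_balanced[OF W kV c deg gi(1,3) gmax] True small unfolding D_def g(2) by blast
      next
        case False
        have "k + 2 * c + 1 \<le> 2 * D" using False by linarith
        moreover have "k + 3 * c \<le> 2 * D + 2 \<or> 4 * c + k \<le> 2 * D + card (ch g)" using False unfolding g(2) by linarith
        ultimately show ?thesis using gi by (intro dom) auto
      qed
    next
      case heavy: False
      show ?thesis
      proof (cases "2 * c + 1 \<le> b")
        case True
        show ?thesis
          using True heavy c deg[OF gi(2,4)] unfolding D_def g(2)
          by (intro embed_dominating_pair[OF W kV, of g]) (use gi in auto)
      next
        case False
        \<comment> \<open>Here b \<le> 2c, so D \<ge> k - 5c and 2D + b \<ge> 2k - b - 6c \<ge> 2k -
          8c; both claims now follow from k > 12c.\<close>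
        have "k + 2 * c + 1 \<le> 2 * D" "4 * c + k \<le> 2 * D + card (ch g)" using heavy False c(2) unfolding g(2) by linarith+
        thus ?thesis using gi by (intro dom) auto
      qed
    qed
  qed
qed

text \<open>For \<open>c = 0\<close> no two vertices share a neighbour, so the host has at most as many arcs as vertices.\<close>

theorem embed_tree_general:
  assumes W: "finite W" "R \<subseteq> W \<times> W" "(k - 1) * card W < card R" and kV: "card V = k + 1"
    and c: "12 * c < k" "k \<le> 12 * c + 12"
    and deg: "\<And>x. x \<in> V \<Longrightarrow> x \<noteq> rt \<Longrightarrow> card (ch x) + 1 \<le> card (ch rt)"
  shows "\<exists>f. emb V f"
proof (cases "1 \<le> c")
  case True
  thus ?thesis using embed_tree[OF W kV True c deg] by blast
next
  case c0: False
  have "k = 1"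
  proof (rule ccontr)
    assume "k \<noteq> 1"
    hence "1 * card W \<le> (k - 1) * card W" using c(1) by (intro mult_le_mono1) auto
    hence "card W < card R" using W(3) by linarith
    moreover have "inj_on fst R"
    proof (rule inj_onI, rule ccontr)
      fix p q assume pq: "p \<in> R" "q \<in> R" "fst p = fst q" "p \<noteq> q"
      have "(fst p, snd p) \<in> R" "(fst p, snd q) \<in> R" using pq(1,2) by simp (simp add: pq(2,3))
      hence "fst p \<in> nb R False (snd p) \<inter> nb R False (snd q)" unfolding nb_def by simp
      moreover have "snd p \<noteq> snd q" using pq(3,4) by (simp add: prod_eq_iff)
      hence "card (nb R False (snd p) \<inter> nb R False (snd q)) = 0"
        using common[of "snd p" "snd q" False False] c0 by linarith
      ultimately show False by (metis card_0_eq empty_iff fin_nb finite_Int)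
    qed
    hence "card R \<le> card W" using W(1,2) by (intro card_inj_on_le[of fst]) auto
    ultimately show False by simp
  qed
  hence V2: "card V = 2" using kV by simp
  then obtain y where y: "V = {rt, y}" "y \<noteq> rt" using rtV by (auto simp: card_2_iff)
  have py: "par y = rt" using y parV[of y] dep_par[of y] by auto
  have "R \<noteq> {}" using W(3) by auto
  then obtain u w where uw: "(u, w) \<in> R" by auto
  have "u \<noteq> w" using uw irrR by auto
  hence "emb (insert y {rt}) ((\<lambda>_. u)(y := w))"
    using y py uw sg_rt by (intro emb_extend[OF closed_rt emb_rt]) (auto simp: nb_def)
  thus ?thesis using y(1) by (auto simp: insert_commute)
qed

end

section \<open>From digraphs to rooted trees\<close>

text \<open>\<open>dep\<close> is the distance from the root and \<open>par\<close> a neighbour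
  closer to it. An edge that is not a parent edge would close a cycle with the path between its ends
  formed by parent edges.\<close>

lemma undirected_tree_rooting:
  assumes T: "undirected_tree (with_proj G)" and rt: "rt \<in> pverts G"
  obtains par and dep :: "'a \<Rightarrow> nat" where
    "\<And>x. x \<in> pverts G \<Longrightarrow> x \<noteq> rt \<Longrightarrow> (par x, x) \<in> parcs G \<and> dep (par x) < dep x"
    "\<And>x y. (x, y) \<in> parcs G \<Longrightarrow> (x \<noteq> rt \<and> par x = y) \<or> (y \<noteq> rt \<and> par y = x)"
proof -
  let ?G = "with_proj G" and ?U = "parcs G"
  interpret graph ?G using T unfolding undirected_tree_def by blast
  have sym: "(y, x) \<in> ?U" if "(x, y) \<in> ?U" for x y using sym_arcs that unfolding symmetric_def sym_def by simp
  have irr: "x \<noteq> y" if "(x, y) \<in> ?U" for x y using no_loops[of "(x, y)"] that by simp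
  have ver: "x \<in> pverts G" "y \<in> pverts G" if "(x, y) \<in> ?U" for x y
    using wellformed[of "(x, y)"] that by auto
  have reach: "(rt, x) \<in> ?U\<^sup>*" if "x \<in> pverts G" for x
  proof -
    have "rt \<rightarrow>\<^sup>*\<^bsub>with_proj (mk_symmetric ?G)\<^esub> x"
      using T rt that unfolding undirected_tree_def connected_def strongly_connected_def by simp
    hence "rt \<rightarrow>\<^sup>*\<^bsub>?G\<^esub> x" using reachable_mk_symmetric_eq[OF sym_arcs] by blast
    thus ?thesis using reachable_rtranclI[of ?G rt x] by simp
  qed
  define dep where "dep x = (LEAST n. (rt, x) \<in> ?U ^^ n)" for x
  have par_ex: "\<exists>p. (p, x) \<in> ?U \<and> dep p < dep x" if "x \<in> pverts G" "x \<noteq> rt" for x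
  proof -
    have "\<exists>n. (rt, x) \<in> ?U ^^ n" using rtrancl_imp_relpow[OF reach[OF that(1)]] by blast
    hence d: "(rt, x) \<in> ?U ^^ dep x" unfolding dep_def by (rule LeastI_ex)
    have "dep x \<noteq> 0"
    proof
      assume "dep x = 0"
      thus False using d that(2) by simp
    qed
    then obtain m where m: "dep x = Suc m" using not0_implies_Suc by blast
    then obtain p where p: "(rt, p) \<in> ?U ^^ m" "(p, x) \<in> ?U" using d by auto
    have "dep p \<le> m" unfolding dep_def using p(1) by (rule Least_le)
    thus ?thesis using p(2) m by auto
  qed
  define par where "par x = (SOME p. (p, x) \<in> ?U \<and> dep p < dep x)" for x
  have par: "(par x, x) \<in> ?U" "dep (par x) < dep x" if "x \<in> pverts G" "x \<noteq> rt" for x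
    using someI_ex[OF par_ex[OF that]] unfolding par_def by auto
  have "(x \<noteq> rt \<and> par x = y) \<or> (y \<noteq> rt \<and> par y = x)" if xy: "(x, y) \<in> ?U" for x y
  proof (rule ccontr)
    assume neg: "\<not> ?thesis"
    \<comment> \<open>\<open>H\<close> keeps the parent edges only, so a path in \<open>H\<close>
      from \<open>x\<close> to \<open>y\<close> avoids the edge under consideration.\<close>
    define H where "H = with_proj \<lparr>pverts = pverts G, parcs = {(a, b) \<in> ?U. (a \<noteq> rt \<and> par a = b) \<or> (b \<noteq> rt \<and> par b = a)}\<rparr>"
    have Hs: "verts H = pverts G" "arcs H = {(a, b) \<in> ?U. (a \<noteq> rt \<and> par a = b) \<or> (b \<noteq> rt \<and> par b = a)}"
      "tail H = fst" "head H = snd" "arcs_ends H = arcs H" unfolding H_def by simp_all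
    interpret H: wf_digraph H by unfold_locales (auto simp: Hs dest: ver)
    have symH: "symmetric H" unfolding symmetric_def sym_def Hs(5) Hs(2) using sym by auto
    have up: "a \<rightarrow>\<^sup>*\<^bsub>H\<^esub> rt" if "a \<in> pverts G" for a
      using that
    proof (induction "dep a" arbitrary: a rule: less_induct)
      case less
      show ?case
      proof (cases "a = rt")
        case True
        thus ?thesis using less.prems H.reachable_refl Hs(1) by blast
      next
        case False
        note p = par[OF less.prems False]
        have "(a, par a) \<in> arcs_ends H" unfolding Hs(5) Hs(2) using sym[OF p(1)] False by auto
        moreover have "par a \<rightarrow>\<^sup>*\<^bsub>H\<^esub> rt" using less.hyps[OF p(2)] ver(1)[OF p(1)] by blast
        ultimately show ?thesis by (rule H.adj_reachable_trans)
      qed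
    qed
    have "x \<rightarrow>\<^sup>*\<^bsub>H\<^esub> y"
      using up[OF ver(1)[OF xy]] symmetric_reachable[OF symH up[OF ver(2)[OF xy]]] by (rule H.reachable_trans)
    then obtain p where pH: "H.apath x p y" using H.reachable_apath by blast
    have pset: "set p \<subseteq> arcs H" using pH unfolding H.apath_def H.awalk_def by blast
    have "subgraph H ?G" unfolding subgraph_def compatible_def using H.wf_digraph wf_digraph by (auto simp: Hs)
    hence p: "apath x p y" using subgraph_apath_imp_apath[OF pH] by blast
    have aw: "awalk x p y" "cas x p y" "distinct (awalk_verts x p)" using p unfolding apath_def awalk_def by auto
    have p0: "p \<noteq> []" using aw(1) irr[OF xy] by (auto simp: awalk_Nil_iff)
    \<comment> \<open>The path is neither empty nor the single arc \<open>(x, y)\<close>, so closing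
      it yields a cycle of length at least 3, the only kind that \<open>undirected_tree\<close>
      excludes.\<close>
    have "length p \<noteq> 1"
    proof
      assume "length p = 1"
      then obtain e where e: "p = [e]" by (auto simp: length_Suc_conv)
      hence "e = (x, y)" using aw(2) by (auto simp: prod_eq_iff)
      thus False using pset neg unfolding e Hs(2) by auto
    qed
    hence len: "3 \<le> length (p @ [(y, x)])" using p0 by (cases p) (auto simp: Suc_le_eq)
    have yx: "awalk y [(y, x)] x" using sym[OF xy] ver[OF xy] by (simp add: awalk_simps)
    have w: "awalk x (p @ [(y, x)]) x" using awalk_appendI[OF aw(1) yx] .
    hence "cas x (p @ [(y, x)]) x" unfolding awalk_def by blast
    hence "tl (awalk_verts x (p @ [(y, x)])) = map snd p @ [x]" by (subst awalk_verts_conv') auto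
    moreover have "awalk_verts x p = x # map snd p"
      using awalk_verts_conv'[OF aw(2)] p0 aw(2) by (cases p) auto
    ultimately have "distinct (tl (awalk_verts x (p @ [(y, x)])))" using aw(3) by simp
    hence "cycle (p @ [(y, x)])" unfolding cycle_def using w by blast
    thus False using T len unfolding undirected_tree_def by blast
  qed
  thus ?thesis using that[of par dep] par by blast
qed

text \<open>If u and w had s common neighbours in the directions \<open>\<sigma>\<close> and
  \<open>\<tau>\<close>, they would span a forbidden orientation: equal signs give the two uniform
  ones, different signs the mixed one.\<close>

lemma K2s_free_common:
  assumes D: "digraph D" "K2s_free s D" and uw: "u \<noteq> w" and s: "1 \<le> s"
  shows "card (nb (arcs_ends D) \<sigma> u \<inter> nb (arcs_ends D) \<tau> w) \<le> s - 1"
proof (rule ccontr)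
  interpret digraph D by (rule D(1))
  let ?R = "arcs_ends D"
  assume "\<not> ?thesis"
  hence "s \<le> card (nb ?R \<sigma> u \<inter> nb ?R \<tau> w)" using s by linarith
  then obtain S where S: "S \<subseteq> nb ?R \<sigma> u \<inter> nb ?R \<tau> w" "card S = s" "finite S"
    by (meson obtain_subset_with_card_n)
  have irr: "(x, x) \<notin> ?R" for x using no_loops unfolding arcs_ends_conv by auto
  have inV: "x \<in> verts D \<and> y \<in> verts D" if "(x, y) \<in> ?R" for x y using that by auto
  have dis: "u \<notin> S" "w \<notin> S" using S(1) irr unfolding nb_def by (auto split: if_splits)
  obtain x0 where x0: "x0 \<in> S" using S(2) s by (metis card.empty ex_in_conv not_one_le_zero)
  have Ru: "if \<sigma> then (u, x) \<in> ?R else (x, u) \<in> ?R" and Rw: "if \<tau> then (w, x) \<in> ?R else (x, w) \<in> ?R" if "x \<in> S" for x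
    using S(1) that unfolding nb_def by (auto split: if_splits)
  have V: "{u, w} \<union> S \<subseteq> verts D"
    using Ru Rw inV x0 by (auto split: if_splits) (metis inV)+
  \<comment> \<open>\<open>D\<close> may contain both arcs between two vertices. \<open>E\<close>
    keeps only those in the chosen directions, which makes the subdigraph oriented.\<close>
  define E where "E = (if \<sigma> then {u} \<times> S else S \<times> {u}) \<union> (if \<tau> then {w} \<times> S else S \<times> {w})"
  have ER: "E \<subseteq> ?R" unfolding E_def using Ru Rw by (auto split: if_splits)
  define H where "H = \<lparr>verts = {u, w} \<union> S, arcs = {a \<in> arcs D. (tail D a, head D a) \<in> E}, tail = tail D, head = head D\<rparr>"
  have Hs: "verts H = {u, w} \<union> S" "arcs H = {a \<in> arcs D. (tail D a, head D a) \<in> E}" "tail H = tail D" "head H = head D"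
    unfolding H_def by auto
  have EH: "arcs_ends H = E"
  proof
    show "arcs_ends H \<subseteq> E" unfolding arcs_ends_conv Hs by auto
    show "E \<subseteq> arcs_ends H"
    proof
      fix e assume e: "e \<in> E"
      then obtain a where "a \<in> arcs D" "e = (tail D a, head D a)" using ER unfolding arcs_ends_conv by blast
      thus "e \<in> arcs_ends H" unfolding arcs_ends_conv Hs using e by auto
    qed
  qed
  have EV: "x \<in> {u, w} \<union> S \<and> y \<in> {u, w} \<union> S" if "(x, y) \<in> E" for x y using that unfolding E_def by (auto split: if_splits)
  have wf: "wf_digraph H" by unfold_locales (auto simp: Hs dest: EV)
  have sub: "subgraph H D" unfolding subgraph_def compatible_def using wf V by (auto simp: Hs wf_digraph)
  have dig: "digraph H" using sub by (rule digraph_subgraph)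
  have "asym E" using uw dis unfolding E_def by (auto intro!: asymI split: if_splits)
  hence ori: "oriented_graph H" unfolding oriented_graph_def EH using dig by blast
  have "arcs_ends (with_proj (mk_symmetric H)) = E \<union> E\<inverse>"
    unfolding EH[symmetric] arcs_ends_conv[of H] by (auto simp: parcs_mk_symmetric)
  also have "\<dots> = {u, w} \<times> S \<union> S \<times> {u, w}" unfolding E_def by (auto split: if_splits)
  finally have ends: "arcs_ends (with_proj (mk_symmetric H)) = {u, w} \<times> S \<union> S \<times> {u, w}" .
  have deg: "out_degree H x = 0 \<or> in_degree H x = 0" if "x \<in> {u, w}" for x
  proof -
    have "out_arcs H x = {} \<or> in_arcs H x = {}"
      using that uw dis unfolding out_arcs_def in_arcs_def Hs E_def by (cases \<sigma>; cases \<tau>) auto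
    thus ?thesis unfolding out_degree_def in_degree_def by auto
  qed
  have "K2s_orientation s H" unfolding K2s_orientation_def
  proof (rule conjI[OF ori], rule exI[of _ "{u, w}"], rule exI[of _ S], intro conjI ballI)
    show "card {u, w} = 2" using uw by simp
    show "{u, w} \<inter> S = {}" using dis by simp
  qed (use Hs(1) S(2) ends deg in \<open>simp_all only:\<close>)
  thus False using D(2) sub unfolding K2s_free_def by blast
qed

text \<open>Signs are taken relative to the root, so that the root has sign \<open>True\<close> in
  any case. Replacing \<open>R\<close> by its converse is harmless since \<open>common\<close>
  covers all combinations of signs and the arc count is unchanged.\<close>

lemma antidirected_tree_embedding:
  assumes T: "antidirected_tree T" "card (arcs T) = k" and k: "1 \<le> k"
    and R: "finite W" "R \<subseteq> W \<times> W" "(k - 1) * card W < card R" "\<And>u. (u, u) \<notin> R"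
    and common: "\<And>u w \<sigma> \<tau>. u \<noteq> w \<Longrightarrow> card (nb R \<sigma> u \<inter> nb R \<tau> w) \<le> c"
    and c: "12 * c < k" "k \<le> 12 * c + 12"
  obtains f where "inj_on f (verts T)" "\<And>x y. x \<rightarrow>\<^bsub>T\<^esub> y \<Longrightarrow> (f x, f y) \<in> R" "f ` verts T \<subseteq> W"
proof -
  let ?S = "arcs_ends T" and ?G = "mk_symmetric T" and ?V = "verts T"
  interpret digraph T using T unfolding antidirected_tree_def oriented_graph_def by blast
  have asym: "(y, x) \<notin> ?S" if "(x, y) \<in> ?S" for x y
    using T that unfolding antidirected_tree_def oriented_graph_def by (blast dest: asymD)
  have irr: "x \<noteq> y" if "(x, y) \<in> ?S" for x y using that no_loops unfolding arcs_ends_conv by auto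
  have SV: "x \<in> ?V \<and> y \<in> ?V" if "(x, y) \<in> ?S" for x y using that by auto
  have U: "parcs ?G = ?S \<union> ?S\<inverse>" unfolding arcs_ends_conv by (auto simp: parcs_mk_symmetric)
  have tree: "undirected_tree (with_proj ?G)" using T unfolding antidirected_tree_def by blast
  define src where "src x \<longleftrightarrow> (\<exists>y. (x, y) \<in> ?S)" for x
  have src: "src x" "\<not> src y" if xy: "(x, y) \<in> ?S" for x y
  proof -
    show "src x" using xy unfolding src_def by blast
    show "\<not> src y"
    proof
      assume "src y"
      then obtain w where w: "(y, w) \<in> ?S" unfolding src_def by blast
      obtain a b where a: "a \<in> arcs T" "tail T a = x" "head T a = y" and b: "b \<in> arcs T" "tail T b = y" "head T b = w"
        using xy w unfolding arcs_ends_conv by auto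
      \<comment> \<open>By asymmetry the second arc does not return to \<open>x\<close>; two
        consecutive arcs are thus a genuine path of length two, which an antidirected tree
        lacks.\<close>
      have "x \<noteq> w" using asym[OF xy] w by auto
      hence "apath x [a, b] w" using a b irr[OF xy] irr[OF w] by (auto simp: apath_simps)
      moreover have "length [a, b] = 2" by simp
      ultimately show False using T unfolding antidirected_tree_def by blast
    qed
  qed
  define N where "N x = {y. (x, y) \<in> ?S \<union> ?S\<inverse>}" for x
  have NV: "N x \<subseteq> ?V" for x unfolding N_def using SV by auto
  have finN: "finite (N x)" for x using finite_subset[OF NV] by simp
  have "?V \<noteq> {}" using tree unfolding undirected_tree_def connected_def strongly_connected_def by simp
  hence "Max ((\<lambda>x. card (N x)) ` ?V) \<in> (\<lambda>x. card (N x)) ` ?V" by (intro Max_in) auto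
  then obtain rt where rt: "rt \<in> ?V" and rtM: "Max ((\<lambda>x. card (N x)) ` ?V) = card (N rt)" by blast
  have rtmax: "card (N x) \<le> card (N rt)" if "x \<in> ?V" for x
    unfolding rtM[symmetric] using that by (intro Max_ge) auto
  obtain par and dep :: "_ \<Rightarrow> nat" where
    par: "\<And>x. x \<in> ?V \<Longrightarrow> x \<noteq> rt \<Longrightarrow> (par x, x) \<in> ?S \<union> ?S\<inverse> \<and> dep (par x) < dep x" and
    edge: "\<And>x y. (x, y) \<in> ?S \<union> ?S\<inverse> \<Longrightarrow> (x \<noteq> rt \<and> par x = y) \<or> (y \<noteq> rt \<and> par y = x)"
    using undirected_tree_rooting[OF tree, of rt] rt U by auto
  define sg where "sg x \<longleftrightarrow> (src x \<longleftrightarrow> src rt)" for x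
  define R' where "R' = (if src rt then R else R\<inverse>)"
  have nbR: "nb R' \<sigma> u = nb R (\<sigma> \<longleftrightarrow> src rt) u" for \<sigma> u unfolding nb_def R'_def by auto
  have finR: "finite R" using finite_subset[OF R(2)] R(1) by simp
  interpret rooted_tree ?V rt par dep
    by unfold_locales (use rt par SV in fastforce)+
  interpret tree_host ?V rt par dep sg R' c
  proof unfold_locales
    show "sg rt" unfolding sg_def by simp
    show "sg x \<longleftrightarrow> \<not> sg (par x)" if "x \<in> ?V" "x \<noteq> rt" for x
      using par[OF that] src[of x "par x"] src[of "par x" x] unfolding sg_def by auto
    show "finite R'" using finR unfolding R'_def by simp
    show "(u, u) \<notin> R'" for u using R(4) unfolding R'_def by simp
    show "card (nb R' \<sigma> u \<inter> nb R' \<tau> w) \<le> c" if "u \<noteq> w" for u w \<sigma> \<tau> unfolding nbR using common[OF that] .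
  qed
  have chN: "ch x = N x - (if x = rt then {} else {par x})" if "x \<in> ?V" for x
  proof -
    have "y \<in> N x" "x = rt \<or> y \<noteq> par x" if y: "y \<in> ch x" for y
    proof -
      have "y \<in> ?V" "y \<noteq> rt" "par y = x" using chD[OF y] by auto
      thus "y \<in> N x" using par[of y] unfolding N_def by auto
      show "x = rt \<or> y \<noteq> par x" using ch_not_par[OF y] chI[OF \<open>x \<in> ?V\<close>] by auto
    qed
    moreover have "y \<in> ch x" if "y \<in> N x" "x = rt \<or> y \<noteq> par x" for y
      using edge[of x y] that NV[of x] unfolding N_def ch_def by auto
    ultimately show ?thesis by auto
  qed
  \<comment> \<open>At the root every neighbour is a child, elsewhere one neighbour is the parent. A
    root of maximum degree therefore has strictly more children than any other vertex.\<close>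
  have deg: "card (ch x) + 1 \<le> card (ch rt)" if x: "x \<in> ?V" "x \<noteq> rt" for x
  proof -
    have "par x \<in> N x" using par[OF x] unfolding N_def by auto
    hence "card (N x - {par x}) + 1 = card (N x)" using finN card_Suc_Diff1[of "N x" "par x"] by simp
    thus ?thesis using rtmax[OF x(1)] chN[OF x(1)] chN[OF rt] x(2) by simp
  qed
  have cardV: "card ?V = k + 1"
  proof -
    have "k = card ?S" unfolding arcs_ends_def T(2)[symmetric]
      by (rule card_image[symmetric]) (auto intro!: inj_onI no_multi_arcs)
    also have "card ?S = card (?V - {rt})"
    proof (rule bij_betw_same_card[symmetric])
      \<comment> \<open>Every arc joins exactly one vertex other than the root to its parent,
        oriented from the source to the sink.\<close>
      let ?h = "\<lambda>y. if src y then (y, par y) else (par y, y)"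
      have h: "?h y \<in> ?S" if "y \<in> ?V - {rt}" for y using par[of y] that src[of y "par y"] src[of "par y" y] by auto
      have "inj_on ?h (?V - {rt})"
      proof (rule inj_onI)
        fix y y' assume y: "y \<in> ?V - {rt}" "y' \<in> ?V - {rt}" "?h y = ?h y'"
        show "y = y'" using y(3) par[of y] par[of y'] y(1,2) by (auto split: if_splits)
      qed
      moreover have "?S \<subseteq> ?h ` (?V - {rt})"
      proof
        fix e assume e: "e \<in> ?S"
        obtain x y where xy: "e = (x, y)" by fastforce
        note s = src[OF e[unfolded xy]] SV[OF e[unfolded xy]]
        have "(x \<noteq> rt \<and> par x = y) \<or> (y \<noteq> rt \<and> par y = x)" using edge[of x y] e xy by auto
        thus "e \<in> ?h ` (?V - {rt})"
        proof
          assume "x \<noteq> rt \<and> par x = y"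
          thus ?thesis using s xy by (intro image_eqI[of _ _ x]) auto
        next
          assume "y \<noteq> rt \<and> par y = x"
          thus ?thesis using s xy by (intro image_eqI[of _ _ y]) auto
        qed
      qed
      ultimately show "bij_betw ?h (?V - {rt}) ?S" unfolding bij_betw_def using h by blast
    qed
    finally show ?thesis using rt k card_Suc_Diff1[of ?V rt] by simp
  qed
  have cR: "card R' = card R" unfolding R'_def by (simp add: card_inverse)
  have "R' \<subseteq> W \<times> W" using R(2) unfolding R'_def by auto
  then obtain f where f: "emb ?V f"
    using embed_tree_general[OF R(1) _ _ cardV c deg] R(3) cR by auto
  have hom: "(f x, f y) \<in> R" if xy: "(x, y) \<in> ?S" for x y
  proof -
    note s = src[OF xy] SV[OF xy]
    have e: "f w \<in> nb R (src (par w)) (f (par w))" if "w \<in> ?V" "w \<noteq> rt" for w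
    proof -
      have "f w \<in> nb R' (sg (par w)) (f (par w))" using f that unfolding emb_def by blast
      moreover have "(sg (par w) \<longleftrightarrow> src rt) = src (par w)" unfolding sg_def by auto
      ultimately show ?thesis unfolding nbR by simp
    qed
    have "(x \<noteq> rt \<and> par x = y) \<or> (y \<noteq> rt \<and> par y = x)" using edge[of x y] xy by auto
    thus ?thesis using e[of x] e[of y] s unfolding nb_def by auto
  qed
  have "f x \<in> W" if x: "x \<in> ?V" for x
  proof -
    have "N x \<noteq> {}"
    proof (cases "x = rt")
      case True
      have "\<not> ?V \<subseteq> {rt}" using cardV k card_mono[of "{rt}" ?V] by auto
      then obtain y where "y \<in> ?V" "y \<noteq> rt" by blast
      hence "ch rt \<noteq> {}" using deg[of y] by auto
      thus ?thesis using chN[OF rt] True by auto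
    qed (use par[OF x] in \<open>auto simp: N_def\<close>)
    then obtain y where "(x, y) \<in> ?S \<or> (y, x) \<in> ?S" unfolding N_def by auto
    thus ?thesis using hom R(2) by blast
  qed
  moreover have "inj_on f ?V" using f unfolding emb_def by blast
  ultimately show ?thesis using that[of f] hom by blast
qed

theorem theorem1p2:
  fixes k s n :: nat
    and D :: "('a,'b) pre_digraph"
    and T :: "('c,'d) pre_digraph"
  assumes "s = nat \<lceil>real k / 12\<rceil>"
    and "digraph D"
    and "K2s_free s D"
    and "card (verts D) = n"
    and "int (card (arcs D)) > (int k - 1) * int n"
    and "antidirected_tree T"
    and "card (arcs T) = k"
  shows "contains_digraph D T"
proof -
  interpret D: digraph D by (rule assms(2))
  interpret T: digraph T using assms(6) unfolding antidirected_tree_def oriented_graph_def by blast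
  let ?R = "arcs_ends D"
  have RW: "?R \<subseteq> verts D \<times> verts D" by auto
  have cR: "card ?R = card (arcs D)" unfolding arcs_ends_def
    by (rule card_image) (auto intro!: inj_onI D.no_multi_arcs)
  show ?thesis
  proof (cases "k = 0")
    case True
    have "arcs T = {}" using assms(7) True by simp
    hence noarc: "parcs (mk_symmetric T) = {}" "arcs_ends T = {}" by (auto simp: parcs_mk_symmetric arcs_ends_def)
    have tree: "undirected_tree (with_proj (mk_symmetric T))" using assms(6) unfolding antidirected_tree_def by blast
    have single: "x = y" if xy: "x \<in> verts T" "y \<in> verts T" for x y
    proof (rule ccontr)
      assume "x \<noteq> y"
      have x: "x \<in> pverts (mk_symmetric T)" using xy(1) by simp
      show False
        by (rule undirected_tree_rooting[OF tree x]) (use xy \<open>x \<noteq> y\<close> noarc in auto)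
    qed
    \<comment> \<open>For k = 0 the tree is a single vertex, and the arc bound, with -n on its
      right-hand side, says just that \<open>D\<close> has a vertex.\<close>
    have "verts D \<noteq> {}"
    proof
      assume V: "verts D = {}"
      hence "arcs D = {}" using D.tail_in_verts by blast
      thus False using V assms(4,5) by simp
    qed
    then obtain u where "u \<in> verts D" by blast
    thus ?thesis unfolding contains_digraph_def using single noarc(2)
      by (intro exI[of _ "\<lambda>_. u"]) (auto intro!: inj_onI)
  next
    case False
    \<comment> \<open>Two distinct vertices share at most s - 1 neighbours, and the ceiling
      translates into \<open>12 * c < k \<le> 12 * c + 12\<close>.\<close>
    define c where "c = s - 1"
    have "real k / 12 \<le> of_int \<lceil>real k / 12\<rceil>" "of_int \<lceil>real k / 12\<rceil> < real k / 12 + 1" by linarith+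
    moreover have "\<lceil>real k / 12\<rceil> = int s" using assms(1) by simp
    ultimately have "real k \<le> 12 * real s" "12 * real s < real k + 12" by auto
    hence s: "k \<le> 12 * s" "12 * s < k + 12" by linarith+
    have s1: "1 \<le> s" using s(1) False by linarith
    have c: "12 * c < k" "k \<le> 12 * c + 12" using s s1 unfolding c_def by linarith+
    have "(int k - 1) * int n = int ((k - 1) * n)" using False by (simp add: of_nat_diff)
    hence dense: "(k - 1) * card (verts D) < card ?R" unfolding assms(4) cR using assms(5) by linarith
    have irr: "(u, u) \<notin> ?R" for u using D.no_loops unfolding arcs_ends_conv by auto
    have common: "card (nb ?R \<sigma> u \<inter> nb ?R \<tau> w) \<le> c" if "u \<noteq> w" for u w \<sigma> \<tau>
      unfolding c_def using K2s_free_common[OF assms(2,3) that s1] .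
    obtain f where "inj_on f (verts T)" "\<And>x y. x \<rightarrow>\<^bsub>T\<^esub> y \<Longrightarrow> (f x, f y) \<in> ?R" "f ` verts T \<subseteq> verts D"
      using antidirected_tree_embedding[OF assms(6,7) _ D.finite_verts RW dense irr common c] False by auto
    thus ?thesis unfolding contains_digraph_def by blast
  qed
qed

end
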